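(* Let $\sigma>1$, $s=\sigma-1$, and let $m\in C^\infty(\mathbb{R}^3)$, $m\ge0$, be a weight satisfying $$\partial_\xi m(x,\xi,\eta)-x\,\partial_\eta m(x,\xi,\eta)=\left(x\,a(\xi,\eta)+b(\xi,\eta)\right)m(x,\xi,\eta)$$ for some $a,b\in G^\sigma(\mathbb{R}^2)$. Let $0<\alpha\le1$, $C_0>0$, $0<\varepsilon<1$, and let $\gamma>0$ be small enough, with $\gamma\ge\varepsilon^2/4$ and $x_{\varepsilon,\gamma}\le1$. Then there is a constant $M>0$ depending on $C_0$ and $s$ such that for every $f:\mathbb{R}^2\to\mathbb{C}$ with $\|f\|_{C^{0,\alpha}(\mathbb{R}^2)}\le C_0$ and $\operatorname{supp}f\subset\{(x,y):y\ge x^2\}$, $$\|f(\cdot,\gamma)\,m(\cdot,0,\gamma)\|_2\le M\,\frac{\left(\log\log\left(\|R_m[f]\|_{\varepsilon,\gamma}^{-1}\right)\right)^{2\alpha}}{\left(\log\left(\|R_m[f]\|_{\varepsilon,\gamma}^{-1}\right)\right)^{\alpha}}$$ for small $\|R_m[f]\|_{\varepsilon,\gamma}$. (The right-hand side is read as $0$ when $\|R_m[f]\|_{\varepsilon,\gamma}=0$.)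
   Context: Gevrey classes: for open $\Omega\subset\mathbb{R}^n$ and $\sigma\ge1$, $G^\sigma(\Omega)$ is the set of $g\in C^\infty(\Omega)$ such that for every compact $K\subset\Omega$ there is $C>0$ with $|\partial^\beta g|\le C^{|\beta|+1}(\beta!)^\sigma$ on $K$ for all multi-indices $\beta$. Hölder seminorm: $\|f\|_{C^{0,\alpha}(\mathbb{R}^2)}=\sup_{p\ne q}|f(p)-f(q)|/\|p-q\|^\alpha$. Weighted Radon transform: $R_m[f](\xi,\eta)=\int_{\mathbb{R}}f(x,\xi x+\eta)m(x,\xi,\eta)\,dx$. $x_{\varepsilon,\gamma}$ is the positive solution of $x^2=\varepsilon x+\gamma$. $\|\cdot\|_2$ is the norm of $L^2([-1,1])$. Data norm: $R_{\varepsilon,\gamma}=\{(\xi,\eta):|\xi|\le\varepsilon,|\eta|<\gamma\}$, and $\|\cdot\|_{\varepsilon,\gamma}$ is a fixed family of norms, increasing in $\varepsilon$ and $\gamma$, such that for some absolute constant $c>0$, $\|g\|_{\varepsilon,\gamma}\ge c\max\{\|g\|_{L^1(R_{\varepsilon,\gamma})},\|g(\cdot,\gamma)\|_{L^1[-\varepsilon,\varepsilon]}\}$; for example $\|g\|_{\varepsilon,\gamma}=\sup_{|\eta|\le\gamma}\|g(\cdot,\eta)\|_{L^1[-\varepsilon,\varepsilon]}$. The weight $m$ is fixed, and constants may depend on it. "Small" means below a positive threshold not depending on $f$. *)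

theory Defs
  imports "HOL-Analysis.Analysis"
begin

section \<open>Smooth functions and Gevrey classes\<close>

definition partial_deriv ::
  "'a::euclidean_space \<Rightarrow> ('a \<Rightarrow> 'b::real_normed_vector) \<Rightarrow> 'a \<Rightarrow> 'b" where
  "partial_deriv v g = (\<lambda>p. frechet_derivative g (at p) v)"

text \<open>
  A multi-index is represented by a list \<open>vs\<close> of standard basis vectors: the entry \<open>\<beta> i\<close> is the
  number of occurrences of the basis vector \<open>i\<close> in \<open>vs\<close>, so the order of the multi-index is
  \<open>length vs\<close>.  Lists that differ only by a permutation give the same derivative of a smooth
  function, so quantifying over lists is the same as quantifying over multi-indices.
\<close>

fun iter_partial ::
  "'a::euclidean_space list \<Rightarrow> ('a \<Rightarrow> 'b::real_normed_vector) \<Rightarrow> 'a \<Rightarrow> 'b" where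
  "iter_partial [] g = g"
| "iter_partial (v # vs) g = partial_deriv v (iter_partial vs g)"

definition multi_fact :: "'a::euclidean_space list \<Rightarrow> real" where
  "multi_fact vs = (\<Prod>i\<in>Basis. fact (count_list vs i))"

text \<open>The following two notions are meant for open \<open>\<Omega>\<close>.\<close>

definition smooth_on ::
  "'a::euclidean_space set \<Rightarrow> ('a \<Rightarrow> 'b::real_normed_vector) \<Rightarrow> bool" where
  "smooth_on \<Omega> g \<longleftrightarrow> (\<forall>vs\<in>lists Basis. iter_partial vs g differentiable_on \<Omega>)"

definition gevrey ::
  "real \<Rightarrow> 'a::euclidean_space set \<Rightarrow> ('a \<Rightarrow> 'b::real_normed_vector) set" where
  "gevrey \<sigma> \<Omega> = {g. smooth_on \<Omega> g \<and>
     (\<forall>K. compact K \<and> K \<subseteq> \<Omega> \<longrightarrow>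
       (\<exists>C>0. \<forall>vs\<in>lists Basis. \<forall>p\<in>K.
          norm (iter_partial vs g p) \<le> C ^ (length vs + 1) * multi_fact vs powr \<sigma>))}"


section \<open>Norms of functions\<close>

definition holder_seminorm :: "real \<Rightarrow> (real \<times> real \<Rightarrow> complex) \<Rightarrow> ennreal" where
  "holder_seminorm \<alpha> f =
     (SUP (p, q) \<in> {(p, q). p \<noteq> q}. ennreal (norm (f p - f q) / norm (p - q) powr \<alpha>))"

text \<open>Only used for continuous functions, which are square integrable on \<open>[-1, 1]\<close>.\<close>

definition L2_norm :: "(real \<Rightarrow> complex) \<Rightarrow> real" where
  "L2_norm h = sqrt (LINT x:{-1..1}|lborel. (norm (h x))\<^sup>2)"


section \<open>The weighted Radon transform\<close>

definition weighted_radon ::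
  "(real \<times> real \<times> real \<Rightarrow> real) \<Rightarrow> (real \<times> real \<Rightarrow> complex) \<Rightarrow> real \<times> real \<Rightarrow> complex" where
  "weighted_radon m f =
     (\<lambda>(\<xi>, \<eta>). LINT x|lborel. f (x, \<xi> * x + \<eta>) * complex_of_real (m (x, \<xi>, \<eta>)))"

definition pos_root :: "real \<Rightarrow> real \<Rightarrow> real" where
  "pos_root \<epsilon> \<gamma> = (THE x. x > 0 \<and> x\<^sup>2 = \<epsilon> * x + \<gamma>)"


section \<open>Data norms\<close>

definition data_rect :: "real \<Rightarrow> real \<Rightarrow> (real \<times> real) set" where
  "data_rect \<epsilon> \<gamma> = {(\<xi>, \<eta>). \<bar>\<xi>\<bar> \<le> \<epsilon> \<and> \<bar>\<eta>\<bar> < \<gamma>}"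

definition closed_rect :: "real \<Rightarrow> real \<Rightarrow> (real \<times> real) set" where
  "closed_rect \<epsilon> \<gamma> = {(\<xi>, \<eta>). \<bar>\<xi>\<bar> \<le> \<epsilon> \<and> \<bar>\<eta>\<bar> \<le> \<gamma>}"

definition L1_rect :: "real \<Rightarrow> real \<Rightarrow> (real \<times> real \<Rightarrow> complex) \<Rightarrow> ennreal" where
  "L1_rect \<epsilon> \<gamma> g = (\<integral>\<^sup>+p\<in>data_rect \<epsilon> \<gamma>. ennreal (norm (g p)) \<partial>lborel)"

definition L1_slice :: "real \<Rightarrow> real \<Rightarrow> (real \<times> real \<Rightarrow> complex) \<Rightarrow> ennreal" where
  "L1_slice \<epsilon> \<eta> g = (\<integral>\<^sup>+\<xi>\<in>{-\<epsilon>..\<epsilon>}. ennreal (norm (g (\<xi>, \<eta>))) \<partial>lborel)"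

text \<open>
  \<open>norm_on_rect \<epsilon> \<gamma> n\<close>: \<open>n\<close> is a norm on continuous functions on the closed rectangle (the closed
  one because the values at \<open>\<eta> = \<gamma>\<close> matter).  The value \<open>\<infinity>\<close> is allowed, for functions outside the
  normed space under consideration; thus norms that are finite only on smoother functions are
  included.  Functions are total in HOL, so the first clause says that \<open>n\<close> only looks at the
  restriction to the rectangle.  With \<open>0 * \<infinity> = 0\<close>, homogeneity also gives \<open>n 0 = 0\<close>.
\<close>

definition norm_on_rect ::
  "real \<Rightarrow> real \<Rightarrow> ((real \<times> real \<Rightarrow> complex) \<Rightarrow> ennreal) \<Rightarrow> bool" where
  "norm_on_rect \<epsilon> \<gamma> n \<longleftrightarrow>
     (\<forall>g h. (\<forall>p\<in>closed_rect \<epsilon> \<gamma>. g p = h p) \<longrightarrow> n g = n h) \<and>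
     (\<forall>g. continuous_on (closed_rect \<epsilon> \<gamma>) g \<longrightarrow> n g = 0 \<longrightarrow> (\<forall>p\<in>closed_rect \<epsilon> \<gamma>. g p = 0)) \<and>
     (\<forall>z g. continuous_on (closed_rect \<epsilon> \<gamma>) g \<longrightarrow> n (\<lambda>p. z * g p) = ennreal (norm z) * n g) \<and>
     (\<forall>g h. continuous_on (closed_rect \<epsilon> \<gamma>) g \<longrightarrow> continuous_on (closed_rect \<epsilon> \<gamma>) h \<longrightarrow>
        n (\<lambda>p. g p + h p) \<le> n g + n h)"

text \<open>
  The parameters are restricted to \<open>0 < \<epsilon>, \<gamma> < 1\<close>, a range that contains all pairs with
  \<open>pos_root \<epsilon> \<gamma> \<le> 1\<close>: for the standard example, the supremum over \<open>\<bar>\<eta>\<bar> \<le> \<gamma>\<close> of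
  \<open>L1_slice \<epsilon> \<eta> g\<close>, a constant \<open>c\<close> independent of \<open>\<gamma>\<close> exists only for bounded \<open>\<gamma>\<close>.
\<close>

definition data_norm_family ::
  "(real \<Rightarrow> real \<Rightarrow> (real \<times> real \<Rightarrow> complex) \<Rightarrow> ennreal) \<Rightarrow> bool" where
  "data_norm_family N \<longleftrightarrow>
     (\<forall>\<epsilon>\<in>{0<..<1}. \<forall>\<gamma>\<in>{0<..<1}. norm_on_rect \<epsilon> \<gamma> (N \<epsilon> \<gamma>)) \<and>
     (\<forall>\<epsilon>\<in>{0<..<1}. \<forall>\<gamma>\<in>{0<..<1}. \<forall>\<epsilon>'\<in>{\<epsilon>..<1}. \<forall>\<gamma>'\<in>{\<gamma>..<1}. \<forall>g.
        continuous_on (closed_rect \<epsilon>' \<gamma>') g \<longrightarrow> N \<epsilon> \<gamma> g \<le> N \<epsilon>' \<gamma>' g) \<and>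
     (\<exists>c>0. \<forall>\<epsilon>\<in>{0<..<1}. \<forall>\<gamma>\<in>{0<..<1}. \<forall>g.
        continuous_on (closed_rect \<epsilon> \<gamma>) g \<longrightarrow>
        ennreal c * max (L1_rect \<epsilon> \<gamma> g) (L1_slice \<epsilon> \<gamma> g) \<le> N \<epsilon> \<gamma> g)"

definition log_modulus :: "real \<Rightarrow> real \<Rightarrow> real" where
  "log_modulus \<alpha> t =
     (if t = 0 then 0 else ln (ln (inverse t)) powr (2 * \<alpha>) / ln (inverse t) powr \<alpha>)"

end

theory Submission
  imports Defs
begin

text \<open>
  \<^bold>\<open>Why the theorem is true.\<close>  Write \<open>I\<^sub>k(\<xi>, \<eta>) = \<integral> x\<^sup>k f(x, \<xi>x + \<eta>) m(x, \<xi>, \<eta>) dx\<close>, so that \<open>I\<^sub>0\<close> is the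
  weighted Radon transform.  The differential equation for \<open>m\<close> says exactly that
  \<open>(\<partial>\<^sub>\<eta> + a) I\<^sub>k\<^sub>+\<^sub>1 = (\<partial>\<^sub>\<xi> - b) I\<^sub>k\<close>.  Since all \<open>I\<^sub>k\<close> vanish for \<open>\<eta> < -\<xi>\<^sup>2/4\<close> (the line then misses the
  parabola), integrating in \<open>\<eta>\<close> recovers \<open>I\<^sub>k\<^sub>+\<^sub>1\<close> from \<open>I\<^sub>k\<close> at the price of one \<open>\<xi>\<close>-derivative.  So the
  data determine all moments of \<open>f(\<cdot>, \<gamma>) m(\<cdot>, 0, \<gamma>)\<close>, with a loss of \<open>k\<close> derivatives for the
  \<open>k\<close>-th one, and a function on \<open>[-1, 1]\<close> is determined by its moments.

  To make this quantitative, the potential \<open>a\<close> is removed by multiplying \<open>m\<close> with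
  \<open>exp (\<integral>\<^sub>\<gamma>\<^sup>\<eta> a)\<close>; this preserves the weight on \<open>\<eta> = \<gamma>\<close>, changes the data by a bounded factor, and
  leaves a single Gevrey potential \<open>c\<close> with \<open>\<partial>\<^sub>\<eta> I\<^sub>k\<^sub>+\<^sub>1 = (\<partial>\<^sub>\<xi> - c) I\<^sub>k\<close>.  Because \<open>f\<close> is only Hoelder
  continuous, this relation is used in its weak form (\<open>moment_Suc\<close>): the \<open>\<xi>\<close>-derivative falls on a
  test function \<open>\<psi>(\<xi>)\<close>, which is replaced by \<open>\<psi>' + c \<psi>\<close>.  The bounds
  \<open>|\<psi>\<^sup>(\<^sup>j\<^sup>)| \<le> K \<Lambda>\<^sup>j ((j + q)!)\<^sup>s\<close> reproduce themselves under this operation with \<open>q + 1\<close> and \<open>2 \<Lambda> K\<close> in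
  place of \<open>q\<close> and \<open>K\<close> (\<open>transport_jet_bound\<close>), so \<open>k\<close> steps cost only \<open>(4\<Lambda>)\<^sup>k (k!)\<^sup>s\<close>
  (\<open>moment_Suc_bound\<close>).

  Now fix a degree \<open>n\<close>.  The test function is the bump \<open>(1 - (n\<xi>)\<^sup>2)\<^sup>8\<^sup>n\<close> on \<open>[-1/n, 1/n]\<close>: a polynomial
  whose derivatives of order below \<open>8n\<close> vanish at the ends, which is all that \<open>8n\<close> integrations by
  parts need.
  In \<open>x\<close>, the function is averaged against a Jackson kernel, a nonnegative polynomial of degree
  \<open>8n\<close> concentrated at scale \<open>1/n\<close> around a point \<open>x\<^sub>0\<close>.  By Hoelder continuity both averages
  change the value at \<open>x\<^sub>0\<close> by \<open>O(n\<^sup>-\<^sup>\<alpha>)\<close> (\<open>average_error\<close>), while the averaged value is a combination of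
  the moments up to order \<open>8n\<close> (\<open>kernel_average\<close>).  Altogether (\<open>stability_estimate\<close>)
  \<open>|f(x\<^sub>0, \<gamma>) m(x\<^sub>0, 0, \<gamma>)| \<le> K\<^sub>1 n\<^sup>-\<^sup>\<alpha> + (K\<^sub>2 n\<^sup>p)\<^sup>n K\<^sub>3 \<tau>\<close> with \<open>\<tau>\<close> the data norm.  With \<open>L = log (1/\<tau>)\<close>, the
  choice of \<open>n\<close> as a small multiple of \<open>L / log L\<close> makes the second term harmless
  (\<open>choose_degree\<close>), and the first is \<open>O((log L / L)\<^sup>\<alpha>)\<close>, which is stronger than the claim.
\<close>

section \<open>Jets of one variable and their Gevrey bounds\<close>

text \<open>
  A function together with all its derivatives.  A jet in this sense may be prescribed on a closed
  interval, where the derivatives at the end points are one-sided; this is what a bump that is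
  polynomial up to the end of its interval requires.
\<close>

definition jet_on :: "real set \<Rightarrow> (nat \<Rightarrow> real \<Rightarrow> real) \<Rightarrow> bool" where
  "jet_on S G \<longleftrightarrow> (\<forall>i. \<forall>x\<in>S. (G i has_real_derivative G (Suc i) x) (at x within S))"

text \<open>
  The Leibniz formula, read as a product of jets.
\<close>

definition jet_mult :: "(nat \<Rightarrow> real \<Rightarrow> real) \<Rightarrow> (nat \<Rightarrow> real \<Rightarrow> real) \<Rightarrow> nat \<Rightarrow> real \<Rightarrow> real" where
  "jet_mult F G j x = (\<Sum>i\<le>j. real (j choose i) * F i x * G (j - i) x)"

lemma jet_onD: "jet_on S G \<Longrightarrow> x \<in> S \<Longrightarrow> (G i has_real_derivative G (Suc i) x) (at x within S)"
  by (simp add: jet_on_def)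

lemma jet_on_continuous: "jet_on S G \<Longrightarrow> continuous_on S (G i)"
  by (rule DERIV_continuous_on) (erule (1) jet_onD)

lemma jet_mult_0 [simp]: "jet_mult F G 0 x = F 0 x * G 0 x"
  by (simp add: jet_mult_def)

lemma jet_on_mult:
  assumes "jet_on S F" "jet_on S G"
  shows "jet_on S (jet_mult F G)"
  unfolding jet_on_def
proof (intro allI ballI)
  fix j x assume x: "x \<in> S"
  have "((\<lambda>x. \<Sum>i\<le>j. real (j choose i) * F i x * G (j - i) x) has_real_derivative
     (\<Sum>i\<le>j. real (j choose i) * (F (Suc i) x * G (j - i) x + F i x * G (Suc (j - i)) x))) (at x within S)"
    by (auto intro!: derivative_eq_intros jet_onD[OF assms(1) x] jet_onD[OF assms(2) x] sum.cong
        simp: algebra_simps)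
  moreover have "(\<Sum>i\<le>j. real (j choose i) * (F (Suc i) x * G (j - i) x + F i x * G (Suc (j - i)) x))
     = jet_mult F G (Suc j) x"
  proof -
    define t where "t i = F i x * G (Suc j - i) x" for i
    have "(\<Sum>i\<le>j. real (j choose i) * (F (Suc i) x * G (j - i) x + F i x * G (Suc (j - i)) x))
        = (\<Sum>i\<le>j. real (j choose i) * t (Suc i)) + (\<Sum>i\<le>j. real (j choose i) * t i)"
      by (simp add: t_def sum.distrib[symmetric] algebra_simps Suc_diff_le)
    also have "(\<Sum>i\<le>j. real (j choose i) * t i) = t 0 + (\<Sum>i\<le>j. real (j choose Suc i) * t (Suc i))"
    proof -
      have "(\<Sum>i\<le>j. real (j choose i) * t i) = (\<Sum>i\<le>Suc j. real (j choose i) * t i)"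
        by simp
      also have "\<dots> = t 0 + (\<Sum>i\<le>j. real (j choose Suc i) * t (Suc i))"
        by (subst sum.atMost_Suc_shift) simp
      finally show ?thesis .
    qed
    also have "(\<Sum>i\<le>j. real (j choose i) * t (Suc i)) + (t 0 + (\<Sum>i\<le>j. real (j choose Suc i) * t (Suc i)))
       = t 0 + (\<Sum>i\<le>j. real (Suc j choose Suc i) * t (Suc i))"
      by (simp add: sum.distrib[symmetric] algebra_simps)
    also have "\<dots> = (\<Sum>i\<le>Suc j. real (Suc j choose i) * t i)"
      by (subst sum.atMost_Suc_shift) simp
    finally show ?thesis by (simp add: jet_mult_def t_def algebra_simps)
  qed
  ultimately show "(jet_mult F G j has_real_derivative jet_mult F G (Suc j) x) (at x within S)"
    by (simp add: jet_mult_def[abs_def])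
qed

lemma jet_mult_exp_bound:
  assumes "\<And>i. \<bar>F i x\<bar> \<le> \<mu> ^ i" "\<And>i. \<bar>G i x\<bar> \<le> \<nu> ^ i"
  shows "\<bar>jet_mult F G j x\<bar> \<le> (\<mu> + \<nu>) ^ j"
proof -
  have n: "0 \<le> \<mu>" "0 \<le> \<nu>" using assms(1)[of 1] assms(2)[of 1] by auto
  have "\<bar>jet_mult F G j x\<bar> \<le> (\<Sum>i\<le>j. real (j choose i) * \<mu> ^ i * \<nu> ^ (j - i))"
    unfolding jet_mult_def
    by (rule order_trans[OF sum_abs]) (auto intro!: sum_mono mult_mono assms simp: abs_mult n)
  also have "\<dots> = (\<mu> + \<nu>) ^ j" by (simp add: binomial_ring)
  finally show ?thesis .
qed

text \<open>
  Gevrey bounds survive products because a binomial coefficient, being at least \<open>1\<close>, is at most its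
  own \<open>s\<close>-th power, and then cancels against the factorials.
\<close>

lemma fact_binomial_le:
  assumes "i \<le> j" "1 \<le> s"
  shows "real (j choose i) * (fact i) ^ s * (fact (j - i + q)) ^ s \<le> (fact (j + q) :: real) ^ s"
proof -
  have le: "j choose i \<le> (j + q) choose i" by (rule binomial_right_mono) simp
  have e: "fact (j+q) = (fact i * fact (j - i + q)) * ((j + q) choose i)"
    using binomial_fact_lemma[of i "j + q"] assms(1) by simp
  have "Suc 0 \<le> (j + q) choose i" using assms(1) by (simp add: Suc_le_eq)
  hence "(j + q) choose i \<le> ((j + q) choose i) ^ s"
    using assms(2) self_le_power[of "(j+q) choose i" s] by simp
  hence "(j choose i) \<le> ((j + q) choose i) ^ s" using le by (rule order_trans[rotated])
  hence "real (j choose i) \<le> real ((j + q) choose i) ^ s"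
    by (simp only: of_nat_le_iff flip: of_nat_power)
  hence "real (j choose i) * ((fact i) ^ s * (fact (j - i + q)) ^ s)
      \<le> real ((j + q) choose i) ^ s * ((fact i) ^ s * (fact (j - i + q)) ^ s)"
    by (intro mult_right_mono) auto
  also have "\<dots> = (real (fact i * fact (j - i + q) * ((j + q) choose i))) ^ s"
    by (simp add: power_mult_distrib)
  also have "\<dots> = (fact (j + q)) ^ s" by (simp add: e[symmetric] del: of_nat_mult)
  finally show ?thesis by (simp add: mult.assoc)
qed

text \<open>
  The jet of \<open>\<psi>' + c \<psi>\<close>, to which the recursion for the moments sends a test function \<open>\<psi>\<close>.
\<close>

definition transport_jet :: "(nat \<Rightarrow> real \<Rightarrow> real) \<Rightarrow> (nat \<Rightarrow> real \<Rightarrow> real) \<Rightarrow> nat \<Rightarrow> real \<Rightarrow> real" where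
  "transport_jet c G j x = G (Suc j) x + jet_mult c G j x"

lemma jet_on_transport_jet:
  assumes "jet_on S c" "jet_on S G"
  shows "jet_on S (transport_jet c G)"
proof -
  have "jet_on S (jet_mult c G)" using assms by (rule jet_on_mult)
  thus ?thesis using assms unfolding jet_on_def transport_jet_def
    by (auto intro!: DERIV_add)
qed

text \<open>
  One step of the recursion raises the Gevrey index \<open>q\<close> by one and otherwise only multiplies the
  constant.  The geometric decay \<open>(C / L)\<^sup>i \<le> 2\<^sup>-\<^sup>i\<close> keeps the Leibniz sum bounded independently of \<open>j\<close>;
  this is why the scale \<open>L\<close> of the test function has to dominate that of the potential.
\<close>

lemma transport_jet_bound:
  assumes c: "\<And>i. \<bar>c i x\<bar> \<le> C * C ^ i * (fact i) ^ s"
    and G: "\<And>i. \<bar>G i x\<bar> \<le> K * L ^ i * (fact (i + q)) ^ s"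
    and s: "1 \<le> s" and C: "0 < C" "2 * C \<le> L"
  shows "\<bar>transport_jet c G j x\<bar> \<le> (2 * L * K) * L ^ j * (fact (j + Suc q)) ^ s"
proof -
  have "0 \<le> K * (fact q) ^ s" using order_trans[OF abs_ge_zero G[of 0]] by simp
  moreover have "0 < (fact q :: real) ^ s" by simp
  ultimately have K: "0 \<le> K" by (smt (verit) mult_neg_pos)
  have l: "0 < L" using C by simp
  have "\<bar>jet_mult c G j x\<bar> \<le> (\<Sum>i\<le>j. C * K * L ^ j * (fact (j + q)) ^ s * (1/2) ^ i)"
    unfolding jet_mult_def
  proof (rule order_trans[OF sum_abs], rule sum_mono)
    fix i assume i: "i \<in> {..j}"
    have "\<bar>real (j choose i) * c i x * G (j - i) x\<bar> = real (j choose i) * (\<bar>c i x\<bar> * \<bar>G (j - i) x\<bar>)"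
      by (simp add: abs_mult)
    also have "\<dots> \<le> real (j choose i) * ((C * C ^ i * (fact i) ^ s) * (K * L ^ (j - i) * (fact (j - i + q)) ^ s))"
      by (intro mult_left_mono mult_mono c G) (use C in auto)
    also have "\<dots> = C * K * (C ^ i * L ^ (j - i)) * (real (j choose i) * (fact i) ^ s * (fact (j - i + q)) ^ s)"
      by (simp add: algebra_simps)
    also have "\<dots> \<le> C * K * ((L * (1/2)) ^ i * L ^ (j - i)) * (fact (j + q)) ^ s"
      by (intro mult_mono mult_left_mono fact_binomial_le mult_right_mono power_mono)
         (use C K l i s in auto)
    also have "(L * (1/2)) ^ i * L ^ (j - i) = L ^ j * (1/2) ^ i"
      using i by (simp add: power_mult_distrib power_add[symmetric] divide_simps del: power_one_over)
    finally show "\<bar>real (j choose i) * c i x * G (j - i) x\<bar> \<le> C * K * L ^ j * (fact (j + q)) ^ s * (1/2) ^ i"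
      by (simp add: algebra_simps)
  qed
  also have "\<dots> = C * K * L ^ j * (fact (j + q)) ^ s * (\<Sum>i\<le>j. (1/2) ^ i)"
    by (simp add: sum_distrib_left)
  also have "\<dots> \<le> C * K * L ^ j * (fact (j + q)) ^ s * 2"
  proof (rule mult_left_mono)
    have "(\<Sum>i\<le>j. (1/2::real) ^ i) = 2 - (1/2)^j"
      by (induction j) (auto simp: field_simps)
    thus "(\<Sum>i\<le>j. (1/2::real) ^ i) \<le> 2" by simp
  qed (use C K l in auto)
  also have "\<dots> = (2 * C) * (K * L ^ j * (fact (j + q)) ^ s)" by simp
  also have "\<dots> \<le> L * (K * L ^ j * (fact (j + Suc q)) ^ s)"
    by (intro mult_mono mult_left_mono power_mono fact_mono) (use C K l in auto)
  finally have "\<bar>jet_mult c G j x\<bar> \<le> L * (K * L ^ j * (fact (j + Suc q)) ^ s)" .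
  moreover have "\<bar>G (Suc j) x\<bar> \<le> L * (K * L ^ j * (fact (j + Suc q)) ^ s)"
    using G[of "Suc j"] by (simp add: algebra_simps)
  ultimately show ?thesis unfolding transport_jet_def by (simp add: algebra_simps)
qed

text \<open>
  A polynomial bump.  For \<open>d\<close> integrations by parts it is as good as a compactly supported smooth
  function, and its derivatives are bounded by \<open>(2d/r)\<^sup>j\<close>, since each of the \<open>d\<close> factors has derivatives
  bounded by \<open>(2/r)\<^sup>j\<close> and Leibniz products add such rates.
\<close>

lemma bump_jet:
  fixes r :: real
  assumes r: "0 < r"
  shows "\<exists>G. jet_on {-r..r} G \<and> (\<forall>x. G 0 x = (1 - (x / r)\<^sup>2) ^ d) \<and>
     (\<forall>j. \<forall>x\<in>{-r..r}. \<bar>G j x\<bar> \<le> (2 * real d / r) ^ j) \<and>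
     (\<forall>j<d. G j r = 0 \<and> G j (-r) = 0)"
proof (induction d)
  case 0
  have "jet_on {-r..r} (\<lambda>j x. if j = 0 then 1 else 0)" by (auto simp: jet_on_def)
  thus ?case by (intro exI[of _ "\<lambda>j x. if j = 0 then 1 else 0"]) auto
next
  case (Suc d)
  then obtain G where G: "jet_on {-r..r} G" "\<And>x. G 0 x = (1 - (x / r)\<^sup>2) ^ d"
     "\<And>j x. x \<in> {-r..r} \<Longrightarrow> \<bar>G j x\<bar> \<le> (2 * real d / r) ^ j"
     "\<And>j. j < d \<Longrightarrow> G j r = 0 \<and> G j (-r) = 0" by blast
  \<comment> \<open>the jet of one quadratic factor\<close>
  define H where "H j x = (if j = 0 then 1 - (x / r)\<^sup>2 else if j = 1 then - 2 * x / r\<^sup>2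
     else if j = 2 then - 2 / r\<^sup>2 else 0)" for j :: nat and x :: real
  have H: "jet_on {-r..r} H"
    unfolding jet_on_def
  proof (intro allI ballI)
    fix i :: nat and x assume "x \<in> {-r..r}"
    consider "i = 0" | "i = 1" | "i = 2" | "i > 2" by linarith
    thus "(H i has_real_derivative H (Suc i) x) (at x within {-r..r})"
    proof cases
      case 1 thus ?thesis using r by (auto simp: H_def[abs_def] power2_eq_square intro!: derivative_eq_intros)
    next
      case 2 thus ?thesis using r by (auto simp: H_def[abs_def] power2_eq_square intro!: derivative_eq_intros)
    qed (auto simp: H_def[abs_def])
  qed
  have Hb: "\<bar>H j x\<bar> \<le> (2 / r) ^ j" if x: "x \<in> {-r..r}" for j x
  proof -
    have ax: "\<bar>x\<bar> \<le> r" using x by auto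
    have "\<bar>x / r\<bar> \<le> 1" using ax r by (simp add: abs_divide)
    hence "(x/r)\<^sup>2 \<le> 1" by (simp add: abs_square_le_1)
    moreover have "2 * \<bar>x\<bar> / r\<^sup>2 \<le> 2 / r" using ax r by (simp add: field_simps power2_eq_square)
    moreover have "2 / r\<^sup>2 \<le> (2 / r)\<^sup>2" using r by (simp add: field_simps)
    ultimately show ?thesis using r by (auto simp: H_def abs_mult power2_eq_square)
  qed
  have Hr: "H 0 r = 0" "H 0 (-r) = 0" using r by (auto simp: H_def)
  show ?case
  proof (intro exI[of _ "jet_mult H G"] conjI allI ballI impI)
    show "jet_on {-r..r} (jet_mult H G)" using H G(1) by (rule jet_on_mult)
    show "jet_mult H G 0 x = (1 - (x / r)\<^sup>2) ^ Suc d" for x by (simp add: H_def G(2))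
    show "\<bar>jet_mult H G j x\<bar> \<le> (2 * real (Suc d) / r) ^ j" if "x \<in> {-r..r}" for j x
      using jet_mult_exp_bound[of H x "2/r" G "2 * real d / r" j] Hb[OF that] G(3)[OF that]
      by (simp add: add_divide_distrib[symmetric] algebra_simps)
    show "jet_mult H G j r = 0" if "j < Suc d" for j
      unfolding jet_mult_def
    proof (rule sum.neutral, rule ballI)
      fix i assume "i \<in> {..j}"
      thus "real (j choose i) * H i r * G (j - i) r = 0"
        using Hr that G(4)[of "j - i"] by (cases "i = 0") auto
    qed
    show "jet_mult H G j (-r) = 0" if "j < Suc d" for j
      unfolding jet_mult_def
    proof (rule sum.neutral, rule ballI)
      fix i assume "i \<in> {..j}"
      thus "real (j choose i) * H i (-r) * G (j - i) (-r) = 0"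
        using Hr that G(4)[of "j - i"] by (cases "i = 0") auto
    qed
  qed
qed

section \<open>A polynomial approximate identity\<close>

text \<open>
  The polynomials with \<open>dirichlet n (sin \<theta>) = sin ((2n + 1) \<theta>) / sin \<theta>\<close>, generated by the
  three-term recursion for Chebyshev polynomials.
\<close>

fun dirichlet :: "nat \<Rightarrow> real \<Rightarrow> real" where
  "dirichlet 0 t = 1"
| "dirichlet (Suc 0) t = 3 - 4 * t\<^sup>2"
| "dirichlet (Suc (Suc n)) t = (2 - 4 * t\<^sup>2) * dirichlet (Suc n) t - dirichlet n t"

lemma dirichlet_sin: "dirichlet n (sin \<theta>) * sin \<theta> = sin (real (2 * n + 1) * \<theta>)"
proof (induction n rule: induct_nat_012)
  case 0 show ?case by simp
next
  case 1
  have "sin (3 * \<theta>) = sin (2 * \<theta>) * cos \<theta> + cos (2 * \<theta>) * sin \<theta>"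
    using sin_add[of "2 * \<theta>" \<theta>] by simp
  also have "\<dots> = 2 * sin \<theta> * (cos \<theta>)\<^sup>2 + (1 - 2 * (sin \<theta>)\<^sup>2) * sin \<theta>"
    by (simp add: sin_double cos_double_sin power2_eq_square)
  also have "\<dots> = sin \<theta> * (3 - 4 * (sin \<theta>)\<^sup>2)"
    by (simp add: cos_squared_eq algebra_simps)
  finally have "sin (3 * \<theta>) = (3 - 4 * (sin \<theta>)\<^sup>2) * sin \<theta>" by simp
  thus ?case by simp
next
  case (ge2 n)
  have "sin (real (2 * Suc (Suc n) + 1) * \<theta>) + sin (real (2 * n + 1) * \<theta>)
      = 2 * sin (real (2 * Suc n + 1) * \<theta>) * cos (2 * \<theta>)"
    using sin_add[of "real (2 * Suc n + 1) * \<theta>" "2 * \<theta>"] sin_diff[of "real (2 * Suc n + 1) * \<theta>" "2 * \<theta>"]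
    by (simp add: algebra_simps)
  also have "cos (2 * \<theta>) = 1 - 2 * (sin \<theta>)\<^sup>2"
    by (simp add: cos_double_sin)
  finally have e: "sin (real (2 * Suc (Suc n) + 1) * \<theta>)
      = (2 - 4 * (sin \<theta>)\<^sup>2) * sin (real (2 * Suc n + 1) * \<theta>) - sin (real (2 * n + 1) * \<theta>)"
    by (simp add: algebra_simps)
  have "dirichlet (Suc (Suc n)) (sin \<theta>) * sin \<theta>
      = (2 - 4 * (sin \<theta>)\<^sup>2) * (dirichlet (Suc n) (sin \<theta>) * sin \<theta>) - dirichlet n (sin \<theta>) * sin \<theta>"
    by (simp add: algebra_simps)
  thus ?case unfolding ge2 e .
qed

lemma dirichlet_mult_le_1:
  assumes "\<bar>t\<bar> \<le> 1" shows "\<bar>dirichlet n t * t\<bar> \<le> 1"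
  using dirichlet_sin[of n "arcsin t"] assms by (simp add: abs_le_iff)

lemma dirichlet_0: "dirichlet n 0 = 2 * n + 1"
  by (induction n rule: induct_nat_012) auto

lemma abs_sin_mult_le: "\<bar>sin (real k * \<theta>)\<bar> \<le> real k * \<bar>sin \<theta>\<bar>"
proof (induction k)
  case (Suc k)
  have "\<bar>sin (real (Suc k) * \<theta>)\<bar> = \<bar>sin (real k * \<theta>) * cos \<theta> + cos (real k * \<theta>) * sin \<theta>\<bar>"
    by (simp add: algebra_simps sin_add)
  also have "\<dots> \<le> \<bar>sin (real k * \<theta>)\<bar> * 1 + 1 * \<bar>sin \<theta>\<bar>"
    by (rule order_trans[OF abs_triangle_ineq]) (unfold abs_mult, intro add_mono mult_left_mono mult_right_mono, auto)
  also have "\<dots> \<le> real (Suc k) * \<bar>sin \<theta>\<bar>" using Suc by (simp add: algebra_simps)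
  finally show ?case .
qed simp

lemma dirichlet_abs_le:
  assumes "\<bar>t\<bar> \<le> 1" shows "\<bar>dirichlet n t\<bar> \<le> 2 * n + 1"
proof (cases "t = 0")
  case True thus ?thesis by (simp add: dirichlet_0)
next
  case False
  have "\<bar>dirichlet n t\<bar> * \<bar>t\<bar> \<le> (2 * n + 1) * \<bar>t\<bar>"
    using dirichlet_sin[of n "arcsin t"] abs_sin_mult_le[of "2*n+1" "arcsin t"] assms
    by (simp add: abs_le_iff flip: abs_mult)
  thus ?thesis using False by simp
qed

text \<open>
  Near \<open>0\<close> the quotient \<open>sin ((2n + 1) \<theta>) / sin \<theta>\<close> keeps half of its value \<open>2n + 1\<close> at \<open>0\<close>,
  by \<open>sin u \<ge> u / 2\<close> on \<open>[0, 1]\<close>.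
\<close>

lemma dirichlet_lower:
  assumes "0 < t" "2 * (2 * n + 1) * t \<le> 1" shows "(2 * n + 1) / 2 \<le> dirichlet n t"
proof -
  define N where "N = 2 * real n + 1"
  have N: "N \<ge> 1" by (simp add: N_def)
  have "0 \<le> real n * t" using assms(1) by simp
  hence t: "t \<le> 1 / 2" using assms(2) by (simp add: algebra_simps)
  define \<theta> where "\<theta> = arcsin t"
  have s: "sin \<theta> = t" using t assms by (simp add: \<theta>_def)
  have th0: "0 < \<theta>" using assms t arcsin_less_arcsin[of 0 t] by (simp add: \<theta>_def)
  have lo: "x / 2 \<le> sin x" if "0 \<le> x" "x \<le> 1" for x :: real
  proof -
    have "(\<lambda>y. sin y - y / 2) 0 \<le> (\<lambda>y. sin y - y / 2) x"
    proof (rule DERIV_nonneg_imp_nondecreasing[OF that(1)])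
      fix y assume y: "0 \<le> y" "y \<le> x"
      have "cos (pi / 3) \<le> cos y"
        using y that pi_gt3 by (intro cos_monotone_0_pi_le) auto
      hence "0 \<le> cos y - 1/2" by (simp add: cos_60)
      moreover have "((\<lambda>y. sin y - y / 2) has_real_derivative cos y - 1/2) (at y)"
        by (auto intro!: derivative_eq_intros)
      ultimately show "\<exists>d. ((\<lambda>y. sin y - y / 2) has_real_derivative d) (at y) \<and> 0 \<le> d" by blast
    qed
    thus ?thesis by simp
  qed
  have th1: "\<theta> / 2 \<le> t"
  proof -
    have "\<theta> \<le> arcsin (1/2)" unfolding \<theta>_def using t assms by (intro arcsin_le_arcsin) auto
    also have "arcsin (1/2 :: real) = pi / 6"
      using arcsin_sin[of "pi/6"] by (simp add: sin_30)
    also have "\<dots> \<le> 1" using pi_less_4 by simp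
    finally show ?thesis using lo[of \<theta>] th0 s by simp
  qed
  have "N * \<theta> \<le> N * (2 * t)" using th1 N by (intro mult_left_mono) auto
  also have "\<dots> \<le> 1" using assms(2) by (simp add: N_def algebra_simps)
  finally have "N * \<theta> / 2 \<le> sin (N * \<theta>)" using lo[of "N * \<theta>"] N th0 by simp
  also have "\<dots> = dirichlet n t * t" using dirichlet_sin[of n \<theta>] by (simp add: s N_def algebra_simps)
  finally have "N / 2 * \<theta> \<le> dirichlet n t * t" by simp
  moreover have "N / 2 * t \<le> N / 2 * \<theta>"
    using sin_x_le_x[of \<theta>] th0 s N by (intro mult_left_mono) auto
  ultimately have "N / 2 * t \<le> dirichlet n t * t" by linarith
  thus ?thesis using assms(1) by (simp add: N_def)
qed

text \<open>
  The \<open>\<ell>\<^sup>1\<close> norm of the coefficients is what pairs with a bound on moments, and it is submultiplicative.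
\<close>

definition coeff_bd :: "nat \<Rightarrow> real \<Rightarrow> (real \<Rightarrow> real) \<Rightarrow> bool" where
  "coeff_bd d B g \<longleftrightarrow> (\<exists>a. (\<forall>y. g y = (\<Sum>k\<le>d. a k * y ^ k)) \<and> (\<Sum>k\<le>d. \<bar>a k\<bar>) \<le> B)"

lemma coeff_bd_mult:
  assumes "coeff_bd d1 B1 g" "coeff_bd d2 B2 h"
  shows "coeff_bd (d1 + d2) (B1 * B2) (\<lambda>y. g y * h y)"
proof -
  obtain a where a: "\<And>y. g y = (\<Sum>k\<le>d1. a k * y ^ k)" "(\<Sum>k\<le>d1. \<bar>a k\<bar>) \<le> B1"
    using assms(1) by (auto simp: coeff_bd_def)
  obtain b where b: "\<And>y. h y = (\<Sum>k\<le>d2. b k * y ^ k)" "(\<Sum>k\<le>d2. \<bar>b k\<bar>) \<le> B2"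
    using assms(2) by (auto simp: coeff_bd_def)
  define P where "P k = {p \<in> {..d1} \<times> {..d2}. fst p + snd p = k}" for k
  define c where "c k = (\<Sum>p\<in>P k. a (fst p) * b (snd p))" for k
  have grp: "(\<Sum>k\<le>d1+d2. \<Sum>p\<in>P k. u p) = (\<Sum>p\<in>{..d1} \<times> {..d2}. u p)" for u :: "nat \<times> nat \<Rightarrow> real"
    unfolding P_def by (rule sum.group) auto
  have B1: "0 \<le> B1" using a(2) by (meson abs_ge_zero order_trans sum_nonneg)
  show ?thesis unfolding coeff_bd_def
  proof (intro exI[of _ c] conjI allI)
    fix y
    have "(\<Sum>k\<le>d1+d2. c k * y ^ k) = (\<Sum>k\<le>d1+d2. \<Sum>p\<in>P k. a (fst p) * y ^ fst p * (b (snd p) * y ^ snd p))"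
      unfolding c_def sum_distrib_right
      by (intro sum.cong refl) (auto simp: P_def power_add)
    also have "\<dots> = g y * h y"
      unfolding grp by (simp add: a b sum_product sum.cartesian_product split_def)
    finally show "g y * h y = (\<Sum>k\<le>d1+d2. c k * y ^ k)" ..
    have "(\<Sum>k\<le>d1+d2. \<bar>c k\<bar>) \<le> (\<Sum>k\<le>d1+d2. \<Sum>p\<in>P k. \<bar>a (fst p)\<bar> * \<bar>b (snd p)\<bar>)"
      unfolding c_def by (intro sum_mono order_trans[OF sum_abs]) (auto simp: abs_mult)
    also have "\<dots> = (\<Sum>k\<le>d1. \<bar>a k\<bar>) * (\<Sum>k\<le>d2. \<bar>b k\<bar>)"
      unfolding grp by (simp add: sum_product sum.cartesian_product split_def)
    also have "\<dots> \<le> B1 * B2" by (intro mult_mono a b B1 sum_nonneg) auto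
    finally show "(\<Sum>k\<le>d1+d2. \<bar>c k\<bar>) \<le> B1 * B2" .
  qed
qed

lemma coeff_bd_const: "\<bar>c\<bar> \<le> B \<Longrightarrow> coeff_bd 0 B (\<lambda>y. c)"
  unfolding coeff_bd_def by (rule exI[of _ "\<lambda>k. c"]) auto

lemma coeff_bd_mono:
  assumes "coeff_bd d B g" "d \<le> d'" "B \<le> B'" shows "coeff_bd d' B' g"
proof -
  obtain a where a: "\<And>y. g y = (\<Sum>k\<le>d. a k * y ^ k)" "(\<Sum>k\<le>d. \<bar>a k\<bar>) \<le> B"
    using assms(1) by (auto simp: coeff_bd_def)
  have s: "(\<Sum>k\<le>d'. if k \<le> d then u k else 0) = (\<Sum>k\<le>d. u k)" for u :: "nat \<Rightarrow> real"
    by (rule sum.mono_neutral_cong_right) (use assms(2) in auto)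
  show ?thesis unfolding coeff_bd_def
  proof (intro exI[of _ "\<lambda>k. if k \<le> d then a k else 0"] conjI allI)
    fix y
    have "(\<Sum>k\<le>d'. (if k \<le> d then a k else 0) * y ^ k) = (\<Sum>k\<le>d'. if k \<le> d then a k * y ^ k else 0)"
      by (rule sum.cong) auto
    thus "g y = (\<Sum>k\<le>d'. (if k \<le> d then a k else 0) * y ^ k)" by (simp only: s a(1))
    have "(\<Sum>k\<le>d'. \<bar>if k \<le> d then a k else 0\<bar>) = (\<Sum>k\<le>d'. if k \<le> d then \<bar>a k\<bar> else 0)"
      by (rule sum.cong) auto
    thus "(\<Sum>k\<le>d'. \<bar>if k \<le> d then a k else 0\<bar>) \<le> B'" using a(2) assms(3) by (simp only: s)
  qed
qed

lemma coeff_bd_add: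
  assumes "coeff_bd d B1 g" "coeff_bd d B2 h"
  shows "coeff_bd d (B1 + B2) (\<lambda>y. g y + h y)"
proof -
  obtain a where a: "\<And>y. g y = (\<Sum>k\<le>d. a k * y ^ k)" "(\<Sum>k\<le>d. \<bar>a k\<bar>) \<le> B1"
    using assms(1) by (auto simp: coeff_bd_def)
  obtain b where b: "\<And>y. h y = (\<Sum>k\<le>d. b k * y ^ k)" "(\<Sum>k\<le>d. \<bar>b k\<bar>) \<le> B2"
    using assms(2) by (auto simp: coeff_bd_def)
  have "(\<Sum>k\<le>d. \<bar>a k + b k\<bar>) \<le> (\<Sum>k\<le>d. \<bar>a k\<bar>) + (\<Sum>k\<le>d. \<bar>b k\<bar>)"
    by (simp add: sum.distrib[symmetric] sum_mono)
  thus ?thesis unfolding coeff_bd_def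
    using a b by (intro exI[of _ "\<lambda>k. a k + b k"]) (auto simp: sum.distrib algebra_simps)
qed

lemma coeff_bd_cmult:
  assumes "coeff_bd d B g" shows "coeff_bd d (\<bar>c\<bar> * B) (\<lambda>y. c * g y)"
  using coeff_bd_mult[OF coeff_bd_const[of c "\<bar>c\<bar>"] assms] by simp

lemma coeff_bd_power:
  assumes "coeff_bd d B g" shows "coeff_bd (k * d) (B ^ k) (\<lambda>y. g y ^ k)"
proof (induction k)
  case 0 show ?case using coeff_bd_const[of 1 1] by simp
next
  case (Suc k) thus ?case using coeff_bd_mult[OF assms Suc] by simp
qed

lemma coeff_bd_dirichlet:
  assumes "coeff_bd 1 1 u"
  shows "coeff_bd (2 * n) (7 ^ n) (\<lambda>y. dirichlet n (u y))"
proof (induction n rule: induct_nat_012)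
  case 0 show ?case using coeff_bd_const[of 1 1] by simp
next
  case 1
  have *[simplified]: "coeff_bd (2*1) (3 + \<bar>-4\<bar> * 1 ^ 2) (\<lambda>y. 3 + (-4) * u y ^ 2)"
    by (intro coeff_bd_add coeff_bd_cmult coeff_bd_power assms coeff_bd_mono[OF coeff_bd_const[of 3 3]]) auto
  thus ?case by simp
next
  case (ge2 n)
  have q[simplified]: "coeff_bd (2*1) (2 + \<bar>-4\<bar> * 1 ^ 2) (\<lambda>y. 2 + (-4) * u y ^ 2)"
    by (intro coeff_bd_add coeff_bd_cmult coeff_bd_power assms coeff_bd_mono[OF coeff_bd_const[of 2 2]]) auto
  have "coeff_bd (2 * Suc (Suc n)) (6 * 7 ^ Suc n + \<bar>-1\<bar> * 7 ^ n)
     (\<lambda>y. (2 - 4 * u y ^ 2) * dirichlet (Suc n) (u y) + (-1) * dirichlet n (u y))"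
    by (intro coeff_bd_add coeff_bd_mono[OF coeff_bd_mult[OF q ge2(2)]]
        coeff_bd_mono[OF coeff_bd_cmult[OF ge2(1), of "-1"]]) auto
  hence "coeff_bd (2 * Suc (Suc n)) (7 ^ Suc (Suc n))
     (\<lambda>y. (2 - 4 * u y ^ 2) * dirichlet (Suc n) (u y) + (-1) * dirichlet n (u y))"
    by (rule coeff_bd_mono) auto
  thus ?case by simp
qed


lemma continuous_on_dirichlet [continuous_intros]:
  "continuous_on S u \<Longrightarrow> continuous_on S (\<lambda>y. dirichlet n (u y))"
  by (induction n rule: induct_nat_012) (auto intro!: continuous_intros)

text \<open>
  The fourth power makes the kernel nonnegative and lets it decay fast enough for its first moment to
  be of the order \<open>1/n\<close> times its integral.  The factor \<open>1/2\<close> brings all differences of points of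
  \<open>[-1, 1]\<close> into the range of the sine.
\<close>

definition jackson_kernel :: "real \<Rightarrow> nat \<Rightarrow> real \<Rightarrow> real" where
  "jackson_kernel x\<^sub>0 n y = dirichlet n ((x\<^sub>0 - y) / 2) ^ 4"

lemma kernel_nonneg: "0 \<le> jackson_kernel x\<^sub>0 n y"
  by (simp add: jackson_kernel_def)

lemma continuous_on_kernel [continuous_intros]: "continuous_on S (jackson_kernel x\<^sub>0 n)"
  unfolding jackson_kernel_def[abs_def] by (intro continuous_intros) auto

lemma coeff_bd_kernel:
  assumes "\<bar>x\<^sub>0\<bar> \<le> 1"
  shows "coeff_bd (8 * n) (7 ^ (4 * n)) (jackson_kernel x\<^sub>0 n)"
proof -
  have "coeff_bd 1 1 (\<lambda>y. (x\<^sub>0 - y) / 2)"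
    unfolding coeff_bd_def
    by (rule exI[of _ "\<lambda>k. if k = 0 then x\<^sub>0 / 2 else - 1 / 2"]) (use assms in \<open>auto simp: field_simps\<close>)
  from coeff_bd_power[OF coeff_bd_dirichlet[OF this, of n], of 4] show ?thesis
    by (simp add: jackson_kernel_def[abs_def] power_mult[symmetric] mult.commute)
qed

text \<open>
  On an interval of length comparable to \<open>1/n\<close> next to \<open>x\<^sub>0\<close> the kernel is comparable to \<open>n\<^sup>4\<close>.
\<close>

lemma kernel_integral_lower:
  "(2 * real n + 1) ^ 3 / 32 \<le> integral {x\<^sub>0 - 2..x\<^sub>0 + 2} (jackson_kernel x\<^sub>0 n)"
proof -
  define N where "N = 2 * real n + 1"
  have N: "N \<ge> 1" by (simp add: N_def)
  let ?I = "{x\<^sub>0 - 1 / N..x\<^sub>0 - 1 / (2 * N)}"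
  have sub: "?I \<subseteq> {x\<^sub>0 - 2..x\<^sub>0 + 2}"
  proof -
    have "1 / N \<le> 1" "0 \<le> 1 / (2 * N)" using N by auto
    thus ?thesis by auto
  qed
  have "N ^ 3 / 32 = integral ?I (\<lambda>y. (N / 2) ^ 4)"
    using N by (simp add: field_simps power_numeral_reduce)
  also have "\<dots> \<le> integral ?I (jackson_kernel x\<^sub>0 n)"
  proof (rule integral_le)
    show "jackson_kernel x\<^sub>0 n integrable_on ?I"
      by (intro integrable_continuous_interval continuous_intros)
    fix y assume y: "y \<in> ?I"
    have "N / 2 \<le> dirichlet n ((x\<^sub>0 - y) / 2)"
      unfolding N_def
    proof (rule dirichlet_lower)
      have "x\<^sub>0 - 1 / (2 * N) < x\<^sub>0" using N by simp
      moreover have "y \<le> x\<^sub>0 - 1 / (2 * N)" using y by simp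
      ultimately have "y < x\<^sub>0" by (rule le_less_trans[rotated])
      thus "0 < (x\<^sub>0 - y) / 2" by simp
      have "x\<^sub>0 - 1 / N \<le> y" using y by simp
      hence "x\<^sub>0 - y \<le> 1 / N" by linarith
      hence "(x\<^sub>0 - y) * N \<le> 1" using N by (simp add: field_simps)
      moreover have "real (2 * (2 * n + 1)) * ((x\<^sub>0 - y) / 2) = (x\<^sub>0 - y) * N"
        by (simp add: N_def field_simps)
      ultimately show "real (2 * (2 * n + 1)) * ((x\<^sub>0 - y) / 2) \<le> 1" by (simp only:)
    qed
    thus "(N / 2) ^ 4 \<le> jackson_kernel x\<^sub>0 n y"
      unfolding jackson_kernel_def using N by (intro power_mono) auto
  qed auto
  also have "\<dots> \<le> integral {x\<^sub>0 - 2..x\<^sub>0 + 2} (jackson_kernel x\<^sub>0 n)"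
    by (intro integral_subset_le sub integrable_continuous_interval continuous_intros)
       (auto simp: kernel_nonneg)
  finally show ?thesis by (simp add: N_def)
qed

text \<open>
  The kernel has width \<open>1/n\<close>.  Combining \<open>|dirichlet n t| \<le> N\<close> with \<open>|t dirichlet n t| \<le> 1\<close>, where
  \<open>N = 2n + 1\<close>, gives \<open>(1 + N\<^sup>2t\<^sup>2) (dirichlet n t)\<^sup>2 \<le> 2N\<^sup>2\<close>, so the kernel times \<open>n|t|\<close> is dominated by a
  multiple of \<open>N\<^sup>4 / (1 + N\<^sup>2t\<^sup>2)\<close>, whose integral is an arctangent of the order \<open>N\<^sup>3\<close>.
\<close>

lemma kernel_moment:
  "integral {x\<^sub>0 - 2..x\<^sub>0 + 2} (\<lambda>y. jackson_kernel x\<^sub>0 n y * (real n * \<bar>y - x\<^sub>0\<bar>))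
     \<le> 1024 * integral {x\<^sub>0 - 2..x\<^sub>0 + 2} (jackson_kernel x\<^sub>0 n)"
proof -
  define N where "N = 2 * real n + 1"
  have N: "N \<ge> 1" by (simp add: N_def)
  have FTC: "((\<lambda>y. 4 * N ^ 4 / (1 + (N * ((y - x\<^sub>0) / 2))\<^sup>2)) has_integral
     (8 * N ^ 3 * arctan (N * ((x\<^sub>0 + 2 - x\<^sub>0) / 2)) - 8 * N ^ 3 * arctan (N * ((x\<^sub>0 - 2 - x\<^sub>0) / 2)))) {x\<^sub>0 - 2..x\<^sub>0 + 2}"
    by (rule fundamental_theorem_of_calculus)
       (auto intro!: derivative_eq_intros simp flip: has_real_derivative_iff_has_vector_derivative
          simp: power_numeral_reduce divide_simps)
  have "integral {x\<^sub>0 - 2..x\<^sub>0 + 2} (\<lambda>y. jackson_kernel x\<^sub>0 n y * (real n * \<bar>y - x\<^sub>0\<bar>))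
      \<le> integral {x\<^sub>0 - 2..x\<^sub>0 + 2} (\<lambda>y. 4 * N ^ 4 / (1 + (N * ((y - x\<^sub>0) / 2))\<^sup>2))"
  proof (rule integral_le)
    show "(\<lambda>y. jackson_kernel x\<^sub>0 n y * (real n * \<bar>y - x\<^sub>0\<bar>)) integrable_on {x\<^sub>0 - 2..x\<^sub>0 + 2}"
      by (intro integrable_continuous_interval continuous_intros)
    show "(\<lambda>y. 4 * N ^ 4 / (1 + (N * ((y - x\<^sub>0) / 2))\<^sup>2)) integrable_on {x\<^sub>0 - 2..x\<^sub>0 + 2}"
      using FTC by blast
    fix y assume y: "y \<in> {x\<^sub>0 - 2..x\<^sub>0 + 2}"
    define t where "t = (x\<^sub>0 - y) / 2"
    have t: "\<bar>t\<bar> \<le> 1" using y by (auto simp: t_def abs_le_iff)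
    define u where "u = N * \<bar>t\<bar>"
    define S where "S = (dirichlet n t)\<^sup>2"
    have u0: "0 \<le> u" using N by (simp add: u_def)
    have S0: "0 \<le> S" by (simp add: S_def)
    have "\<bar>dirichlet n t\<bar>\<^sup>2 \<le> N\<^sup>2"
      using dirichlet_abs_le[OF t, of n] by (intro power_mono) (auto simp: N_def)
    hence S1: "S \<le> N\<^sup>2" by (simp add: S_def)
    have "\<bar>dirichlet n t * t\<bar>\<^sup>2 \<le> 1\<^sup>2"
      using dirichlet_mult_le_1[OF t, of n] by (intro power_mono) auto
    hence S2: "S * t\<^sup>2 \<le> 1" by (simp add: S_def power_mult_distrib)
    have "S * (1 + u\<^sup>2) = S + N\<^sup>2 * (S * t\<^sup>2)" by (simp add: u_def power_mult_distrib algebra_simps)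
    also have "\<dots> \<le> N\<^sup>2 + N\<^sup>2 * 1" using S1 S2 by (intro add_mono mult_left_mono) auto
    finally have S3: "S * (1 + u\<^sup>2) \<le> 2 * N\<^sup>2" by simp
    have p: "0 < 1 + u\<^sup>2" by (simp add: add_pos_nonneg)
    have "(S * (1 + u\<^sup>2))\<^sup>2 \<le> (2 * N\<^sup>2)\<^sup>2"
      using S3 S0 p by (intro power_mono) auto
    hence S4: "S\<^sup>2 * (1 + u\<^sup>2)\<^sup>2 \<le> 4 * N ^ 4" by (simp add: power_mult_distrib flip: power_mult)
    have "0 \<le> (1 - u)\<^sup>2" by simp
    hence u2: "2 * u \<le> 1 + u\<^sup>2" by (simp add: power2_eq_square algebra_simps)
    have "jackson_kernel x\<^sub>0 n y * (real n * \<bar>y - x\<^sub>0\<bar>) = S\<^sup>2 * (2 * (real n * \<bar>t\<bar>))"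
      by (simp add: jackson_kernel_def S_def t_def abs_divide abs_minus_commute flip: power_mult)
    also have "\<dots> \<le> S\<^sup>2 * (1 + u\<^sup>2)"
    proof (rule mult_left_mono)
      have "real n * \<bar>t\<bar> \<le> u" unfolding u_def N_def by (intro mult_right_mono) auto
      thus "2 * (real n * \<bar>t\<bar>) \<le> 1 + u\<^sup>2" using u2 by linarith
    qed simp
    also have "\<dots> = S\<^sup>2 * (1 + u\<^sup>2)\<^sup>2 / (1 + u\<^sup>2)" using p by (simp add: power2_eq_square)
    also have "\<dots> \<le> 4 * N ^ 4 / (1 + u\<^sup>2)" using S4 p by (intro divide_right_mono) auto
    also have "u\<^sup>2 = (N * ((y - x\<^sub>0) / 2))\<^sup>2"
      by (simp add: u_def t_def power_mult_distrib power2_commute power_divide)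
    finally show "jackson_kernel x\<^sub>0 n y * (real n * \<bar>y - x\<^sub>0\<bar>) \<le> 4 * N ^ 4 / (1 + (N * ((y - x\<^sub>0) / 2))\<^sup>2)" .
  qed
  also have "\<dots> = 8 * N ^ 3 * arctan N - 8 * N ^ 3 * arctan (- N)"
    using FTC by (simp add: integral_unique)
  also have "\<dots> = 16 * N ^ 3 * arctan N" by (simp add: arctan_minus)
  also have "\<dots> \<le> 16 * N ^ 3 * 2"
    using arctan_ubound[of N] pi_less_4 N by (intro mult_left_mono) auto
  also have "\<dots> = 1024 * (N ^ 3 / 32)" by simp
  also have "\<dots> \<le> 1024 * integral {x\<^sub>0 - 2..x\<^sub>0 + 2} (jackson_kernel x\<^sub>0 n)"
    using kernel_integral_lower[of n x\<^sub>0] by (intro mult_left_mono) (auto simp: N_def)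
  finally show ?thesis .
qed

section \<open>Moments of a transported weight\<close>

text \<open>
  Differentiation under the integral sign with an upper limit that moves with the parameter.  No
  derivative in the variable of integration is involved, so this applies to integrands that are
  merely continuous in it.
\<close>

lemma leibniz_affine_upper_limit:
  fixes g g' :: "real \<Rightarrow> real \<Rightarrow> complex"
  assumes g: "continuous_on (S \<times> {l..u}) (\<lambda>(\<xi>, y). g \<xi> y)"
    and g': "continuous_on (S \<times> {l..u}) (\<lambda>(\<xi>, y). g' \<xi> y)"
    and d: "\<And>\<xi> y. \<xi> \<in> S \<Longrightarrow> y \<in> {l..u} \<Longrightarrow> ((\<lambda>\<xi>. g \<xi> y) has_vector_derivative g' \<xi> y) (at \<xi> within S)"
    and S: "convex S" "\<xi> \<in> S" and maps: "\<And>\<xi>. \<xi> \<in> S \<Longrightarrow> \<xi> * p + q \<in> {l..u}"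
  shows "((\<lambda>\<xi>. integral {l..\<xi> * p + q} (g \<xi>)) has_vector_derivative
     p *\<^sub>R g \<xi> (\<xi> * p + q) + integral {l..\<xi> * p + q} (g' \<xi>)) (at \<xi> within S)"
proof -
  define s where "s = \<xi> * p + q"
  have s: "s \<in> {l..u}" using maps[OF S(2)] by (simp add: s_def)
  have gc: "continuous_on {l..u} (g \<xi>)" if "\<xi> \<in> S" for \<xi>
    by (rule continuous_on_compose2[OF g, of _ "\<lambda>y. (\<xi>, y)", simplified]) (use that in \<open>auto intro!: continuous_intros\<close>)
  have fx: "((\<lambda>\<xi>. integral {l..s} (g \<xi>)) has_derivative (\<lambda>t. t *\<^sub>R integral {l..s} (g' \<xi>))) (at \<xi> within S)"
  proof -
    have "((\<lambda>\<xi>. integral (cbox l s) (g \<xi>)) has_vector_derivative integral (cbox l s) (g' \<xi>)) (at \<xi> within S)"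
    proof (rule leibniz_rule_vector_derivative)
      show "((\<lambda>\<xi>. g \<xi> t) has_vector_derivative g' \<xi> t) (at \<xi> within S)" if "\<xi> \<in> S" "t \<in> cbox l s" for \<xi> t
        using d that s by auto
      show "g \<xi> integrable_on cbox l s" if "\<xi> \<in> S" for \<xi>
        using continuous_on_subset[OF gc[OF that], of "{l..s}"] s
        by (auto intro!: integrable_continuous_interval)
      show "continuous_on (S \<times> cbox l s) (\<lambda>(x, t). g' x t)"
        by (rule continuous_on_subset[OF g']) (use s in auto)
    qed (use S in auto)
    thus ?thesis by (simp add: has_vector_derivative_def)
  qed
  have fy: "((\<lambda>s. integral {l..s} (g \<xi>)) has_derivative blinfun_apply (blinfun_scaleR_left (g \<xi> s))) (at s within {l..u})"
    if "\<xi> \<in> S" "s \<in> {l..u}" for \<xi> s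
    using integral_has_vector_derivative[OF gc[OF that(1)] that(2)]
    by (simp add: has_vector_derivative_def)
  have "continuous_on (S \<times> {l..u}) (\<lambda>p. blinfun_scaleR_left (case p of (\<xi>, s) \<Rightarrow> g \<xi> s))"
    by (intro continuous_intros g)
  hence "continuous (at (\<xi>, s) within S \<times> {l..u}) (\<lambda>(\<xi>, s). blinfun_scaleR_left (g \<xi> s))"
    using S s by (simp add: continuous_on_eq_continuous_within split_def)
  note tot = has_derivative_partialsI[OF fx fy this s convex_real_interval(5)]
  have "((\<lambda>\<xi>. (\<xi>, \<xi> * p + q)) has_derivative (\<lambda>t. (t, t * p))) (at \<xi> within S)"
    by (auto intro!: derivative_eq_intros)
  moreover have "(\<lambda>\<xi>. (\<xi>, \<xi> * p + q)) ` S \<subseteq> S \<times> {l..u}" using maps by auto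
  hence "((\<lambda>(\<xi>, s). integral {l..s} (g \<xi>)) has_derivative
      (\<lambda>(tx, ty). tx *\<^sub>R integral {l..s} (g' \<xi>) + blinfun_apply (blinfun_scaleR_left (g \<xi> s)) ty))
      (at (\<xi>, \<xi> * p + q) within (\<lambda>\<xi>. (\<xi>, \<xi> * p + q)) ` S)"
    using has_derivative_subset[OF tot] by (simp add: s_def)
  ultimately have "((\<lambda>\<xi>. (\<lambda>(\<xi>, s). integral {l..s} (g \<xi>)) (\<xi>, \<xi> * p + q)) has_derivative 
     (\<lambda>t. (\<lambda>(tx, ty). tx *\<^sub>R integral {l..s} (g' \<xi>) + blinfun_apply (blinfun_scaleR_left (g \<xi> s)) ty) (t, t * p))) (at \<xi> within S)"
    by (rule has_derivative_in_compose)
  thus ?thesis by (simp add: has_vector_derivative_def s_def algebra_simps)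
qed

text \<open>
  A weight \<open>W\<close> that satisfies \<open>dW/d\<xi> = c W\<close> as a line turns about a fixed point \<open>(x, y)\<close>; this is
  the equation of the theorem after \<open>a\<close> has been removed.  The number \<open>r\<close> is a half-width in the
  slope \<open>\<xi>\<close>.  For \<open>|\<xi>| \<le> r\<close> the inequality \<open>r\<^sup>2/4 \<le> \<gamma>\<close> makes the lines with \<open>\<eta> < -\<gamma>\<close> miss the
  parabola, and for \<open>\<eta> \<le> \<gamma>\<close> the inequality \<open>r + \<gamma> \<le> 1\<close> confines the part of the line inside the
  parabola to \<open>|x| \<le> 1\<close>.
\<close>

locale transported_weight =
  fixes f :: "real \<times> real \<Rightarrow> complex" and W :: "real \<Rightarrow> real \<Rightarrow> real \<Rightarrow> real"
    and c :: "real \<Rightarrow> real \<Rightarrow> real" and r \<gamma> :: real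
  assumes f_cont: "continuous_on UNIV f"
    and f_supp: "\<And>x y. y < x\<^sup>2 \<Longrightarrow> f (x, y) = 0"
    and W_cont: "continuous_on UNIV (\<lambda>(x, \<xi>, \<eta>). W x \<xi> \<eta>)"
    and W_deriv: "\<And>x \<xi> y. ((\<lambda>\<xi>. W x \<xi> (y - \<xi> * x)) has_real_derivative
        c \<xi> (y - \<xi> * x) * W x \<xi> (y - \<xi> * x)) (at \<xi>)"
    and c_cont: "continuous_on UNIV (\<lambda>(\<xi>, \<eta>). c \<xi> \<eta>)"
    and r: "0 < r" and r_le: "r\<^sup>2 / 4 \<le> \<gamma>" "r + \<gamma> \<le> 1"
begin

lemma \<gamma>: "0 < \<gamma>" "\<gamma> \<le> 1" "r \<le> 1"
proof -
  have "0 < r\<^sup>2 / 4" using r by simp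
  thus "0 < \<gamma>" using r_le by linarith
  thus "\<gamma> \<le> 1" "r \<le> 1" using r_le r by auto
qed

lemma continuous_on_f [continuous_intros]: "continuous_on S u \<Longrightarrow> continuous_on S (\<lambda>p. f (u p))"
  by (rule continuous_on_compose2[OF f_cont]) auto

lemma continuous_on_W [continuous_intros]:
  assumes "continuous_on S u" "continuous_on S v" "continuous_on S w"
  shows "continuous_on S (\<lambda>p. W (u p) (v p) (w p))"
proof -
  have "continuous_on S (\<lambda>p. (u p, v p, w p))" by (intro continuous_intros assms)
  from continuous_on_compose2[OF W_cont this] show ?thesis by simp
qed

lemma continuous_on_c [continuous_intros]:
  assumes "continuous_on S v" "continuous_on S w"
  shows "continuous_on S (\<lambda>p. c (v p) (w p))"
proof -
  have "continuous_on S (\<lambda>p. (v p, w p))" by (intro continuous_intros assms)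
  from continuous_on_compose2[OF c_cont this] show ?thesis by simp
qed

definition "integrand x \<xi> \<eta> = f (x, \<xi> * x + \<eta>) * complex_of_real (W x \<xi> \<eta>)"

lemma continuous_on_integrand [continuous_intros]:
  assumes "continuous_on S u" "continuous_on S v" "continuous_on S w"
  shows "continuous_on S (\<lambda>p. integrand (u p) (v p) (w p))"
  unfolding integrand_def using assms by (intro continuous_intros) auto

lemma integrand_eq_0_low:
  assumes "\<bar>\<xi>\<bar> \<le> r" "\<eta> < - \<gamma>" shows "integrand x \<xi> \<eta> = 0"
proof -
  have "\<xi>\<^sup>2 \<le> r\<^sup>2" using assms(1) r by (metis abs_le_square_iff abs_of_pos)
  hence "\<eta> < - (\<xi>\<^sup>2 / 4)" using assms r_le by simp
  moreover have "0 \<le> (x - \<xi> / 2)\<^sup>2" by simp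
  hence "\<xi> * x - \<xi>\<^sup>2 / 4 \<le> x\<^sup>2" by (simp add: power2_eq_square algebra_simps)
  ultimately have "\<xi> * x + \<eta> < x\<^sup>2" by linarith
  thus ?thesis by (simp add: integrand_def f_supp)
qed

text \<open>
  The \<open>k\<close>-th moment, tested against \<open>\<psi>\<close> in the slope.  Testing replaces derivatives of the moment in
  \<open>\<xi>\<close>, which need not exist for Hoelder continuous \<open>f\<close>.
\<close>
definition "moment k \<eta> \<psi> = integral {-1..1} (\<lambda>x. integral {-r..r} (\<lambda>\<xi>. complex_of_real (x ^ k * \<psi> \<xi>) * integrand x \<xi> \<eta>))"

lemma continuous_on_moment:
  assumes "continuous_on {-r..r} \<psi>" "continuous_on {-r..r} \<psi>'"
  shows "continuous_on T (\<lambda>t. moment k t (\<lambda>\<xi>. \<psi>' \<xi> + c \<xi> t * \<psi> \<xi>))"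
proof -
  have "continuous_on (T \<times> {-1..1}) (\<lambda>(t, x). integral {-r..r}
      (\<lambda>\<xi>. complex_of_real (x ^ k * (\<psi>' \<xi> + c \<xi> t * \<psi> \<xi>)) * integrand x \<xi> t))"
    unfolding box_real(2)[symmetric] split_def
    by (rule integral_continuous_on_param)
       (auto simp: split_def intro!: continuous_intros continuous_on_compose2[OF assms(1)] continuous_on_compose2[OF assms(2)])
  thus ?thesis unfolding moment_def box_real(2)[symmetric]
    by (rule integral_continuous_on_param)
qed

text \<open>
  For fixed \<open>x\<close>, write the points of a line as \<open>(x, y)\<close> and consider
  \<open>\<psi>(\<xi>) \<integral> f(x, y) W(x, \<xi>, y - \<xi>x) dy\<close> over \<open>y \<le> \<xi>x + \<eta>\<close>.  It vanishes at \<open>\<xi> = \<plusminus>r\<close>, and its derivative in \<open>\<xi>\<close>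
  consists of the contribution \<open>x f W \<psi>\<close> of the moving end point and, since the derivative of \<open>W\<close> is
  \<open>c W\<close>, of the integral of \<open>f W (\<psi>' + c \<psi>)\<close>.  Integrating over \<open>\<xi>\<close> gives the identity.  In these
  coordinates \<open>f\<close> does not depend on \<open>\<xi>\<close>, so no derivative of \<open>f\<close> occurs.
\<close>

lemma line_identity:
  assumes \<psi>: "\<And>\<xi>. \<xi> \<in> {-r..r} \<Longrightarrow> (\<psi> has_real_derivative \<psi>' \<xi>) (at \<xi> within {-r..r})"
    and \<psi>': "continuous_on {-r..r} \<psi>'" and bd: "\<psi> r = 0" "\<psi> (-r) = 0"
    and x: "x \<in> {-1..1}" and \<eta>: "\<eta> \<in> {-\<gamma>..\<gamma>}"
  shows "integral {-r..r} (\<lambda>\<xi>. complex_of_real (x * \<psi> \<xi>) * integrand x \<xi> \<eta>)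
      = - integral {-r..r} (\<lambda>\<xi>. integral {-\<gamma>..\<eta>} (\<lambda>t. complex_of_real (\<psi>' \<xi> + c \<xi> t * \<psi> \<xi>) * integrand x \<xi> t))"
proof -
  define w where "w \<xi> y = W x \<xi> (y - \<xi> * x)" for \<xi> y
  define g where "g \<xi> y = complex_of_real (w \<xi> y * \<psi> \<xi>) * f (x, y)" for \<xi> y
  define g' where "g' \<xi> y = complex_of_real (w \<xi> y * (\<psi>' \<xi> + c \<xi> (y - \<xi> * x) * \<psi> \<xi>)) * f (x, y)" for \<xi> y
  have \<psi>c: "continuous_on {-r..r} \<psi>" using \<psi> by (rule DERIV_continuous_on)
  have cp: "continuous_on ({-r..r} \<times> T) (\<lambda>p. \<psi> (fst p))" "continuous_on ({-r..r} \<times> T) (\<lambda>p. \<psi>' (fst p))" for T :: "real set"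
    by (auto intro!: continuous_on_compose2[OF \<psi>c] continuous_on_compose2[OF \<psi>'] continuous_intros)
  (* Any lower limit below the parabola and below all -gamma + xi x would do in place of -4. *)
  have gc: "continuous_on ({-r..r} \<times> {-4..4}) (\<lambda>(\<xi>, y). g \<xi> y)"
    unfolding g_def w_def split_def by (intro continuous_intros cp)
  have gc': "continuous_on ({-r..r} \<times> {-4..4}) (\<lambda>(\<xi>, y). g' \<xi> y)"
    unfolding g'_def w_def split_def by (intro continuous_intros cp)
  have d: "((\<lambda>\<xi>. g \<xi> y) has_vector_derivative g' \<xi> y) (at \<xi> within {-r..r})" if "\<xi> \<in> {-r..r}" for \<xi> y
  proof -
    have "((\<lambda>\<xi>. w \<xi> y * \<psi> \<xi>) has_real_derivative w \<xi> y * (\<psi>' \<xi> + c \<xi> (y - \<xi> * x) * \<psi> \<xi>)) (at \<xi> within {-r..r})"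
      unfolding w_def
      by (rule derivative_eq_intros DERIV_subset[OF W_deriv] \<psi> that subset_UNIV refl)+ (simp add: algebra_simps)
    hence "((\<lambda>\<xi>. of_real (w \<xi> y * \<psi> \<xi>)) has_vector_derivative complex_of_real (w \<xi> y * (\<psi>' \<xi> + c \<xi> (y - \<xi> * x) * \<psi> \<xi>))) (at \<xi> within {-r..r})"
      by (rule has_vector_derivative_of_real)
    thus ?thesis unfolding g_def g'_def by (rule has_vector_derivative_mult_left)
  qed
  have rng: "\<xi> * x + \<eta> \<in> {-4..4}" if "\<xi> \<in> {-r..r}" for \<xi>
  proof -
    have "\<bar>\<xi> * x\<bar> \<le> 1 * 1" unfolding abs_mult by (intro mult_mono) (use that x \<gamma> in auto)
    thus ?thesis using \<eta> \<gamma> by auto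
  qed
  have D: "((\<lambda>\<xi>. integral {-4..\<xi> * x + \<eta>} (g \<xi>)) has_vector_derivative
      x *\<^sub>R g \<xi> (\<xi> * x + \<eta>) + integral {-4..\<xi> * x + \<eta>} (g' \<xi>)) (at \<xi> within {-r..r})"
    if "\<xi> \<in> {-r..r}" for \<xi>
    by (rule leibniz_affine_upper_limit[OF gc gc' d _ that rng]) auto
  have shift: "integral {-4..\<xi> * x + \<eta>} (g' \<xi>)
      = integral {-\<gamma>..\<eta>} (\<lambda>t. complex_of_real (\<psi>' \<xi> + c \<xi> t * \<psi> \<xi>) * integrand x \<xi> t)" (is "_ = integral _ ?h")
    if \<xi>: "\<xi> \<in> {-r..r}" for \<xi>
  proof -
    have "integral {-4..\<xi> * x + \<eta>} (g' \<xi>) = integral {(-4 - \<xi> * x) + \<xi> * x..\<eta> + \<xi> * x} (g' \<xi>)"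
      by (simp add: add.commute)
    also have "\<dots> = integral {-4 - \<xi> * x..\<eta>} (g' \<xi> \<circ> (+) (\<xi> * x))"
      by (rule integral_shift_Icc_real[symmetric])
    also have "g' \<xi> \<circ> (+) (\<xi> * x) = ?h"
      by (auto simp: g'_def w_def integrand_def fun_eq_iff add.commute)
    also have "integral {-4 - \<xi> * x..\<eta>} ?h = integral {-\<gamma>..\<eta>} ?h"
    proof (rule integral_spike_set)
      have E: "{t. t \<in> {-4 - \<xi> * x..\<eta>} - {-\<gamma>..\<eta>} \<and> ?h t \<noteq> 0} = {}"
        using integrand_eq_0_low[of \<xi>] \<xi> by (auto simp: abs_le_iff)
      show "negligible {t. t \<in> {-4 - \<xi> * x..\<eta>} - {-\<gamma>..\<eta>} \<and> ?h t \<noteq> 0}"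
        unfolding E by (rule negligible_empty)
      have "{-\<gamma>..\<eta>} \<subseteq> {-4 - \<xi> * x..\<eta>}"
      proof -
        have "\<bar>\<xi> * x\<bar> \<le> 1 * 1" unfolding abs_mult by (intro mult_mono) (use \<xi> x \<gamma> in auto)
        thus ?thesis using \<gamma> by auto
      qed
      hence E: "{t. t \<in> {-\<gamma>..\<eta>} - {-4 - \<xi> * x..\<eta>} \<and> ?h t \<noteq> 0} = {}" by blast
      show "negligible {t. t \<in> {-\<gamma>..\<eta>} - {-4 - \<xi> * x..\<eta>} \<and> ?h t \<noteq> 0}"
        unfolding E by (rule negligible_empty)
    qed
    finally show ?thesis .
  qed
  have ic: "continuous_on {-r..r} (\<lambda>\<xi>. integral {-\<gamma>..\<eta>} (\<lambda>t. complex_of_real (\<psi>' \<xi> + c \<xi> t * \<psi> \<xi>) * integrand x \<xi> t))"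
    unfolding box_real(2)[symmetric]
    by (rule integral_continuous_on_param) (auto simp: split_def intro!: continuous_intros cp)
  have first: "x *\<^sub>R g \<xi> (\<xi> * x + \<eta>) = complex_of_real (x * \<psi> \<xi>) * integrand x \<xi> \<eta>" for \<xi>
    by (simp add: g_def w_def integrand_def scaleR_conv_of_real)
  have "((\<lambda>\<xi>. complex_of_real (x * \<psi> \<xi>) * integrand x \<xi> \<eta> + integral {-\<gamma>..\<eta>} (\<lambda>t. complex_of_real (\<psi>' \<xi> + c \<xi> t * \<psi> \<xi>) * integrand x \<xi> t))
     has_integral (integral {-4..r * x + \<eta>} (g r) - integral {-4..(-r) * x + \<eta>} (g (-r)))) {-r..r}"
    by (rule fundamental_theorem_of_calculus) (use r D in \<open>auto simp: first shift\<close>)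
  moreover have "g r = (\<lambda>_. 0)" "g (-r) = (\<lambda>_. 0)" by (auto simp: g_def bd)
  ultimately have "integral {-r..r} (\<lambda>\<xi>. complex_of_real (x * \<psi> \<xi>) * integrand x \<xi> \<eta> + integral {-\<gamma>..\<eta>} (\<lambda>t. complex_of_real (\<psi>' \<xi> + c \<xi> t * \<psi> \<xi>) * integrand x \<xi> t)) = 0"
    by (simp add: integral_unique)
  also have "integral {-r..r} (\<lambda>\<xi>. complex_of_real (x * \<psi> \<xi>) * integrand x \<xi> \<eta> + integral {-\<gamma>..\<eta>} (\<lambda>t. complex_of_real (\<psi>' \<xi> + c \<xi> t * \<psi> \<xi>) * integrand x \<xi> t))
    = integral {-r..r} (\<lambda>\<xi>. complex_of_real (x * \<psi> \<xi>) * integrand x \<xi> \<eta>)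
    + integral {-r..r} (\<lambda>\<xi>. integral {-\<gamma>..\<eta>} (\<lambda>t. complex_of_real (\<psi>' \<xi> + c \<xi> t * \<psi> \<xi>) * integrand x \<xi> t))"
    by (intro integral_add integrable_continuous_interval ic continuous_intros \<psi>c)
  finally show ?thesis by (simp add: add_eq_0_iff2)
qed

text \<open>
  The recursion \<open>\<partial>\<^sub>\<eta> I\<^sub>k\<^sub>+\<^sub>1 = (\<partial>\<^sub>\<xi> - c) I\<^sub>k\<close> in weak form, integrated from \<open>-\<gamma>\<close>, where everything vanishes.
\<close>

lemma moment_Suc:
  assumes \<psi>: "\<And>\<xi>. \<xi> \<in> {-r..r} \<Longrightarrow> (\<psi> has_real_derivative \<psi>' \<xi>) (at \<xi> within {-r..r})"
    and \<psi>': "continuous_on {-r..r} \<psi>'" and bd: "\<psi> r = 0" "\<psi> (-r) = 0"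
    and \<eta>: "\<eta> \<in> {-\<gamma>..\<gamma>}"
  shows "moment (Suc k) \<eta> \<psi> = - integral {-\<gamma>..\<eta>} (\<lambda>t. moment k t (\<lambda>\<xi>. \<psi>' \<xi> + c \<xi> t * \<psi> \<xi>))"
proof -
  have \<psi>c: "continuous_on {-r..r} \<psi>" using \<psi> by (rule DERIV_continuous_on)
  define H where "H x \<xi> t = complex_of_real (x ^ k * (\<psi>' \<xi> + c \<xi> t * \<psi> \<xi>)) * integrand x \<xi> t" for x \<xi> t
  have "moment (Suc k) \<eta> \<psi> = integral {-1..1} (\<lambda>x. - integral {-\<gamma>..\<eta>} (\<lambda>t. integral {-r..r} (\<lambda>\<xi>. H x \<xi> t)))"
    unfolding moment_def
  proof (rule integral_cong)
    fix x :: real assume x: "x \<in> {-1..1}"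
    have "integral {-r..r} (\<lambda>\<xi>. complex_of_real (x ^ Suc k * \<psi> \<xi>) * integrand x \<xi> \<eta>)
        = of_real (x ^ k) * integral {-r..r} (\<lambda>\<xi>. complex_of_real (x * \<psi> \<xi>) * integrand x \<xi> \<eta>)"
      unfolding integral_mult_right[symmetric] by (simp add: algebra_simps)
    also have "\<dots> = - (of_real (x ^ k) * integral {-r..r} (\<lambda>\<xi>. integral {-\<gamma>..\<eta>} (\<lambda>t. complex_of_real (\<psi>' \<xi> + c \<xi> t * \<psi> \<xi>) * integrand x \<xi> t)))"
      by (subst line_identity[OF \<psi> \<psi>' bd x \<eta>]) auto
    also have "\<dots> = - integral {-r..r} (\<lambda>\<xi>. integral {-\<gamma>..\<eta>} (H x \<xi>))"
      unfolding integral_mult_right[symmetric] H_def by (simp add: algebra_simps)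
    also have "integral ({-r..r}) (\<lambda>\<xi>. integral ({-\<gamma>..\<eta>}) (H x \<xi>))
        = integral ({-\<gamma>..\<eta>}) (\<lambda>t. integral ({-r..r}) (\<lambda>\<xi>. H x \<xi> t))"
      unfolding box_real(2)[symmetric]
      by (rule integral_swap_continuous)
         (auto simp: H_def split_def intro!: continuous_intros continuous_on_compose2[OF \<psi>c] continuous_on_compose2[OF \<psi>'])
    finally show "integral {-r..r} (\<lambda>\<xi>. complex_of_real (x ^ Suc k * \<psi> \<xi>) * integrand x \<xi> \<eta>)
      = - integral {-\<gamma>..\<eta>} (\<lambda>t. integral {-r..r} (\<lambda>\<xi>. H x \<xi> t))" by simp
  qed
  also have "\<dots> = - integral {-1..1} (\<lambda>x. integral {-\<gamma>..\<eta>} (\<lambda>t. integral {-r..r} (\<lambda>\<xi>. H x \<xi> t)))"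
    by simp
  also have "integral ({-1..1}) (\<lambda>x. integral ({-\<gamma>..\<eta>}) (\<lambda>t. integral {-r..r} (\<lambda>\<xi>. H x \<xi> t)))
     = integral ({-\<gamma>..\<eta>}) (\<lambda>t. integral ({-1..1}) (\<lambda>x. integral {-r..r} (\<lambda>\<xi>. H x \<xi> t)))"
    unfolding box_real(2)[symmetric, of "-1"] box_real(2)[symmetric, of "-\<gamma>"]
  proof (rule integral_swap_continuous)
    show "continuous_on (cbox (- 1, - \<gamma>) (1, \<eta>)) (\<lambda>(x, t). integral {- r..r} (\<lambda>\<xi>. H x \<xi> t))"
      unfolding box_real(2)[symmetric] split_def
      by (rule integral_continuous_on_param)
         (auto simp: H_def split_def intro!: continuous_intros continuous_on_compose2[OF \<psi>c] continuous_on_compose2[OF \<psi>'])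
  qed
  finally show ?thesis by (simp add: moment_def H_def)
qed

definition "line_integral \<xi> \<eta> = integral {-1..1} (\<lambda>x. integrand x \<xi> \<eta>)"

lemma continuous_on_line_integral [continuous_intros]:
  assumes "continuous_on S u" "continuous_on S v"
  shows "continuous_on S (\<lambda>p. line_integral (u p) (v p))"
  unfolding line_integral_def box_real(2)[symmetric]
  by (rule integral_continuous_on_param)
     (auto simp: split_def intro!: continuous_intros continuous_on_compose2[OF assms(1)] continuous_on_compose2[OF assms(2)])

lemma moment_0:
  assumes \<psi>: "continuous_on {-r..r} \<psi>"
  shows "moment 0 \<eta> \<psi> = integral {-r..r} (\<lambda>\<xi>. of_real (\<psi> \<xi>) * line_integral \<xi> \<eta>)"
proof -
  have "integral (cbox (-1) 1) (\<lambda>x. integral (cbox (-r) r) (\<lambda>\<xi>. complex_of_real (\<psi> \<xi>) * integrand x \<xi> \<eta>))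
    = integral (cbox (-r) r) (\<lambda>\<xi>. integral (cbox (-1) 1) (\<lambda>x. complex_of_real (\<psi> \<xi>) * integrand x \<xi> \<eta>))"
    by (rule integral_swap_continuous)
       (auto simp: split_def intro!: continuous_intros continuous_on_compose2[OF \<psi>])
  thus ?thesis by (simp add: moment_def line_integral_def)
qed

lemma moment_0_bound:
  assumes \<psi>: "continuous_on {-r..r} \<psi>" and B: "\<And>\<xi>. \<xi> \<in> {-r..r} \<Longrightarrow> \<bar>\<psi> \<xi>\<bar> \<le> B"
  shows "norm (moment 0 \<eta> \<psi>) \<le> B * integral {-r..r} (\<lambda>\<xi>. norm (line_integral \<xi> \<eta>))"
proof -
  have "norm (moment 0 \<eta> \<psi>) \<le> integral {-r..r} (\<lambda>\<xi>. B * norm (line_integral \<xi> \<eta>))"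
    unfolding moment_0[OF \<psi>]
    by (rule Henstock_Kurzweil_Integration.integral_norm_bound_integral)
       (auto intro!: integrable_continuous_interval continuous_intros \<psi> mult_right_mono B simp: norm_mult)
  thus ?thesis by simp
qed

text \<open>
  Iterating the recursion down to the moment of order zero, which is the data.  Each step but the last integrates
  over an interval in \<open>\<eta>\<close> of length at most \<open>2\<close>, which accounts for \<open>2\<^sup>k\<close>, and applies
  \<open>transport_jet_bound\<close> once.  Each step also uses up one order of vanishing of the test function at the
  ends of its interval.
\<close>

lemma moment_Suc_bound:
  assumes cj: "\<And>\<eta>. \<eta> \<in> {-\<gamma>..\<gamma>} \<Longrightarrow> jet_on {-r..r} (\<lambda>j \<xi>. cj j \<xi> \<eta>)"
    and cj0: "\<And>\<xi> \<eta>. cj 0 \<xi> \<eta> = c \<xi> \<eta>"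
    and cjb: "\<And>j \<xi> \<eta>. \<xi> \<in> {-r..r} \<Longrightarrow> \<eta> \<in> {-\<gamma>..\<gamma>} \<Longrightarrow> \<bar>cj j \<xi> \<eta>\<bar> \<le> A * A ^ j * (fact j) ^ s"
    and A: "0 < A" "2 * A \<le> L" "1 \<le> s"
    and D: "integral {-\<gamma>..\<gamma>} (\<lambda>\<eta>. integral {-r..r} (\<lambda>\<xi>. norm (line_integral \<xi> \<eta>))) \<le> D"
  shows "jet_on {-r..r} G \<Longrightarrow> (\<And>j \<xi>. \<xi> \<in> {-r..r} \<Longrightarrow> \<bar>G j \<xi>\<bar> \<le> K * L ^ j * (fact (j + q)) ^ s) \<Longrightarrow>
     (\<And>j. j \<le> k \<Longrightarrow> G j r = 0 \<and> G j (-r) = 0) \<Longrightarrow> \<eta> \<in> {-\<gamma>..\<gamma>} \<Longrightarrow>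
     norm (moment (Suc k) \<eta> (G 0)) \<le> D * 2 ^ k * (K * (2 * L) ^ Suc k * (fact (Suc k + q)) ^ s)"
proof (induction k arbitrary: G K q \<eta>)
  case (0 G K q \<eta>)
  have L: "0 < L" using A by simp
  have K: "0 \<le> K"
  proof -
    have "0 \<le> \<bar>G 0 0\<bar>" by simp
    also have "\<dots> \<le> K * (fact q) ^ s" using 0(2)[of 0 0] r by simp
    finally show ?thesis by (smt (verit) fact_gt_zero mult_neg_pos zero_less_power)
  qed
  \<comment> \<open>a single integration by parts: the double integral \<open>D\<close> of the data appears\<close>
  define B where "B = 2 * L * K * (fact (Suc q)) ^ s"
  have B: "0 \<le> B" using L K by (simp add: B_def)
  have G0: "continuous_on {-r..r} (G 0)" and G1: "continuous_on {-r..r} (G (Suc 0))"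
    using jet_on_continuous[OF 0(1)] by auto
  have step: "norm (moment 0 t (\<lambda>\<xi>. G (Suc 0) \<xi> + c \<xi> t * G 0 \<xi>)) \<le> B * integral {-r..r} (\<lambda>\<xi>. norm (line_integral \<xi> t))"
    if t: "t \<in> {-\<gamma>..\<gamma>}" for t
  proof (rule moment_0_bound)
    show "continuous_on {- r..r} (\<lambda>\<xi>. G (Suc 0) \<xi> + c \<xi> t * G 0 \<xi>)"
      by (intro continuous_intros G0 G1)
    fix \<xi> assume \<xi>: "\<xi> \<in> {-r..r}"
    have "\<bar>transport_jet (\<lambda>j \<xi>. cj j \<xi> t) G 0 \<xi>\<bar> \<le> 2 * L * K * L ^ 0 * (fact (0 + Suc q)) ^ s"
      by (rule transport_jet_bound[where C = A]) (use cjb 0(2) \<xi> t A in auto)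
    thus "\<bar>G (Suc 0) \<xi> + c \<xi> t * G 0 \<xi>\<bar> \<le> B" by (simp add: transport_jet_def cj0 B_def)
  qed
  have iU: "continuous_on T (\<lambda>t. integral {-r..r} (\<lambda>\<xi>. norm (line_integral \<xi> t)))" for T
    unfolding box_real(2)[symmetric]
    by (rule integral_continuous_on_param) (auto simp: split_def intro!: continuous_intros)
  have nn: "0 \<le> integral {-r..r} (\<lambda>\<xi>. norm (line_integral \<xi> t))" for t
    by (rule integral_nonneg) (auto intro!: integrable_continuous_interval continuous_intros)
  have "moment (Suc 0) \<eta> (G 0) = - integral {-\<gamma>..\<eta>} (\<lambda>t. moment 0 t (\<lambda>\<xi>. G (Suc 0) \<xi> + c \<xi> t * G 0 \<xi>))"
    using jet_onD[OF 0(1)] G1 0(3)[of 0] 0(4) by (intro moment_Suc) auto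
  hence "norm (moment (Suc 0) \<eta> (G 0)) = norm (integral {-\<gamma>..\<eta>} (\<lambda>t. moment 0 t (\<lambda>\<xi>. G (Suc 0) \<xi> + c \<xi> t * G 0 \<xi>)))"
    by simp
  also have "\<dots> \<le> integral {-\<gamma>..\<eta>} (\<lambda>t. B * integral {-r..r} (\<lambda>\<xi>. norm (line_integral \<xi> t)))"
    by (rule Henstock_Kurzweil_Integration.integral_norm_bound_integral)
       (use 0(4) in \<open>auto intro!: integrable_continuous_interval continuous_on_moment G0 G1 continuous_intros iU step\<close>)
  also have "\<dots> \<le> integral {-\<gamma>..\<gamma>} (\<lambda>t. B * integral {-r..r} (\<lambda>\<xi>. norm (line_integral \<xi> t)))"
    using 0(4) B nn by (intro integral_subset_le integrable_continuous_interval continuous_intros iU mult_nonneg_nonneg) auto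
  also have "\<dots> = B * integral {-\<gamma>..\<gamma>} (\<lambda>t. integral {-r..r} (\<lambda>\<xi>. norm (line_integral \<xi> t)))" by simp
  also have "\<dots> \<le> B * D" using D B by (rule mult_left_mono)
  finally show ?case by (simp add: B_def algebra_simps)
next
  case (Suc k G K q \<eta>)
  define B where "B = D * 2 ^ k * ((2 * L * K) * (2 * L) ^ Suc k * (fact (Suc k + Suc q)) ^ s)"
  have G0: "continuous_on {-r..r} (G 0)" and G1: "continuous_on {-r..r} (G (Suc 0))"
    using jet_on_continuous[OF Suc.prems(1)] by auto
  have step: "norm (moment (Suc k) t (\<lambda>\<xi>. G (Suc 0) \<xi> + c \<xi> t * G 0 \<xi>)) \<le> B"
    if t: "t \<in> {-\<gamma>..\<gamma>}" for t
  proof -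
    have "norm (moment (Suc k) t (transport_jet (\<lambda>j \<xi>. cj j \<xi> t) G 0)) \<le> B"
      unfolding B_def
    proof (rule Suc.IH)
      show "jet_on {- r..r} (transport_jet (\<lambda>j \<xi>. cj j \<xi> t) G)"
        by (rule jet_on_transport_jet[OF cj[OF t] Suc.prems(1)])
      show "\<bar>transport_jet (\<lambda>j \<xi>. cj j \<xi> t) G j \<xi>\<bar> \<le> 2 * L * K * L ^ j * (fact (j + Suc q)) ^ s"
        if \<xi>: "\<xi> \<in> {-r..r}" for j \<xi>
        by (rule transport_jet_bound[where C = A]) (use cjb Suc.prems(2) \<xi> t A in auto)
      show "transport_jet (\<lambda>j \<xi>. cj j \<xi> t) G j r = 0 \<and> transport_jet (\<lambda>j \<xi>. cj j \<xi> t) G j (- r) = 0" if "j \<le> k" for j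
        using Suc.prems(3) that by (auto simp: transport_jet_def jet_mult_def intro!: sum.neutral)
    qed (use t in auto)
    also have "transport_jet (\<lambda>j \<xi>. cj j \<xi> t) G 0 = (\<lambda>\<xi>. G (Suc 0) \<xi> + c \<xi> t * G 0 \<xi>)"
      by (auto simp: transport_jet_def cj0)
    finally show ?thesis .
  qed
  have "moment (Suc (Suc k)) \<eta> (G 0) = - integral {-\<gamma>..\<eta>} (\<lambda>t. moment (Suc k) t (\<lambda>\<xi>. G (Suc 0) \<xi> + c \<xi> t * G 0 \<xi>))"
    using jet_onD[OF Suc.prems(1)] G1 Suc.prems(3)[of 0] Suc.prems(4) by (intro moment_Suc) auto
  hence "norm (moment (Suc (Suc k)) \<eta> (G 0)) = norm (integral {-\<gamma>..\<eta>} (\<lambda>t. moment (Suc k) t (\<lambda>\<xi>. G (Suc 0) \<xi> + c \<xi> t * G 0 \<xi>)))"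
    by simp
  also have "\<dots> \<le> B * (\<eta> - (-\<gamma>))"
    by (rule integral_bound) (use Suc.prems(4) step in \<open>auto intro!: continuous_on_moment G0 G1\<close>)
  also have "\<dots> \<le> B * 2"
    using Suc.prems(4) \<gamma> order_trans[OF norm_ge_zero step[OF Suc.prems(4)]] by (intro mult_left_mono) auto
  finally show ?case by (simp add: B_def algebra_simps)
qed

end

section \<open>From small moments to small values\<close>

lemma bump_integral_lower:
  fixes r :: real
  assumes "0 < r" "1 \<le> d"
  shows "r / (4 * real d) \<le> integral {-r..r} (\<lambda>\<xi>. (1 - (\<xi> / r)\<^sup>2) ^ d)"
proof -
  let ?I = "{0..r / (2 * real d)}"
  have d: "1 \<le> real d" using assms by simp
  have "r / (2 * real d) \<le> r / 1" using assms d by (intro divide_left_mono) auto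
  hence sub: "?I \<subseteq> {-r..r}" using assms by auto
  have "r / (4 * real d) = integral ?I (\<lambda>\<xi>. 1 / 2)" using assms by simp
  also have "\<dots> \<le> integral ?I (\<lambda>\<xi>. (1 - (\<xi> / r)\<^sup>2) ^ d)"
  proof (rule integral_le)
    fix \<xi> assume "\<xi> \<in> ?I"
    hence "0 \<le> \<xi> / r" "\<xi> / r \<le> 1 / (2 * real d)" using assms by (auto simp: field_simps)
    hence "(\<xi> / r)\<^sup>2 \<le> (1 / (2 * real d))\<^sup>2" by (intro power_mono)
    also have "\<dots> \<le> 1 / (2 * real d)" using d by (simp add: power2_eq_square field_simps)
    finally have t: "(\<xi> / r)\<^sup>2 \<le> 1 / (2 * real d)" .
    also have "\<dots> \<le> 1" using d by simp
    finally have t1: "(\<xi> / r)\<^sup>2 \<le> 1" .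
    have "1 / 2 \<le> 1 + real d * (- (\<xi> / r)\<^sup>2)" using t d by (simp add: field_simps)
    also have "\<dots> \<le> (1 + - (\<xi> / r)\<^sup>2) ^ d" by (rule Bernoulli_inequality) (use t1 in simp)
    finally show "1 / 2 \<le> (1 - (\<xi> / r)\<^sup>2) ^ d" by simp
  qed (use assms in \<open>auto intro!: integrable_continuous_interval continuous_intros\<close>)
  also have "\<dots> \<le> integral {-r..r} (\<lambda>\<xi>. (1 - (\<xi> / r)\<^sup>2) ^ d)"
  proof (intro integral_subset_le sub integrable_continuous_interval ballI)
    fix \<xi> assume "\<xi> \<in> {-r..r}"
    hence "\<bar>\<xi> / r\<bar> \<le> 1" using assms by (auto simp: abs_divide abs_le_iff)
    hence "(\<xi> / r)\<^sup>2 \<le> 1" by (simp add: abs_square_le_1)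
    thus "0 \<le> (1 - (\<xi> / r)\<^sup>2) ^ d" by simp
  qed (use assms in \<open>auto intro!: continuous_intros\<close>)
  finally show ?thesis .
qed

text \<open>
  This lets a first moment control the mean of \<open>\<tau>\<^sup>\<alpha>\<close> at scale \<open>1/n\<close>, with constants independent of \<open>\<alpha>\<close>.
\<close>

lemma powr_le_scaled:
  fixes n \<tau> \<alpha> :: real
  assumes "0 < n" "0 \<le> \<tau>" "0 < \<alpha>" "\<alpha> \<le> 1"
  shows "\<tau> powr \<alpha> \<le> n powr (-\<alpha>) * (1 + n * \<tau>)"
proof -
  have "(n * \<tau>) powr \<alpha> \<le> 1 + n * \<tau>"
  proof (cases "n * \<tau> \<le> 1")
    case True
    hence "(n * \<tau>) powr \<alpha> \<le> 1" using assms by (intro powr_le1) auto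
    also have "\<dots> \<le> 1 + n * \<tau>" using assms by simp
    finally show ?thesis .
  next
    case False
    hence "(n * \<tau>) powr \<alpha> \<le> (n * \<tau>) powr 1" using assms by (intro powr_mono) auto
    thus ?thesis using False by simp
  qed
  hence "n powr (-\<alpha>) * (n * \<tau>) powr \<alpha> \<le> n powr (-\<alpha>) * (1 + n * \<tau>)" by (intro mult_left_mono) auto
  thus ?thesis using assms by (simp add: powr_mult powr_minus field_simps)
qed

lemma integral_of_real_mult:
  fixes g :: "real \<Rightarrow> real" and z :: complex
  assumes "continuous_on {a..b} g"
  shows "integral {a..b} (\<lambda>x. of_real (g x) * z) = of_real (integral {a..b} g) * z"
  using integral_linear[OF integrable_continuous_interval[OF assms]
      bounded_linear_compose[OF bounded_linear_mult_left[of z] bounded_linear_of_real]]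
  by (simp add: o_def)

context transported_weight
begin

lemma integrand_eq_0_outside:
  assumes "\<bar>\<xi>\<bar> \<le> r" "\<eta> \<le> \<gamma>" "1 < \<bar>x\<bar>" shows "integrand x \<xi> \<eta> = 0"
proof -
  have "\<xi> * x \<le> \<bar>\<xi>\<bar> * \<bar>x\<bar>" by (metis abs_ge_self abs_mult)
  also have "\<dots> \<le> r * \<bar>x\<bar>" using assms by (intro mult_right_mono) auto
  finally have "\<xi> * x + \<eta> \<le> r * \<bar>x\<bar> + \<gamma> * 1" using assms by simp
  also have "\<dots> \<le> r * \<bar>x\<bar> + \<gamma> * \<bar>x\<bar>" using assms \<gamma> by (intro add_mono mult_left_mono) auto
  also have "\<dots> = (r + \<gamma>) * \<bar>x\<bar>" by (simp add: algebra_simps)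
  also have "\<dots> \<le> 1 * \<bar>x\<bar>" using r_le by (intro mult_right_mono) auto
  also have "\<dots> < \<bar>x\<bar> * \<bar>x\<bar>" using assms by (intro mult_strict_right_mono) auto
  finally have "\<xi> * x + \<eta> < x\<^sup>2" by (simp add: power2_eq_square)
  thus ?thesis by (simp add: integrand_def f_supp)
qed

text \<open>
  An average against a polynomial is a combination of moments.  The interval around \<open>x\<^sub>0\<close> may be
  replaced by \<open>[-1, 1]\<close>, since the integrand vanishes outside.
\<close>

lemma kernel_average:
  assumes \<phi>: "continuous_on {-r..r} \<phi>" and q: "coeff_bd d B \<kappa>" and x0: "\<bar>x\<^sub>0\<bar> \<le> 1" and M: "\<And>k. k \<le> d \<Longrightarrow> norm (moment k \<gamma> \<phi>) \<le> M"
  shows "norm (integral {x\<^sub>0 - 2..x\<^sub>0 + 2} (\<lambda>y. integral {-r..r} (\<lambda>\<xi>. complex_of_real (\<kappa> y * \<phi> \<xi>) * integrand y \<xi> \<gamma>))) \<le> B * M"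
proof -
  obtain a where a: "\<And>y. \<kappa> y = (\<Sum>k\<le>d. a k * y ^ k)" and aB: "(\<Sum>k\<le>d. \<bar>a k\<bar>) \<le> B"
    using q by (auto simp: coeff_bd_def)
  define I where "I k y = integral {-r..r} (\<lambda>\<xi>. complex_of_real (y ^ k * \<phi> \<xi>) * integrand y \<xi> \<gamma>)" for k y
  have Ic: "continuous_on T (I k)" for T k
    unfolding I_def box_real(2)[symmetric]
    by (rule integral_continuous_on_param)
       (auto simp: split_def intro!: continuous_intros continuous_on_compose2[OF \<phi>])
  have expand: "integral {-r..r} (\<lambda>\<xi>. complex_of_real (\<kappa> y * \<phi> \<xi>) * integrand y \<xi> \<gamma>) = (\<Sum>k\<le>d. of_real (a k) * I k y)" for y
  proof -
    have "integral {-r..r} (\<lambda>\<xi>. complex_of_real (\<kappa> y * \<phi> \<xi>) * integrand y \<xi> \<gamma>)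
        = integral {-r..r} (\<lambda>\<xi>. \<Sum>k\<le>d. of_real (a k) * (complex_of_real (y ^ k * \<phi> \<xi>) * integrand y \<xi> \<gamma>))"
      by (simp add: a sum_distrib_left sum_distrib_right mult_ac)
    also have "\<dots> = (\<Sum>k\<le>d. integral {-r..r} (\<lambda>\<xi>. of_real (a k) * (complex_of_real (y ^ k * \<phi> \<xi>) * integrand y \<xi> \<gamma>)))"
      by (intro integral_sum integrable_continuous_interval continuous_intros \<phi>) auto
    finally show ?thesis by (simp add: I_def)
  qed
  have "integral {x\<^sub>0 - 2..x\<^sub>0 + 2} (\<lambda>y. \<Sum>k\<le>d. of_real (a k) * I k y)
      = integral {-1..1} (\<lambda>y. \<Sum>k\<le>d. of_real (a k) * I k y)" (is "integral ?J ?g = _")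
  proof (rule integral_spike_set)
    have "?g y = 0" if "y \<notin> {-1..1}" for y
    proof -
      have "1 < \<bar>y\<bar>" using that by auto
      hence "I k y = integral {-r..r} (\<lambda>\<xi>. 0)" for k
        unfolding I_def by (intro integral_cong) (auto simp: integrand_eq_0_outside abs_le_iff)
      thus ?thesis by simp
    qed
    hence E: "{y. y \<in> ?J - {-1..1} \<and> ?g y \<noteq> 0} = {}" by blast
    show "negligible {y. y \<in> ?J - {-1..1} \<and> ?g y \<noteq> 0}"
      unfolding E by (rule negligible_empty)
    have "{-1..1} \<subseteq> ?J" using x0 by auto
    hence E: "{y. y \<in> {-1..1} - ?J \<and> ?g y \<noteq> 0} = {}" by blast
    show "negligible {y. y \<in> {-1..1} - ?J \<and> ?g y \<noteq> 0}"
      unfolding E by (rule negligible_empty)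
  qed
  also have "\<dots> = (\<Sum>k\<le>d. integral {-1..1} (\<lambda>y. of_real (a k) * I k y))"
    by (intro integral_sum integrable_continuous_interval continuous_intros Ic) auto
  also have "\<dots> = (\<Sum>k\<le>d. of_real (a k) * moment k \<gamma> \<phi>)"
    by (simp add: moment_def I_def)
  also have "norm \<dots> \<le> (\<Sum>k\<le>d. \<bar>a k\<bar> * M)"
    by (intro sum_norm_le) (auto simp: norm_mult intro!: mult_left_mono M)
  also have "\<dots> \<le> B * M"
    unfolding sum_distrib_right[symmetric] using aB order_trans[OF norm_ge_zero M[of 0]]
    by (intro mult_right_mono) auto
  finally show ?thesis by (simp only: expand)
qed

text \<open>
  The mean of the Hoelder modulus over the kernel, of width \<open>1/n\<close> in \<open>y\<close>, and the bump, of width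
  \<open>1/n\<close> in \<open>\<xi>\<close>, is \<open>O(n\<^sup>-\<^sup>\<alpha>)\<close>.
\<close>

lemma average_error:
  assumes \<phi>: "continuous_on {-r..r} \<phi>" "\<And>\<xi>. \<xi> \<in> {-r..r} \<Longrightarrow> 0 \<le> \<phi> \<xi>"
    and n: "1 \<le> n" "r = 1 / real n" and \<alpha>: "0 < \<alpha>" "\<alpha> \<le> 1" and E: "0 \<le> E"
    and H: "\<And>y \<xi>. y \<in> {x\<^sub>0 - 2..x\<^sub>0 + 2} \<Longrightarrow> \<xi> \<in> {-r..r} \<Longrightarrow>
        norm (integrand x\<^sub>0 0 \<gamma> - integrand y \<xi> \<gamma>) \<le> E * (\<bar>y - x\<^sub>0\<bar> + \<bar>\<xi>\<bar>) powr \<alpha>"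
  defines "Z \<equiv> integral {x\<^sub>0 - 2..x\<^sub>0 + 2} (jackson_kernel x\<^sub>0 n)" and "V \<equiv> integral {-r..r} \<phi>"
  shows "norm (of_real (Z * V) * integrand x\<^sub>0 0 \<gamma> - integral {x\<^sub>0 - 2..x\<^sub>0 + 2} (\<lambda>y. integral {-r..r}
      (\<lambda>\<xi>. complex_of_real (jackson_kernel x\<^sub>0 n y * \<phi> \<xi>) * integrand y \<xi> \<gamma>)))
    \<le> 1026 * E * real n powr (-\<alpha>) * (Z * V)"
proof -
  let ?J = "{x\<^sub>0 - 2..x\<^sub>0 + 2}" and ?h = "integrand x\<^sub>0 0 \<gamma>" and ?\<kappa> = "jackson_kernel x\<^sub>0 n"
  let ?e = "E * real n powr (-\<alpha>)"
  have e0: "0 \<le> ?e" using E by simp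
  have V0: "0 \<le> V" unfolding V_def by (intro integral_nonneg integrable_continuous_interval \<phi>)
  have kc: "continuous_on (?J \<times> {-r..r}) (\<lambda>p. ?\<kappa> (fst p))" "continuous_on (?J \<times> {-r..r}) (\<lambda>p. \<phi> (snd p))"
    by (auto intro!: continuous_on_compose2[OF continuous_on_kernel[of UNIV]] continuous_on_compose2[OF \<phi>(1)] continuous_intros)
  have c1: "continuous_on ?J (\<lambda>y. integral {-r..r} (\<lambda>\<xi>. complex_of_real (?\<kappa> y * \<phi> \<xi>) * integrand y \<xi> \<gamma>))"
    unfolding box_real(2)[symmetric]
    by (rule integral_continuous_on_param) (use kc in \<open>auto simp: split_def intro!: continuous_intros\<close>)
  have c2: "continuous_on ?J (\<lambda>y. integral {-r..r} (\<lambda>\<xi>. complex_of_real (?\<kappa> y * \<phi> \<xi>) * (?h - integrand y \<xi> \<gamma>)))"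
    unfolding box_real(2)[symmetric]
    by (rule integral_continuous_on_param) (use kc in \<open>auto simp: split_def intro!: continuous_intros\<close>)
  have inner: "of_real (V * ?\<kappa> y) * ?h - integral {-r..r} (\<lambda>\<xi>. complex_of_real (?\<kappa> y * \<phi> \<xi>) * integrand y \<xi> \<gamma>)
     = integral {-r..r} (\<lambda>\<xi>. complex_of_real (?\<kappa> y * \<phi> \<xi>) * (?h - integrand y \<xi> \<gamma>))" for y
  proof -
    have "integral {-r..r} (\<lambda>\<xi>. complex_of_real (?\<kappa> y * \<phi> \<xi>) * (?h - integrand y \<xi> \<gamma>))
      = integral {-r..r} (\<lambda>\<xi>. complex_of_real (?\<kappa> y * \<phi> \<xi>) * ?h) - integral {-r..r} (\<lambda>\<xi>. complex_of_real (?\<kappa> y * \<phi> \<xi>) * integrand y \<xi> \<gamma>)"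
      unfolding right_diff_distrib by (intro integral_diff integrable_continuous_interval continuous_intros \<phi>)
    also have "integral {-r..r} (\<lambda>\<xi>. complex_of_real (?\<kappa> y * \<phi> \<xi>) * ?h) = of_real (V * ?\<kappa> y) * ?h"
      by (subst integral_of_real_mult) (auto intro!: continuous_intros \<phi> simp: V_def)
    finally show ?thesis by simp
  qed
  have "of_real (Z * V) * ?h = integral ?J (\<lambda>y. of_real (V * ?\<kappa> y) * ?h)"
    by (subst integral_of_real_mult) (auto intro!: continuous_intros simp: Z_def)
  hence "norm (of_real (Z * V) * ?h - integral ?J (\<lambda>y. integral {-r..r} (\<lambda>\<xi>. complex_of_real (?\<kappa> y * \<phi> \<xi>) * integrand y \<xi> \<gamma>)))
      = norm (integral ?J (\<lambda>y. of_real (V * ?\<kappa> y) * ?h) - integral ?J (\<lambda>y. integral {-r..r} (\<lambda>\<xi>. complex_of_real (?\<kappa> y * \<phi> \<xi>) * integrand y \<xi> \<gamma>)))"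
    by (simp only:)
  also have "\<dots> = norm (integral ?J (\<lambda>y. integral {-r..r} (\<lambda>\<xi>. complex_of_real (?\<kappa> y * \<phi> \<xi>) * (?h - integrand y \<xi> \<gamma>))))"
    unfolding inner[symmetric]
    by (subst integral_diff[symmetric]) (intro integrable_continuous_interval continuous_intros c1 refl)+
  also have "\<dots> \<le> integral ?J (\<lambda>y. ?\<kappa> y * (?e * (2 + real n * \<bar>y - x\<^sub>0\<bar>)) * V)"
  proof (rule Henstock_Kurzweil_Integration.integral_norm_bound_integral)
    fix y assume y: "y \<in> ?J"
    have "norm (integral {-r..r} (\<lambda>\<xi>. complex_of_real (?\<kappa> y * \<phi> \<xi>) * (?h - integrand y \<xi> \<gamma>)))
        \<le> integral {-r..r} (\<lambda>\<xi>. (?\<kappa> y * (?e * (2 + real n * \<bar>y - x\<^sub>0\<bar>))) * \<phi> \<xi>)"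
    proof (rule Henstock_Kurzweil_Integration.integral_norm_bound_integral)
      fix \<xi> assume \<xi>: "\<xi> \<in> {-r..r}"
      have "\<bar>\<xi>\<bar> \<le> r" using \<xi> by auto
      hence "real n * \<bar>\<xi>\<bar> \<le> real n * r" by (intro mult_left_mono) auto
      also have "\<dots> = 1" using n by simp
      finally have "real n * \<bar>\<xi>\<bar> \<le> 1" .
      hence "norm (?h - integrand y \<xi> \<gamma>) \<le> ?e * (2 + real n * \<bar>y - x\<^sub>0\<bar>)"
      proof -
        have "norm (?h - integrand y \<xi> \<gamma>) \<le> E * (\<bar>y - x\<^sub>0\<bar> + \<bar>\<xi>\<bar>) powr \<alpha>" by (rule H[OF y \<xi>])
        also have "\<dots> \<le> E * (real n powr (-\<alpha>) * (1 + real n * (\<bar>y - x\<^sub>0\<bar> + \<bar>\<xi>\<bar>)))"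
          using n by (intro mult_left_mono E powr_le_scaled \<alpha>) auto
        also have "\<dots> \<le> E * (real n powr (-\<alpha>) * (2 + real n * \<bar>y - x\<^sub>0\<bar>))"
          using \<open>real n * \<bar>\<xi>\<bar> \<le> 1\<close> by (intro mult_left_mono E) (auto simp: algebra_simps)
        finally show ?thesis by (simp add: mult.assoc)
      qed
      hence "(?\<kappa> y * \<phi> \<xi>) * norm (?h - integrand y \<xi> \<gamma>) \<le> (?\<kappa> y * \<phi> \<xi>) * (?e * (2 + real n * \<bar>y - x\<^sub>0\<bar>))"
        by (intro mult_left_mono mult_nonneg_nonneg kernel_nonneg \<phi>(2) \<xi>)
      moreover have "norm (complex_of_real (?\<kappa> y * \<phi> \<xi>)) = ?\<kappa> y * \<phi> \<xi>"
        unfolding norm_of_real by (intro abs_of_nonneg mult_nonneg_nonneg kernel_nonneg \<phi>(2) \<xi>)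
      ultimately show "norm (complex_of_real (?\<kappa> y * \<phi> \<xi>) * (?h - integrand y \<xi> \<gamma>)) \<le> (?\<kappa> y * (?e * (2 + real n * \<bar>y - x\<^sub>0\<bar>))) * \<phi> \<xi>"
        unfolding norm_mult by (simp only: mult_ac)
    qed (intro integrable_continuous_interval continuous_intros \<phi>)+
    also have "\<dots> = ?\<kappa> y * (?e * (2 + real n * \<bar>y - x\<^sub>0\<bar>)) * V"
      unfolding V_def by (rule integral_mult_right)
    finally show "norm (integral {-r..r} (\<lambda>\<xi>. complex_of_real (?\<kappa> y * \<phi> \<xi>) * (?h - integrand y \<xi> \<gamma>)))
        \<le> ?\<kappa> y * (?e * (2 + real n * \<bar>y - x\<^sub>0\<bar>)) * V" .
  qed (intro integrable_continuous_interval continuous_intros c2)+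
  also have "\<dots> = integral ?J (\<lambda>y. (?e * V) * (2 * ?\<kappa> y + ?\<kappa> y * (real n * \<bar>y - x\<^sub>0\<bar>)))"
    by (intro integral_cong) (simp add: algebra_simps)
  also have "\<dots> = (?e * V) * (2 * Z + integral ?J (\<lambda>y. ?\<kappa> y * (real n * \<bar>y - x\<^sub>0\<bar>)))"
    unfolding Z_def
    by (subst integral_mult_right, subst integral_add) (auto intro!: integrable_continuous_interval continuous_intros)
  also have "\<dots> \<le> (?e * V) * (2 * Z + 1024 * Z)"
    unfolding Z_def by (intro mult_left_mono add_left_mono kernel_moment mult_nonneg_nonneg e0 V0)
  finally show ?thesis by (simp add: algebra_simps)
qed

text \<open>
  The value at \<open>x\<^sub>0\<close> differs from the normalised average by \<open>O(n\<^sup>-\<^sup>\<alpha>)\<close>, and the average is bounded by the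
  coefficients of the kernel, at most \<open>7\<^sup>4\<^sup>n\<close>, times the moments up to order \<open>8n\<close>, at most
  \<open>(64 n\<^sup>2)\<^sup>8\<^sup>n ((8n)!)\<^sup>s\<close> times the data.  All of this has the shape \<open>(const n\<^sup>p)\<^sup>n\<close>.
\<close>

lemma pointwise_bound:
  assumes cj: "\<And>\<eta>. \<eta> \<in> {-\<gamma>..\<gamma>} \<Longrightarrow> jet_on {-r..r} (\<lambda>j \<xi>. cj j \<xi> \<eta>)"
    and cj0: "\<And>\<xi> \<eta>. cj 0 \<xi> \<eta> = c \<xi> \<eta>"
    and cjb: "\<And>j \<xi> \<eta>. \<xi> \<in> {-r..r} \<Longrightarrow> \<eta> \<in> {-\<gamma>..\<gamma>} \<Longrightarrow> \<bar>cj j \<xi> \<eta>\<bar> \<le> A * A ^ j * (fact j) ^ s"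
    and A: "0 < A" "2 * A \<le> 16 * (real n)\<^sup>2" "1 \<le> s"
    and D: "integral {-\<gamma>..\<gamma>} (\<lambda>\<eta>. integral {-r..r} (\<lambda>\<xi>. norm (line_integral \<xi> \<eta>))) \<le> D"
      "integral {-r..r} (\<lambda>\<xi>. norm (line_integral \<xi> \<gamma>)) \<le> D"
    and n: "1 \<le> n" "r = 1 / real n" and \<alpha>: "0 < \<alpha>" "\<alpha> \<le> 1" and E: "0 \<le> E" and x0: "\<bar>x\<^sub>0\<bar> \<le> 1"
    and H: "\<And>y \<xi>. y \<in> {x\<^sub>0 - 2..x\<^sub>0 + 2} \<Longrightarrow> \<xi> \<in> {-r..r} \<Longrightarrow>
        norm (integrand x\<^sub>0 0 \<gamma> - integrand y \<xi> \<gamma>) \<le> E * (\<bar>y - x\<^sub>0\<bar> + \<bar>\<xi>\<bar>) powr \<alpha>"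
  shows "norm (integrand x\<^sub>0 0 \<gamma>) \<le> 1026 * E * real n powr (-\<alpha>)
     + (1024 * 7 ^ 4 * 64 ^ 8 * 8 ^ (8 * s) * real n ^ (18 + 8 * s)) ^ n * D"
proof -
  \<comment> \<open>the degree of the kernel, hence the number of moments that are needed; a bump of the same
    order on \<open>[-1/n, 1/n]\<close> has derivatives bounded by powers of \<open>2d/r = 16n\<^sup>2\<close>\<close>
  define d where "d = 8 * n"
  define L where "L = 16 * (real n)\<^sup>2"
  have nr: "1 \<le> real n" using n by simp
  have Ld: "2 * real d / r = L" using n by (simp add: d_def L_def power2_eq_square)
  have L1: "1 \<le> L" using one_le_power[OF nr, of 2] by (simp add: L_def)
  obtain G where G': "jet_on {-r..r} G" "\<forall>x. G 0 x = (1 - (x / r)\<^sup>2) ^ d"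
     "\<forall>j. \<forall>x\<in>{-r..r}. \<bar>G j x\<bar> \<le> L ^ j" "\<forall>j<d. G j r = 0 \<and> G j (-r) = 0"
    using bump_jet[OF r, of d] unfolding Ld by (elim exE conjE) (rule that)
  note G = G'(1) G'(2)[rule_format] G'(3)[rule_format] G'(4)[rule_format]
  define \<phi> where "\<phi> = G 0"
  have \<phi>c: "continuous_on {-r..r} \<phi>" unfolding \<phi>_def by (rule jet_on_continuous[OF G(1)])
  have \<phi>0: "0 \<le> \<phi> \<xi>" if "\<xi> \<in> {-r..r}" for \<xi>
  proof -
    have "\<bar>\<xi> / r\<bar> \<le> 1" using that r by (auto simp: abs_divide abs_le_iff)
    hence "(\<xi> / r)\<^sup>2 \<le> 1" by (simp add: abs_square_le_1)
    thus ?thesis by (simp add: \<phi>_def G(2))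
  qed
  define Z where "Z = integral {x\<^sub>0 - 2..x\<^sub>0 + 2} (jackson_kernel x\<^sub>0 n)"
  define V where "V = integral {-r..r} \<phi>"
  define P where "P = integral {x\<^sub>0 - 2..x\<^sub>0 + 2} (\<lambda>y. integral {-r..r}
      (\<lambda>\<xi>. complex_of_real (jackson_kernel x\<^sub>0 n y * \<phi> \<xi>) * integrand y \<xi> \<gamma>))"
  have D0: "0 \<le> D"
  proof -
    have "0 \<le> integral {-r..r} (\<lambda>\<xi>. norm (line_integral \<xi> \<gamma>))"
      by (intro integral_nonneg integrable_continuous_interval continuous_intros) auto
    thus ?thesis using D(2) by linarith
  qed
  define Mo where "Mo = D * ((4 * L) ^ d * (fact d) ^ s)"
  have mom: "norm (moment k \<gamma> \<phi>) \<le> Mo" if k: "k \<le> d" for k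
  proof -
    have "norm (moment k \<gamma> \<phi>) \<le> D * ((4 * L) ^ k * (fact k) ^ s)"
    proof (cases k)
      case 0
      have "norm (moment 0 \<gamma> \<phi>) \<le> 1 * integral {-r..r} (\<lambda>\<xi>. norm (line_integral \<xi> \<gamma>))"
        by (rule moment_0_bound[OF \<phi>c]) (use G(3)[of _ 0] in \<open>simp add: \<phi>_def\<close>)
      thus ?thesis using D(2) 0 by simp
    next
      case (Suc k')
      have "norm (moment (Suc k') \<gamma> (G 0)) \<le> D * 2 ^ k' * (1 * (2 * L) ^ Suc k' * (fact (Suc k' + 0)) ^ s)"
      proof (rule moment_Suc_bound[OF cj cj0 cjb A(1) _ A(3) D(1) G(1)])
        show "\<bar>G j \<xi>\<bar> \<le> 1 * L ^ j * fact (j + 0) ^ s" if "\<xi> \<in> {-r..r}" for j \<xi>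
        proof -
          have "\<bar>G j \<xi>\<bar> \<le> L ^ j * 1" using G(3)[OF that] by simp
          also have "\<dots> \<le> L ^ j * fact j ^ s" using L1 by (intro mult_left_mono one_le_power) auto
          finally show ?thesis by simp
        qed
      qed (use k Suc G(4) \<gamma> A(2) in \<open>auto simp: L_def\<close>)
      also have "\<dots> = D * (2 ^ k' * (2 * L) ^ Suc k' * (fact (Suc k')) ^ s)" by simp
      also have "\<dots> \<le> D * (2 ^ Suc k' * (2 * L) ^ Suc k' * (fact (Suc k')) ^ s)"
        using D0 L1 by (intro mult_left_mono mult_right_mono power_increasing) auto
      also have "2 ^ Suc k' * (2 * L) ^ Suc k' = (4 * L) ^ Suc k'"
        unfolding power_mult_distrib[symmetric] by simp
      finally show ?thesis using Suc by (simp add: \<phi>_def)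
    qed
    also have "\<dots> \<le> Mo" unfolding Mo_def
      using k L1 D0 by (intro mult_left_mono mult_mono power_increasing power_mono fact_mono) auto
    finally show ?thesis .
  qed
  have P: "norm P \<le> 7 ^ (4 * n) * Mo"
    unfolding P_def
    by (rule kernel_average[OF \<phi>c _ x0]) (use mom coeff_bd_kernel[OF x0, of n] in \<open>auto simp: d_def\<close>)
  have avg: "norm (of_real (Z * V) * integrand x\<^sub>0 0 \<gamma> - P) \<le> 1026 * E * real n powr (-\<alpha>) * (Z * V)"
    unfolding Z_def V_def P_def by (rule average_error[OF \<phi>c \<phi>0 n \<alpha> E H])
  \<comment> \<open>the normalising factor is at least polynomially small in \<open>n\<close>\<close>
  have "1 / 32 \<le> (2 * real n + 1) ^ 3 / 32" by (intro divide_right_mono one_le_power) auto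
  hence Z: "1 / 32 \<le> Z" unfolding Z_def using kernel_integral_lower[of n x\<^sub>0] by linarith
  have "1 / (32 * (real n)\<^sup>2) = r / (4 * real d)" using n by (simp add: d_def power2_eq_square)
  also have "\<dots> \<le> V" unfolding V_def \<phi>_def G(2) by (rule bump_integral_lower) (use r n in \<open>auto simp: d_def\<close>)
  finally have V: "1 / (32 * (real n)\<^sup>2) \<le> V" .
  have "1 / (1024 * (real n)\<^sup>2) = 1 / 32 * (1 / (32 * (real n)\<^sup>2))" by simp
  also have "\<dots> \<le> Z * V" using Z V by (intro mult_mono) auto
  finally have ZV: "1 / (1024 * (real n)\<^sup>2) \<le> Z * V" .
  have n2: "0 < (real n)\<^sup>2" using nr by simp
  have "0 < 1 / (1024 * (real n)\<^sup>2)" using n2 by simp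
  hence ZV0: "0 < Z * V" using ZV by (rule less_le_trans)
  have "norm (of_real (Z * V) * integrand x\<^sub>0 0 \<gamma>) \<le> 1026 * E * real n powr (-\<alpha>) * (Z * V) + norm P"
    using avg norm_triangle_ineq2[of "of_real (Z * V) * integrand x\<^sub>0 0 \<gamma>" P] by linarith
  also have "norm P \<le> norm P * (1024 * (real n)\<^sup>2) * (Z * V)"
  proof -
    have "(1024 * (real n)\<^sup>2) * (1 / (1024 * (real n)\<^sup>2)) \<le> (1024 * (real n)\<^sup>2) * (Z * V)"
      using ZV by (intro mult_left_mono) auto
    hence "1 \<le> (1024 * (real n)\<^sup>2) * (Z * V)" using n2 by simp
    from mult_left_mono[OF this norm_ge_zero[of P]] show ?thesis by (simp add: mult.assoc)
  qed
  finally have "(Z * V) * norm (integrand x\<^sub>0 0 \<gamma>) \<le> (Z * V) * (1026 * E * real n powr (-\<alpha>) + norm P * (1024 * (real n)\<^sup>2))"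
    using ZV0 by (simp add: norm_mult algebra_simps del: of_real_mult)
  hence "norm (integrand x\<^sub>0 0 \<gamma>) \<le> 1026 * E * real n powr (-\<alpha>) + norm P * (1024 * (real n)\<^sup>2)"
    using ZV0 by (simp only: mult_le_cancel_left_pos)
  also have "norm P * (1024 * (real n)\<^sup>2) \<le> (7 ^ (4 * n) * Mo) * (1024 * (real n)\<^sup>2)"
    using P by (intro mult_right_mono) auto
  also have "\<dots> \<le> (1024 * 7 ^ 4 * 64 ^ 8 * 8 ^ (8 * s) * real n ^ (18 + 8 * s)) ^ n * D"
  proof -
    have fd: "(fact d :: real) \<le> (8 * real n) ^ (8 * n)"
      using fact_le_power[of d, where 'a = real] by (simp add: d_def)
    have "7 ^ (4 * n) * ((4 * L) ^ d * (fact d) ^ s) * (1024 * (real n)\<^sup>2)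
        \<le> 7 ^ (4 * n) * ((64 * (real n)\<^sup>2) ^ (8 * n) * ((8 * real n) ^ (8 * n)) ^ s) * (1024 ^ n * ((real n)\<^sup>2) ^ n)"
    proof (intro mult_mono mult_left_mono)
      show "(4 * L) ^ d \<le> (64 * (real n)\<^sup>2) ^ (8 * n)" by (simp add: L_def d_def)
      show "(fact d) ^ s \<le> ((8 * real n) ^ (8 * n)) ^ s" by (intro power_mono fd) auto
      show "(1024 :: real) \<le> 1024 ^ n" using n by (intro self_le_power) auto
      show "(real n)\<^sup>2 \<le> ((real n)\<^sup>2) ^ n" using n nr by (intro self_le_power one_le_power) auto
    qed (use L1 in auto)
    also have "\<dots> = (7 ^ 4) ^ n * ((64 ^ 8 * real n ^ 16) ^ n * (8 ^ (8 * s) * real n ^ (8 * s)) ^ n) * (1024 ^ n * ((real n)\<^sup>2) ^ n)"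
    proof -
      have "(64 * (real n)\<^sup>2) ^ (8 * n) = ((64 * (real n)\<^sup>2) ^ 8) ^ n" by (rule power_mult)
      also have "(64 * (real n)\<^sup>2) ^ 8 = 64 ^ 8 * real n ^ 16"
        unfolding power_mult_distrib power_mult[symmetric] by simp
      finally have e2: "(64 * (real n)\<^sup>2) ^ (8 * n) = (64 ^ 8 * real n ^ 16) ^ n" .
      have "((8 * real n) ^ (8 * n)) ^ s = (8 * real n) ^ ((8 * s) * n)"
        unfolding power_mult[symmetric] by (simp only: mult_ac)
      also have "\<dots> = (8 ^ (8 * s) * real n ^ (8 * s)) ^ n"
        by (simp only: power_mult[of _ "8 * s"] power_mult_distrib)
      finally have e3: "((8 * real n) ^ (8 * n)) ^ s = (8 ^ (8 * s) * real n ^ (8 * s)) ^ n" .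
      show ?thesis by (simp only: e2 e3 power_mult[of 7])
    qed
    also have "\<dots> = (7 ^ 4 * (64 ^ 8 * real n ^ 16 * (8 ^ (8 * s) * real n ^ (8 * s))) * (1024 * (real n)\<^sup>2)) ^ n"
      by (simp only: power_mult_distrib)
    also have "7 ^ 4 * (64 ^ 8 * real n ^ 16 * (8 ^ (8 * s) * real n ^ (8 * s))) * (1024 * (real n)\<^sup>2)
        = 1024 * 7 ^ 4 * 64 ^ 8 * 8 ^ (8 * s) * (real n ^ 16 * real n ^ 2 * real n ^ (8 * s))"
      by (simp only: mult_ac)
    also have "real n ^ 16 * real n ^ 2 * real n ^ (8 * s) = real n ^ (18 + 8 * s)"
      unfolding power_add[symmetric] by simp
    finally have "7 ^ (4 * n) * ((4 * L) ^ d * (fact d) ^ s) * (1024 * (real n)\<^sup>2) * D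
       \<le> (1024 * 7 ^ 4 * 64 ^ 8 * 8 ^ (8 * s) * real n ^ (18 + 8 * s)) ^ n * D"
      using D0 by (rule mult_right_mono)
    thus ?thesis by (simp only: Mo_def mult_ac)
  qed
  finally show ?thesis by simp
qed

end

section \<open>Removing the first-order potential\<close>

lemma smooth_onD:
  assumes "smooth_on UNIV g" "set vs \<subseteq> Basis"
  shows "(iter_partial vs g has_derivative frechet_derivative (iter_partial vs g) (at p)) (at p)"
  using assms by (auto simp: smooth_on_def lists_eq_set differentiable_on_def frechet_derivative_works)

lemma smooth_on_continuous:
  assumes "smooth_on UNIV g" "set vs \<subseteq> Basis"
  shows "continuous_on S (iter_partial vs g)"
  by (rule continuous_on_subset[OF has_derivative_continuous_on[of UNIV]])
     (use smooth_onD[OF assms] in auto)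

lemma smooth_on_directional:
  assumes "smooth_on UNIV g" "set vs \<subseteq> Basis" "(u has_vector_derivative v) (at t within S)"
  shows "((\<lambda>t. iter_partial vs g (u t)) has_vector_derivative
     frechet_derivative (iter_partial vs g) (at (u t)) v) (at t within S)"
proof -
  have d: "(iter_partial vs g has_derivative frechet_derivative (iter_partial vs g) (at (u t))) (at (u t))"
    by (rule smooth_onD[OF assms(1,2)])
  have "((\<lambda>t. iter_partial vs g (u t)) has_derivative
     (\<lambda>h. frechet_derivative (iter_partial vs g) (at (u t)) (h *\<^sub>R v))) (at t within S)"
    using has_derivative_compose[OF assms(3)[unfolded has_vector_derivative_def] d] by simp
  thus ?thesis
    by (simp add: has_vector_derivative_def linear_cmul[OF has_derivative_linear[OF d]])
qed

lemma smooth_on_partials2: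
  fixes g :: "real \<times> real \<Rightarrow> real"
  assumes g: "smooth_on UNIV g" "set vs \<subseteq> Basis"
    and u: "(u has_real_derivative u') (at t within S)" and w: "(w has_real_derivative w') (at t within S)"
  shows "((\<lambda>t. iter_partial vs g (u t, w t)) has_real_derivative
     u' * iter_partial ((1, 0) # vs) g (u t, w t) + w' * iter_partial ((0, 1) # vs) g (u t, w t)) (at t within S)"
proof -
  let ?D = "frechet_derivative (iter_partial vs g) (at (u t, w t))"
  have lin: "linear ?D" using has_derivative_linear[OF smooth_onD[OF g]] .
  have "((\<lambda>t. (u t, w t)) has_vector_derivative (u', w')) (at t within S)"
    using u w by (intro has_vector_derivative_Pair) (auto simp: has_real_derivative_iff_has_vector_derivative)
  from smooth_on_directional[OF g this]
  have "((\<lambda>t. iter_partial vs g (u t, w t)) has_real_derivative ?D (u', w')) (at t within S)"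
    by (simp add: has_real_derivative_iff_has_vector_derivative)
  also have "?D (u', w') = ?D (u' *\<^sub>R (1, 0) + w' *\<^sub>R (0, 1))" by simp
  also have "\<dots> = u' * ?D (1, 0) + w' * ?D (0, 1)"
    by (simp only: linear_add[OF lin] linear_cmul[OF lin] real_scaleR_def)
  finally show ?thesis by (simp add: partial_deriv_def)
qed

lemma smooth_on_partials3:
  fixes g :: "real \<times> real \<times> real \<Rightarrow> real"
  assumes g: "smooth_on UNIV g"
  shows "((\<lambda>\<xi>. g (x, \<xi>, y - \<xi> * x)) has_real_derivative
     partial_deriv (0, 1, 0) g (x, \<xi>, y - \<xi> * x) - x * partial_deriv (0, 0, 1) g (x, \<xi>, y - \<xi> * x)) (at \<xi>)"
proof -
  let ?p = "(x, \<xi>, y - \<xi> * x)"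
  let ?D = "frechet_derivative g (at ?p)"
  have lin: "linear ?D" using has_derivative_linear[OF smooth_onD[OF g, of "[]"]] by simp
  have "((\<lambda>\<xi>. (x, \<xi>, y - \<xi> * x)) has_vector_derivative (0, 1, - x)) (at \<xi>)"
    by (intro has_vector_derivative_Pair)
       (auto intro!: derivative_eq_intros simp flip: has_real_derivative_iff_has_vector_derivative)
  from smooth_on_directional[OF g _ this, of "[]"]
  have "((\<lambda>\<xi>. g (x, \<xi>, y - \<xi> * x)) has_real_derivative ?D (0, 1, - x)) (at \<xi>)"
    by (simp add: has_real_derivative_iff_has_vector_derivative)
  also have "?D (0, 1, - x) = ?D ((0, 1, 0) + (- x) *\<^sub>R (0, 0, 1))" by simp
  also have "\<dots> = ?D (0, 1, 0) + (- x) * ?D (0, 0, 1)"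
    by (simp only: linear_add[OF lin] linear_cmul[OF lin] real_scaleR_def)
  finally show ?thesis by (simp add: partial_deriv_def)
qed

text \<open>
  Only pure \<open>\<xi>\<close>-derivatives enter the estimates, because the recursion differentiates in \<open>\<xi>\<close> alone.
\<close>

abbreviation xi_deriv :: "nat \<Rightarrow> (real \<times> real \<Rightarrow> real) \<Rightarrow> real \<times> real \<Rightarrow> real" where
  "xi_deriv j g \<equiv> iter_partial (replicate j (1, 0)) g"

lemma replicate_Basis2: "set (replicate j (1, 0)) \<subseteq> (Basis :: (real \<times> real) set)"
  by (auto simp: Basis_prod_def)

lemma has_derivative_xi_deriv:
  assumes "smooth_on UNIV g"
  shows "((\<lambda>\<xi>. xi_deriv j g (\<xi>, \<eta>)) has_real_derivative xi_deriv (Suc j) g (\<xi>, \<eta>)) (at \<xi> within S)"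
proof -
  have "((\<lambda>\<xi>. xi_deriv j g (\<xi>, \<eta>)) has_real_derivative
      1 * xi_deriv (Suc j) g (\<xi>, \<eta>) + 0 * iter_partial ((0, 1) # replicate j (1, 0)) g (\<xi>, \<eta>)) (at \<xi> within S)"
    unfolding replicate_Suc
    by (rule smooth_on_partials2[OF assms replicate_Basis2]) auto
  thus ?thesis by simp
qed

lemma continuous_on_xi_deriv [continuous_intros]:
  assumes "smooth_on UNIV g" "continuous_on S u"
  shows "continuous_on S (\<lambda>p. xi_deriv j g (u p))"
  by (rule continuous_on_compose2[OF smooth_on_continuous[OF assms(1) replicate_Basis2] assms(2)]) auto

lemma gevrey_xi_deriv_bound:
  fixes g :: "real \<times> real \<Rightarrow> real"
  assumes "g \<in> gevrey \<sigma> UNIV" and s: "\<sigma> \<le> real s"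
  obtains C where "1 \<le> C"
    "\<And>j \<xi> \<eta>. \<bar>\<xi>\<bar> \<le> 1 \<Longrightarrow> \<bar>\<eta>\<bar> \<le> 1 \<Longrightarrow> \<bar>xi_deriv j g (\<xi>, \<eta>)\<bar> \<le> C ^ (j + 1) * (fact j) ^ s"
proof -
  let ?K = "cbox (-1, -1) (1, 1) :: (real \<times> real) set"
  have "\<forall>K. compact K \<and> K \<subseteq> UNIV \<longrightarrow> (\<exists>C>0. \<forall>vs\<in>lists Basis. \<forall>p\<in>K.
          norm (iter_partial vs g p) \<le> C ^ (length vs + 1) * multi_fact vs powr \<sigma>)"
    using assms(1) unfolding gevrey_def mem_Collect_eq by (rule conjunct2)
  from this[rule_format, OF conjI[OF compact_cbox subset_UNIV], of "(-1, -1)" "(1, 1)"]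
  obtain C where C: "C > 0" "\<forall>vs\<in>lists Basis. \<forall>p\<in>?K.
      norm (iter_partial vs g p) \<le> C ^ (length vs + 1) * multi_fact vs powr \<sigma>" by (elim exE conjE)
  have mf: "multi_fact (replicate j (1, 0) :: (real \<times> real) list) = fact j" for j
  proof -
    have B: "(Basis :: (real \<times> real) set) = {(1, 0), (0, 1)}" by (auto simp: Basis_prod_def)
    have "count_list (replicate j (1 :: real, 0 :: real)) (1, 0) = j" for j
      by (induction j) auto
    moreover have "count_list (replicate j (1 :: real, 0 :: real)) (0, 1) = 0" for j
      by (induction j) auto
    ultimately show ?thesis by (simp add: multi_fact_def B)
  qed
  show ?thesis
  proof (rule that[of "max 1 C"])
    fix j :: nat and \<xi> \<eta> :: real assume "\<bar>\<xi>\<bar> \<le> 1" "\<bar>\<eta>\<bar> \<le> 1"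
    hence "(\<xi>, \<eta>) \<in> ?K" by (auto simp: cbox_Pair_eq abs_le_iff)
    hence "\<bar>xi_deriv j g (\<xi>, \<eta>)\<bar> \<le> C ^ (j + 1) * fact j powr \<sigma>"
      using C(2)[rule_format, of "replicate j (1, 0)" "(\<xi>, \<eta>)"] replicate_Basis2[of j]
      by (simp add: mf lists_eq_set)
    also have "\<dots> \<le> max 1 C ^ (j + 1) * fact j powr (real s)"
      using C(1) s by (intro mult_mono power_mono powr_mono) auto
    finally show "\<bar>xi_deriv j g (\<xi>, \<eta>)\<bar> \<le> max 1 C ^ (j + 1) * (fact j) ^ s"
      by (simp add: powr_realpow)
  qed simp
qed

text \<open>
  The \<open>\<xi>\<close>-derivatives of \<open>\<integral>\<^sub>\<gamma>\<^sup>\<eta> a(\<xi>, t) dt\<close>, written over the fixed interval \<open>[0, 1]\<close> so that they are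
  smooth in all of \<open>\<eta>\<close>.  Starting the primitive at \<open>\<gamma>\<close> makes it vanish on the line \<open>\<eta> = \<gamma>\<close>.
\<close>

definition gauge_jet :: "(real \<times> real \<Rightarrow> real) \<Rightarrow> real \<Rightarrow> nat \<Rightarrow> real \<Rightarrow> real \<Rightarrow> real" where
  "gauge_jet a \<gamma> j \<xi> \<eta> = (\<eta> - \<gamma>) * integral {0..1} (\<lambda>t. xi_deriv j a (\<xi>, \<gamma> + t * (\<eta> - \<gamma>)))"

lemma gauge_jet_at [simp]: "gauge_jet a \<gamma> j \<xi> \<gamma> = 0"
  by (simp add: gauge_jet_def)

lemma continuous_on_gauge_jet [continuous_intros]:
  assumes "smooth_on UNIV a" "continuous_on S u" "continuous_on S v"
  shows "continuous_on S (\<lambda>p. gauge_jet a \<gamma> j (u p) (v p))"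
proof -
  have "continuous_on S (\<lambda>p. integral (cbox 0 1) (\<lambda>t. xi_deriv j a (u p, \<gamma> + t * (v p - \<gamma>))))"
    by (rule integral_continuous_on_param)
       (auto simp: split_def intro!: continuous_intros assms(1)
          continuous_on_compose2[OF assms(2)] continuous_on_compose2[OF assms(3)])
  thus ?thesis unfolding gauge_jet_def using assms(3) by (auto intro!: continuous_intros)
qed

lemma gauge_jet_deriv:
  assumes "smooth_on UNIV a"
  shows "((\<lambda>\<xi>. gauge_jet a \<gamma> j \<xi> \<eta>) has_real_derivative gauge_jet a \<gamma> (Suc j) \<xi> \<eta>) (at \<xi> within S)"
proof -
  have "((\<lambda>\<xi>. integral (cbox 0 1) (\<lambda>t. xi_deriv j a (\<xi>, \<gamma> + t * (\<eta> - \<gamma>)))) has_field_derivative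
      integral (cbox 0 1) (\<lambda>t. xi_deriv (Suc j) a (\<xi>, \<gamma> + t * (\<eta> - \<gamma>)))) (at \<xi> within UNIV)"
  proof (rule leibniz_rule_field_derivative)
    show "(\<lambda>t. xi_deriv j a (x, \<gamma> + t * (\<eta> - \<gamma>))) integrable_on cbox 0 1" for x
      by (intro integrable_continuous continuous_intros assms)
    show "continuous_on (UNIV \<times> cbox 0 1) (\<lambda>(x, t). xi_deriv (Suc j) a (x, \<gamma> + t * (\<eta> - \<gamma>)))"
      unfolding split_def by (intro continuous_intros assms)
  qed (use has_derivative_xi_deriv[OF assms] in auto)
  hence "((\<lambda>\<xi>. integral {0..1} (\<lambda>t. xi_deriv j a (\<xi>, \<gamma> + t * (\<eta> - \<gamma>)))) has_field_derivative
      integral {0..1} (\<lambda>t. xi_deriv (Suc j) a (\<xi>, \<gamma> + t * (\<eta> - \<gamma>)))) (at \<xi> within S)"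
    by (auto intro: DERIV_subset)
  from DERIV_cmult[OF this, of "\<eta> - \<gamma>"] show ?thesis by (simp add: gauge_jet_def)
qed

text \<open>
  Along the lines through a fixed point, the \<open>\<eta>\<close>-derivative of the primitive contributes \<open>-x a\<close>,
  which cancels the term \<open>x a\<close> in the equation of the weight.  The identity
  \<open>\<integral>\<^sub>0\<^sup>1 (a + t (\<eta> - \<gamma>) \<partial>\<^sub>\<eta>a) dt = a(\<xi>, \<eta>)\<close>, with \<open>a\<close> taken at \<open>\<gamma> + t (\<eta> - \<gamma>)\<close>, is the fundamental
  theorem of calculus for \<open>t a\<close>.
\<close>

lemma gauge_jet_characteristic:
  assumes a: "smooth_on UNIV a"
  shows "((\<lambda>\<xi>. gauge_jet a \<gamma> 0 \<xi> (y - \<xi> * x)) has_real_derivative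
     gauge_jet a \<gamma> (Suc 0) \<xi> (y - \<xi> * x) - x * a (\<xi>, y - \<xi> * x)) (at \<xi>)"
proof -
  define \<eta> where "\<eta> \<xi> = y - \<xi> * x - \<gamma>" for \<xi>
  define a2 where "a2 = iter_partial [(0, 1)] a"
  have B: "(0, 1) \<in> (Basis :: (real \<times> real) set)" by (auto simp: Basis_prod_def)
  have a2c: "continuous_on S a2" for S unfolding a2_def by (rule smooth_on_continuous[OF a]) (use B in auto)
  have c0: "continuous_on S (\<lambda>p. a (u p))" if "continuous_on S u" for S u
    using continuous_on_xi_deriv[OF a that, of 0] by simp
  have c2: "continuous_on S (\<lambda>p. a2 (u p))" if "continuous_on S u" for S u
    by (rule continuous_on_compose2[OF a2c that]) auto
  have d: "((\<lambda>t. a (u t, w t)) has_real_derivative u' * xi_deriv 1 a (u t, w t) + w' * a2 (u t, w t)) (at t within S)"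
    if "(u has_real_derivative u') (at t within S)" "(w has_real_derivative w') (at t within S)" for u u' w w' t S
    using smooth_on_partials2[OF a, of "[]", OF _ that] by (simp add: a2_def)
  define F' where "F' \<xi> t = - x * a (\<xi>, \<gamma> + t * \<eta> \<xi>) + \<eta> \<xi> * (xi_deriv 1 a (\<xi>, \<gamma> + t * \<eta> \<xi>) - t * x * a2 (\<xi>, \<gamma> + t * \<eta> \<xi>))" for \<xi> t
  have \<eta>d: "(\<eta> has_real_derivative - x) (at \<xi> within S)" for \<xi> S
    unfolding \<eta>_def by (auto intro!: derivative_eq_intros)
  have \<eta>c: "continuous_on S \<eta>" for S unfolding \<eta>_def by (intro continuous_intros)
  have "((\<lambda>\<xi>. integral (cbox 0 1) (\<lambda>t. \<eta> \<xi> * a (\<xi>, \<gamma> + t * \<eta> \<xi>))) has_field_derivative integral (cbox 0 1) (F' \<xi>)) (at \<xi> within UNIV)"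
  proof (rule leibniz_rule_field_derivative)
    show "((\<lambda>\<xi>. \<eta> \<xi> * a (\<xi>, \<gamma> + t * \<eta> \<xi>)) has_field_derivative F' \<xi> t) (at \<xi> within UNIV)" for \<xi> t
      by (rule derivative_eq_intros \<eta>d d refl)+ (simp add: F'_def algebra_simps)
    show "(\<lambda>t. \<eta> \<xi> * a (\<xi>, \<gamma> + t * \<eta> \<xi>)) integrable_on cbox 0 1" for \<xi>
      by (intro integrable_continuous continuous_intros c0)
    show "continuous_on (UNIV \<times> cbox 0 1) (\<lambda>(x, t). F' x t)"
      unfolding F'_def split_def
      by (intro continuous_intros c0 c2 a continuous_on_compose2[OF \<eta>c]) auto
  qed auto
  moreover have "(\<lambda>\<xi>. integral (cbox 0 1) (\<lambda>t. \<eta> \<xi> * a (\<xi>, \<gamma> + t * \<eta> \<xi>))) = (\<lambda>\<xi>. gauge_jet a \<gamma> 0 \<xi> (y - \<xi> * x))"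
    by (auto simp: gauge_jet_def \<eta>_def)
  moreover have "integral (cbox 0 1) (F' \<xi>) = gauge_jet a \<gamma> (Suc 0) \<xi> (y - \<xi> * x) - x * a (\<xi>, y - \<xi> * x)"
  proof -
    have FTC: "((\<lambda>t. a (\<xi>, \<gamma> + t * \<eta> \<xi>) + t * (\<eta> \<xi> * a2 (\<xi>, \<gamma> + t * \<eta> \<xi>))) has_integral
        (1 * a (\<xi>, \<gamma> + 1 * \<eta> \<xi>) - 0 * a (\<xi>, \<gamma> + 0 * \<eta> \<xi>))) {0..1}"
    proof (rule fundamental_theorem_of_calculus)
      fix t :: real
      have "((\<lambda>t. t * a (\<xi>, \<gamma> + t * \<eta> \<xi>)) has_real_derivative
          a (\<xi>, \<gamma> + t * \<eta> \<xi>) + t * (\<eta> \<xi> * a2 (\<xi>, \<gamma> + t * \<eta> \<xi>))) (at t within {0..1})"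
        by (rule derivative_eq_intros d refl)+ simp
      thus "((\<lambda>t. t * a (\<xi>, \<gamma> + t * \<eta> \<xi>)) has_vector_derivative
          a (\<xi>, \<gamma> + t * \<eta> \<xi>) + t * (\<eta> \<xi> * a2 (\<xi>, \<gamma> + t * \<eta> \<xi>))) (at t within {0..1})"
        by (simp add: has_real_derivative_iff_has_vector_derivative)
    qed simp
    have i1: "(\<lambda>t. xi_deriv 1 a (\<xi>, \<gamma> + t * \<eta> \<xi>)) integrable_on {0..1}"
      by (intro integrable_continuous_interval continuous_intros a)
    have "F' \<xi> = (\<lambda>t. \<eta> \<xi> * xi_deriv 1 a (\<xi>, \<gamma> + t * \<eta> \<xi>) - x * (a (\<xi>, \<gamma> + t * \<eta> \<xi>) + t * (\<eta> \<xi> * a2 (\<xi>, \<gamma> + t * \<eta> \<xi>))))"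
      by (auto simp: F'_def algebra_simps)
    moreover have "(\<dots> has_integral \<eta> \<xi> * integral {0..1} (\<lambda>t. xi_deriv 1 a (\<xi>, \<gamma> + t * \<eta> \<xi>)) - x * a (\<xi>, \<gamma> + \<eta> \<xi>)) {0..1}"
      using FTC by (intro has_integral_diff has_integral_mult_right integrable_integral i1) simp
    ultimately have "integral {0..1} (F' \<xi>) = \<eta> \<xi> * integral {0..1} (\<lambda>t. xi_deriv 1 a (\<xi>, \<gamma> + t * \<eta> \<xi>)) - x * a (\<xi>, \<gamma> + \<eta> \<xi>)"
      by (simp add: integral_unique)
    thus ?thesis by (simp add: gauge_jet_def \<eta>_def)
  qed
  ultimately show ?thesis by simp
qed

lemma gauge_jet_bound:
  assumes a: "smooth_on UNIV a" and C: "\<And>\<xi> \<eta>. \<bar>\<xi>\<bar> \<le> 1 \<Longrightarrow> \<bar>\<eta>\<bar> \<le> 1 \<Longrightarrow> \<bar>xi_deriv j a (\<xi>, \<eta>)\<bar> \<le> B"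
    and *: "\<bar>\<xi>\<bar> \<le> 1" "\<bar>\<eta>\<bar> \<le> 1" "\<bar>\<gamma>\<bar> \<le> 1"
  shows "\<bar>gauge_jet a \<gamma> j \<xi> \<eta>\<bar> \<le> 2 * B"
proof -
  have "norm (integral {0..1} (\<lambda>t. xi_deriv j a (\<xi>, \<gamma> + t * (\<eta> - \<gamma>)))) \<le> B * (1 - 0)"
  proof (rule integral_bound)
    fix t :: real assume t: "t \<in> {0..1}"
    have "\<gamma> + t * (\<eta> - \<gamma>) = (1 - t) * \<gamma> + t * \<eta>" by (simp add: algebra_simps)
    also have "\<bar>\<dots>\<bar> \<le> \<bar>(1 - t) * \<gamma>\<bar> + \<bar>t * \<eta>\<bar>" by (rule abs_triangle_ineq)
    also have "\<dots> \<le> (1 - t) * 1 + t * 1"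
      unfolding abs_mult using t * by (intro add_mono mult_mono) auto
    finally have "\<bar>\<gamma> + t * (\<eta> - \<gamma>)\<bar> \<le> 1" by simp
    thus "norm (xi_deriv j a (\<xi>, \<gamma> + t * (\<eta> - \<gamma>))) \<le> B" using C *(1) by simp
  qed (auto intro!: continuous_intros a)
  moreover have "\<bar>\<eta> - \<gamma>\<bar> \<le> 2" using * by linarith
  moreover have "0 \<le> B" using C[of 0 0] by simp
  ultimately have "\<bar>\<eta> - \<gamma>\<bar> * \<bar>integral {0..1} (\<lambda>t. xi_deriv j a (\<xi>, \<gamma> + t * (\<eta> - \<gamma>)))\<bar> \<le> 2 * B"
    by (intro mult_mono) auto
  thus ?thesis by (simp add: gauge_jet_def abs_mult)
qed

text \<open>
  The gauge costs one derivative, \<open>(j + 1)!\<close> in place of \<open>j!\<close>, which a geometric factor absorbs.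
\<close>

lemma potential_jet_bound:
  fixes C u v :: real
  assumes C: "1 \<le> C" and a: "\<bar>u\<bar> \<le> 2 * (C ^ (j + 2) * (fact (Suc j)) ^ s)" and b: "\<bar>v\<bar> \<le> C ^ (j + 1) * (fact j) ^ s"
  shows "\<bar>v + u\<bar> \<le> (3 * C\<^sup>2 * 2 ^ s) * (3 * C\<^sup>2 * 2 ^ s) ^ j * (fact j) ^ s"
proof -
  have "real (Suc j) \<le> 2 ^ j" by (induction j) auto
  hence j: "real (Suc j) ^ s \<le> (2 ^ s) ^ j"
    using power_mono[of "real (Suc j)" "2 ^ j" s] by (simp add: power_mult[symmetric] mult.commute)
  have s1: "1 \<le> (2 ^ s :: real)" by simp
  have "\<bar>u\<bar> \<le> 2 * (C ^ (j + 2) * (fact (Suc j)) ^ s)" by (rule a)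
  also have "\<dots> = 2 * C ^ (j + 2) * (real (Suc j) ^ s * (fact j) ^ s)"
    by (simp only: fact_Suc of_nat_mult power_mult_distrib mult_ac)
  also have "\<dots> \<le> 2 * C ^ (j + 2) * ((2 ^ s) ^ j * (fact j) ^ s)"
    using C j by (intro mult_left_mono mult_right_mono) auto
  also have "\<dots> = 2 * C\<^sup>2 * ((C * 2 ^ s) ^ j * (fact j) ^ s)"
    by (simp add: power_add power_mult_distrib power2_eq_square)
  finally have u: "\<bar>u\<bar> \<le> 2 * C\<^sup>2 * ((C * 2 ^ s) ^ j * (fact j) ^ s)" .
  have "C ^ (j + 1) * (fact j) ^ s = C * (C ^ j * (fact j) ^ s)" by simp
  also have "\<dots> \<le> C\<^sup>2 * ((C * 2 ^ s) ^ j * (fact j) ^ s)"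
    using C s1 by (intro mult_mono power_mono) (auto simp: power2_eq_square)
  finally have v: "\<bar>v\<bar> \<le> C\<^sup>2 * ((C * 2 ^ s) ^ j * (fact j) ^ s)" using b by linarith
  have "\<bar>v + u\<bar> \<le> (3 * C\<^sup>2 * 1) * ((C * 2 ^ s) ^ j * (fact j) ^ s)" using u v by linarith
  also have "\<dots> \<le> (3 * C\<^sup>2 * 2 ^ s) * ((3 * C\<^sup>2 * 2 ^ s) ^ j * (fact j) ^ s)"
  proof (intro mult_mono mult_left_mono power_mono)
    have "1 * C \<le> (3 * C) * C" using C by (intro mult_right_mono) auto
    thus "C \<le> 3 * C\<^sup>2" by (simp add: power2_eq_square)
  qed (use C in auto)
  finally show ?thesis by (simp add: mult_ac)
qed

section \<open>Data norms, Hoelder bounds and the choice of the degree\<close>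

text \<open>
  Continuous partial derivatives are bounded on a compact set, so the operator norm of the derivative
  is, and convexity gives the mean value inequality.
\<close>

lemma smooth_imp_lipschitz:
  fixes g :: "'a::euclidean_space \<Rightarrow> real"
  assumes g: "smooth_on UNIV g" and K: "compact K" "convex K"
  obtains L where "0 \<le> L" "\<And>p q. p \<in> K \<Longrightarrow> q \<in> K \<Longrightarrow> \<bar>g p - g q\<bar> \<le> L * norm (p - q)"
proof -
  have dg: "(g has_derivative frechet_derivative g (at p)) (at p)" for p
    using smooth_onD[OF g, of "[]"] by simp
  have "\<forall>i\<in>Basis. \<exists>B. \<forall>p\<in>K. \<bar>partial_deriv i g p\<bar> \<le> B"
  proof
    fix i :: 'a assume "i \<in> Basis"
    hence "continuous_on K (partial_deriv i g)"
      using smooth_on_continuous[OF g, of "[i]" K] by simp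
    hence "bounded (partial_deriv i g ` K)"
      using K(1) by (intro compact_imp_bounded compact_continuous_image)
    thus "\<exists>B. \<forall>p\<in>K. \<bar>partial_deriv i g p\<bar> \<le> B" by (auto simp: bounded_iff)
  qed
  then obtain B where B: "\<And>i p. i \<in> Basis \<Longrightarrow> p \<in> K \<Longrightarrow> \<bar>partial_deriv i g p\<bar> \<le> B i"
    by metis
  define L where "L = (\<Sum>i\<in>Basis. \<bar>B i\<bar>)"
  have on: "onorm (frechet_derivative g (at p)) \<le> L" if "p \<in> K" for p
  proof (rule onorm_bound)
    show "0 \<le> L" by (simp add: L_def sum_nonneg)
    fix v :: 'a
    let ?D = "frechet_derivative g (at p)"
    have lin: "linear ?D" using has_derivative_linear[OF dg] .
    have "?D v = ?D (\<Sum>i\<in>Basis. (v \<bullet> i) *\<^sub>R i)" by (simp add: euclidean_representation)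
    also have "\<dots> = (\<Sum>i\<in>Basis. (v \<bullet> i) * partial_deriv i g p)"
      by (simp add: linear_sum[OF lin] linear_cmul[OF lin] partial_deriv_def)
    also have "norm \<dots> \<le> (\<Sum>i\<in>Basis. \<bar>B i\<bar> * norm v)"
    proof (rule sum_norm_le)
      fix i :: 'a assume i: "i \<in> Basis"
      have "\<bar>v \<bullet> i\<bar> * \<bar>partial_deriv i g p\<bar> \<le> norm v * \<bar>B i\<bar>"
        using B[OF i that] Basis_le_norm[OF i, of v] by (intro mult_mono) auto
      thus "norm ((v \<bullet> i) * partial_deriv i g p) \<le> \<bar>B i\<bar> * norm v" by (simp add: abs_mult mult.commute)
    qed
    finally show "norm (?D v) \<le> L * norm v" by (simp add: L_def sum_distrib_right)
  qed
  show thesis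
  proof (rule that[of L])
    show "0 \<le> L" by (simp add: L_def sum_nonneg)
    fix p q assume "p \<in> K" "q \<in> K"
    have "norm (g p - g q) \<le> L * norm (p - q)"
      by (rule differentiable_bound[OF K(2) has_derivative_at_withinI[OF dg] on \<open>p \<in> K\<close> \<open>q \<in> K\<close>])
    thus "\<bar>g p - g q\<bar> \<le> L * norm (p - q)" by simp
  qed
qed

lemma holder_seminormD:
  assumes "holder_seminorm \<alpha> f \<le> ennreal C" "0 < C"
  shows "norm (f p - f q) \<le> C * norm (p - q) powr \<alpha>"
proof (cases "p = q")
  case False
  have "ennreal (norm (f p - f q) / norm (p - q) powr \<alpha>) \<le> holder_seminorm \<alpha> f"
    unfolding holder_seminorm_def using False by (intro SUP_upper2[of "(p, q)"]) auto
  hence "ennreal (norm (f p - f q) / norm (p - q) powr \<alpha>) \<le> ennreal C" using assms(1) by (rule order_trans)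
  hence "norm (f p - f q) / norm (p - q) powr \<alpha> \<le> C" using assms by (simp add: ennreal_le_iff)
  thus ?thesis using False by (simp add: pos_divide_le_eq)
qed (use assms in simp)

lemma holder_imp_continuous:
  fixes f :: "'a::real_normed_vector \<Rightarrow> 'b::real_normed_vector"
  assumes H: "\<And>p q. norm (f p - f q) \<le> C * norm (p - q) powr \<alpha>" and \<alpha>: "0 < \<alpha>"
  shows "continuous_on UNIV f"
  unfolding continuous_on_def
proof
  fix p :: 'a
  have "((\<lambda>q. C * norm (q - p) powr \<alpha>) \<longlongrightarrow> C * norm (p - p) powr \<alpha>) (at p within UNIV)"
    using \<alpha> by (intro tendsto_intros) auto
  hence "((\<lambda>q. C * norm (q - p) powr \<alpha>) \<longlongrightarrow> 0) (at p within UNIV)" by simp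
  hence "((\<lambda>q. f q - f p) \<longlongrightarrow> 0) (at p within UNIV)"
    by (rule Lim_null_comparison[rotated]) (use H in auto)
  thus "(f \<longlongrightarrow> f p) (at p within UNIV)" by (simp add: Lim_null[symmetric])
qed

text \<open>
  The quadratic \<open>x\<^sup>2 - \<epsilon>x - \<gamma>\<close> has one root of each sign, so its positive root is at most \<open>1\<close> exactly
  when its value at \<open>1\<close> is nonnegative.
\<close>

lemma pos_root_le_1_iff:
  assumes "0 < \<epsilon>" "0 < \<gamma>"
  shows "pos_root \<epsilon> \<gamma> \<le> 1 \<longleftrightarrow> \<epsilon> + \<gamma> \<le> 1"
proof -
  define X where "X = (\<epsilon> + sqrt (\<epsilon>\<^sup>2 + 4 * \<gamma>)) / 2"
  have "0 \<le> \<epsilon>\<^sup>2 + 4 * \<gamma>" using assms by simp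
  hence X2: "X\<^sup>2 = \<epsilon> * X + \<gamma>" by (simp add: X_def power2_eq_square field_simps)
  have X0: "0 < X" unfolding X_def using assms by (simp add: add_pos_nonneg)
  have "pos_root \<epsilon> \<gamma> = X"
    unfolding pos_root_def
  proof (rule the_equality)
    fix x assume x: "0 < x \<and> x\<^sup>2 = \<epsilon> * x + \<gamma>"
    have "(x - X) * (x * X + \<gamma>) = X * (x\<^sup>2 - \<epsilon> * x - \<gamma>) - x * (X\<^sup>2 - \<epsilon> * X - \<gamma>)"
      by (simp add: power2_eq_square algebra_simps)
    also have "\<dots> = 0" using x X2 by simp
    finally have "(x - X) * (x * X + \<gamma>) = 0" .
    moreover have "0 < x * X + \<gamma>" using x X0 assms by (intro add_pos_pos mult_pos_pos) auto
    ultimately show "x = X" by simp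
  qed (use X0 X2 in simp)
  moreover have "X \<le> 1 \<longleftrightarrow> \<epsilon> + \<gamma> \<le> 1"
  proof
    assume "X \<le> 1"
    have "(1 - X) * (X + \<gamma>) = X * (1 - \<epsilon> - \<gamma>) - (X\<^sup>2 - \<epsilon> * X - \<gamma>)"
      by (simp add: power2_eq_square algebra_simps)
    hence "(1 - X) * (X + \<gamma>) = X * (1 - \<epsilon> - \<gamma>)" using X2 by simp
    moreover have "0 \<le> (1 - X) * (X + \<gamma>)" using \<open>X \<le> 1\<close> X0 assms by (intro mult_nonneg_nonneg) auto
    ultimately show "\<epsilon> + \<gamma> \<le> 1" using X0 by (simp add: zero_le_mult_iff)
  next
    assume "\<epsilon> + \<gamma> \<le> 1"
    have "(1 - X) * (X + \<gamma>) = X * (1 - \<epsilon> - \<gamma>) - (X\<^sup>2 - \<epsilon> * X - \<gamma>)"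
      by (simp add: power2_eq_square algebra_simps)
    hence "(1 - X) * (X + \<gamma>) = X * (1 - \<epsilon> - \<gamma>)" using X2 by simp
    moreover have "0 \<le> X * (1 - \<epsilon> - \<gamma>)" using X0 \<open>\<epsilon> + \<gamma> \<le> 1\<close> by simp
    ultimately have "0 \<le> (1 - X) * (X + \<gamma>)" by simp
    moreover have "0 < X + \<gamma>" using X0 assms by simp
    ultimately have "0 \<le> 1 - X" by (simp only: zero_le_mult_iff) linarith
    thus "X \<le> 1" by simp
  qed
  ultimately show ?thesis by simp
qed

lemma L2_norm_le:
  assumes c: "continuous_on {-1..1} h" and b: "\<And>x. x \<in> {-1..1} \<Longrightarrow> norm (h x) \<le> B"
  shows "L2_norm h \<le> 2 * B"
proof -
  have B: "0 \<le> B" using order_trans[OF norm_ge_zero b[of 0]] by simp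
  have c2: "continuous_on {-1..1} (\<lambda>x. (norm (h x))\<^sup>2)" by (intro continuous_intros c)
  have "(LINT x:{-1..1}|lborel. (norm (h x))\<^sup>2) = integral {-1..1} (\<lambda>x. (norm (h x))\<^sup>2)"
    using borel_integrable_atLeastAtMost'[OF c2] by (rule set_borel_integral_eq_integral)
  also have "\<dots> \<le> integral {-1..1} (\<lambda>x::real. B\<^sup>2)"
    by (intro integral_le integrable_continuous_interval c2 power_mono b) auto
  also have "\<dots> \<le> (2 * B)\<^sup>2" by (simp add: power2_eq_square)
  finally show ?thesis unfolding L2_norm_def using B by (intro real_le_lsqrt) auto
qed

lemma (in transported_weight) LINT_integrand:
  assumes "\<bar>\<xi>\<bar> \<le> r" "\<eta> \<le> \<gamma>"
  shows "(LINT x|lborel. integrand x \<xi> \<eta>) = line_integral \<xi> \<eta>"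
proof -
  have c: "continuous_on {-1..1} (\<lambda>x. integrand x \<xi> \<eta>)" by (intro continuous_intros)
  have "(LINT x|lborel. integrand x \<xi> \<eta>) = (LINT x:{-1..1}|lborel. integrand x \<xi> \<eta>)"
    unfolding set_lebesgue_integral_def
  proof (rule Bochner_Integration.integral_cong)
    fix x
    show "integrand x \<xi> \<eta> = indicat_real {-1..1} x *\<^sub>R integrand x \<xi> \<eta>"
      using integrand_eq_0_outside[OF assms, of x] by (auto simp: indicator_def)
  qed simp
  also have "\<dots> = line_integral \<xi> \<eta>"
    unfolding line_integral_def using borel_integrable_atLeastAtMost'[OF c] by (rule set_borel_integral_eq_integral)
  finally show ?thesis .
qed

lemma L1_slice_eq:
  assumes "continuous_on {-\<epsilon>..\<epsilon>} (\<lambda>\<xi>. g (\<xi>, \<eta>))"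
  shows "L1_slice \<epsilon> \<eta> g = ennreal (integral {-\<epsilon>..\<epsilon>} (\<lambda>\<xi>. norm (g (\<xi>, \<eta>))))"
  unfolding L1_slice_def
  by (rule nn_integral_has_integral_lebesgue')
     (auto intro!: integrable_integral integrable_continuous_interval continuous_intros assms)

text \<open>
  The open rectangle lies in \<open>data_rect\<close> and differs from the closed one by a null set.
\<close>

lemma L1_rect_ge:
  assumes c: "continuous_on (closed_rect \<epsilon> \<gamma>) g"
  shows "ennreal (integral {-\<gamma>..\<gamma>} (\<lambda>\<eta>. integral {-\<epsilon>..\<epsilon>} (\<lambda>\<xi>. norm (g (\<xi>, \<eta>))))) \<le> L1_rect \<epsilon> \<gamma> g"
proof -
  let ?Q = "cbox (-\<epsilon>, -\<gamma>) (\<epsilon>, \<gamma>)" and ?B = "box (-\<epsilon>, -\<gamma>) (\<epsilon>, \<gamma>)"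
  have Q: "closed_rect \<epsilon> \<gamma> = ?Q"
    by (auto simp: closed_rect_def cbox_Pair_eq abs_le_iff)
  have cn: "continuous_on ?Q (\<lambda>p. norm (g p))" using c unfolding Q by (intro continuous_intros)
  have "integral (cbox (-\<epsilon>) \<epsilon>) (\<lambda>\<xi>. integral (cbox (-\<gamma>) \<gamma>) (\<lambda>\<eta>. norm (g (\<xi>, \<eta>))))
      = integral (cbox (-\<gamma>) \<gamma>) (\<lambda>\<eta>. integral (cbox (-\<epsilon>) \<epsilon>) (\<lambda>\<xi>. norm (g (\<xi>, \<eta>))))"
    by (rule integral_swap_continuous) (use cn in \<open>simp add: split_def\<close>)
  hence I: "integral ?Q (\<lambda>p. norm (g p)) = integral {-\<gamma>..\<gamma>} (\<lambda>\<eta>. integral {-\<epsilon>..\<epsilon>} (\<lambda>\<xi>. norm (g (\<xi>, \<eta>))))"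
    using integral_prod_continuous[OF cn] by simp
  have "((\<lambda>p. norm (g p)) has_integral integral ?Q (\<lambda>p. norm (g p))) ?B"
    unfolding has_integral_open_interval by (intro integrable_integral integrable_continuous cn)
  hence "ennreal (integral ?Q (\<lambda>p. norm (g p))) = (\<integral>\<^sup>+p. ennreal (norm (g p)) * indicator ?B p \<partial>lborel)"
    by (intro nn_integral_has_integral_lebesgue'[symmetric]) auto
  also have "\<dots> \<le> L1_rect \<epsilon> \<gamma> g"
    unfolding L1_rect_def
    by (intro nn_integral_mono mult_left_mono)
       (auto simp: indicator_def data_rect_def mem_box Basis_prod_def inner_prod_def abs_le_iff abs_less_iff)
  finally show ?thesis unfolding I .
qed

text \<open>
  The choice \<open>n = \<lfloor>L / (P log L)\<rfloor>\<close> with \<open>L = log (1/\<tau>)\<close>: then \<open>n log n \<le> L / P\<close>, so that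
  \<open>n\<^sup>(\<^sup>p\<^sup>+\<^sup>3\<^sup>)\<^sup>n \<le> exp (L / 4)\<close> is beaten by \<open>\<tau> = exp (-L)\<close>, and \<open>n \<ge> L / (2 P log L)\<close>.  The threshold on
  \<open>\<tau>\<close> only ensures that \<open>n\<close> exceeds all constants, which is why \<open>n\<^sub>0\<close> may later depend on
  \<open>\<epsilon>\<close>, whereas the factor in the conclusion depends on \<open>p\<close> alone.
\<close>

lemma choose_degree:
  fixes K\<^sub>2 K\<^sub>3 :: real and p n\<^sub>0 :: nat
  shows "\<exists>\<delta>>0. \<forall>\<tau> \<alpha>. 0 < \<tau> \<and> \<tau> < \<delta> \<and> 0 < \<alpha> \<and> \<alpha> \<le> 1 \<longrightarrow> (\<exists>n\<ge>n\<^sub>0.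
     real n powr (-\<alpha>) \<le> 8 * (real p + 3) * log_modulus \<alpha> \<tau> \<and>
     (K\<^sub>2 * real n ^ p) ^ n * (K\<^sub>3 * \<tau>) \<le> real n powr (-\<alpha>))"
proof -
  define P where "P = 4 * (real p + 3)"
  have P: "0 < P" by (simp add: P_def)
  define B where "B = 2 + real n\<^sub>0 + \<bar>K\<^sub>2\<bar> + \<bar>K\<^sub>3\<bar>"
  have B: "1 \<le> B" "real n\<^sub>0 \<le> B - 1" "\<bar>K\<^sub>2\<bar> \<le> B - 1" "\<bar>K\<^sub>3\<bar> \<le> B - 1" by (auto simp: B_def)
  \<comment> \<open>from here on \<open>L / (P ln L) \<ge> \<surd>L / (2 P) \<ge> B\<close>, by \<open>ln L \<le> 2 \<surd>L\<close>\<close>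
  define L0 where "L0 = max (exp 1) ((2 * P * B)\<^sup>2)"
  have L0: "B \<le> L / (P * ln L) \<and> 1 \<le> ln L \<and> 1 \<le> L" if L: "L0 \<le> L" for L
  proof -
    have e: "exp 1 \<le> L" using L by (simp add: L0_def)
    have "(1::real) \<le> exp 1" by simp
    hence L1: "1 \<le> L" using e by linarith
    have l1: "1 \<le> ln L" using e L1 by (simp add: ln_ge_iff)
    have "2 * P * B \<le> sqrt L" using L P B(1) by (intro real_le_rsqrt) (simp add: L0_def)
    have "ln L = 2 * ln (sqrt L)" using L1 by (simp add: ln_sqrt)
    also have "\<dots> \<le> 2 * sqrt L" using ln_less_self[of "sqrt L"] L1 by (simp add: less_imp_le)
    finally have "B * (P * ln L) \<le> B * (P * (2 * sqrt L))" using P B(1) by (intro mult_left_mono) auto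
    also have "\<dots> = (2 * P * B) * sqrt L" by simp
    also have "\<dots> \<le> sqrt L * sqrt L" using \<open>2 * P * B \<le> sqrt L\<close> L1 by (intro mult_right_mono) auto
    also have "\<dots> = L" using L1 by simp
    finally have "B \<le> L / (P * ln L)" using P l1 by (simp add: pos_le_divide_eq)
    thus ?thesis using l1 L1 by simp
  qed
  show ?thesis
  proof (intro exI[of _ "exp (- L0)"] conjI allI impI)
    fix \<tau> \<alpha> :: real assume H: "0 < \<tau> \<and> \<tau> < exp (- L0) \<and> 0 < \<alpha> \<and> \<alpha> \<le> 1"
    define L where "L = ln (inverse \<tau>)"
    have \<tau>: "\<tau> = exp (- L)" using H by (simp add: L_def ln_inverse)
    have "L0 \<le> L" using H by (simp add: \<tau>)
    from L0[OF this] have LB: "B \<le> L / (P * ln L)" and l1: "1 \<le> ln L" and L1: "1 \<le> L" by auto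
    define x where "x = L / (P * ln L)"
    define n where "n = nat \<lfloor>x\<rfloor>"
    have x1: "1 \<le> x" using LB B(1) by (simp add: x_def)
    have nx: "real n \<le> x" "x - 1 < real n" using x1 unfolding n_def by linarith+
    have "0 < real n" using nx x1 by linarith
    hence n1: "1 \<le> real n" by simp
    have nB: "B - 1 \<le> real n" using nx LB by (simp add: x_def)
    have nh: "x / 2 \<le> real n" using nx n1 by linarith
    have xL: "x \<le> L"
    proof -
      have "1 * 1 \<le> P * ln L" using l1 by (intro mult_mono) (auto simp: P_def)
      hence "L / (P * ln L) \<le> L / 1" using L1 by (intro divide_left_mono) auto
      thus ?thesis by (simp add: x_def)
    qed
    have nln: "real n * ln (real n) \<le> L / P"
    proof -
      have "ln (real n) \<le> ln L" using nx xL n1 by simp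
      hence "real n * ln (real n) \<le> x * ln L" using nx n1 by (intro mult_mono) auto
      also have "\<dots> = L / P" using l1 by (simp add: x_def)
      finally show ?thesis .
    qed
    show "\<exists>n\<ge>n\<^sub>0. real n powr (-\<alpha>) \<le> 8 * (real p + 3) * log_modulus \<alpha> \<tau> \<and>
       (K\<^sub>2 * real n ^ p) ^ n * (K\<^sub>3 * \<tau>) \<le> real n powr (-\<alpha>)"
    proof (intro exI[of _ n] conjI)
      show "n\<^sub>0 \<le> n" using B(2) nB by linarith
      have "real n powr (-\<alpha>) \<le> (x / 2) powr (-\<alpha>)"
        using nh x1 H by (intro powr_mono2') auto
      also have "\<dots> = (2 * P) powr \<alpha> * (ln L powr \<alpha> / L powr \<alpha>)"
        using P l1 L1 by (simp add: x_def powr_minus powr_divide powr_mult divide_simps)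
      also have "\<dots> \<le> (2 * P) * (ln L powr (2 * \<alpha>) / L powr \<alpha>)"
      proof (intro mult_mono divide_right_mono)
        have "(2 * P) powr \<alpha> \<le> (2 * P) powr 1" using H by (intro powr_mono) (auto simp: P_def)
        thus "(2 * P) powr \<alpha> \<le> 2 * P" using P by simp
        show "ln L powr \<alpha> \<le> ln L powr (2 * \<alpha>)" using l1 H by (intro powr_mono) auto
      qed (use P in auto)
      also have "\<dots> = 8 * (real p + 3) * log_modulus \<alpha> \<tau>"
        using H by (simp add: log_modulus_def P_def L_def)
      finally show "real n powr (-\<alpha>) \<le> 8 * (real p + 3) * log_modulus \<alpha> \<tau>" .
      have "(K\<^sub>2 * real n ^ p) ^ n * (K\<^sub>3 * \<tau>) \<le> \<bar>(K\<^sub>2 * real n ^ p) ^ n * (K\<^sub>3 * \<tau>)\<bar>" by (rule abs_ge_self)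
      also have "\<dots> = (\<bar>K\<^sub>2\<bar> * real n ^ p) ^ n * (\<bar>K\<^sub>3\<bar> * \<tau>)"
        using H by (simp add: abs_mult power_abs)
      also have "\<dots> \<le> (real n * real n ^ p) ^ n * (real n * \<tau>)"
        using B nB H by (intro mult_mono power_mono mult_right_mono mult_nonneg_nonneg) auto
      also have "\<dots> = real n ^ ((p + 1) * n + 1) * \<tau>"
        by (simp add: power_mult power_add power_mult_distrib)
      \<comment> \<open>two further powers of \<open>n\<close> are spent: one on \<open>K\<^sub>3\<close>, one to leave \<open>n\<^sup>-\<^sup>1\<close> behind\<close>
      also have "\<dots> \<le> real n ^ ((p + 3) * n) * real n powr (-1) * \<tau>"
      proof -
        have "(p + 1) * n + 2 \<le> (p + 3) * n" using n1 by (simp add: algebra_simps)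
        hence "real n ^ ((p + 1) * n + 1 + 1) \<le> real n ^ ((p + 3) * n)" using n1 by (intro power_increasing) auto
        hence "real n ^ ((p + 1) * n + 1) \<le> real n ^ ((p + 3) * n) * real n powr (-1)"
          using n1 by (simp add: powr_minus field_simps)
        thus ?thesis using H by (intro mult_right_mono) auto
      qed
      also have "\<dots> = (real n ^ ((p + 3) * n) * \<tau>) * real n powr (-1)" by simp
      also have "\<dots> \<le> 1 * real n powr (-\<alpha>)"
      proof (intro mult_mono powr_mono)
        have "real n ^ ((p + 3) * n) = exp ((real p + 3) * (real n * ln (real n)))"
          using n1 by (simp add: powr_realpow[symmetric] powr_def mult.assoc)
        also have "\<dots> \<le> exp ((real p + 3) * (L / P))"
          unfolding exp_le_cancel_iff by (intro mult_left_mono nln) simp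
        also have "(real p + 3) * (L / P) = L / 4" by (simp add: P_def field_simps)
        finally have "real n ^ ((p + 3) * n) * \<tau> \<le> exp (L / 4) * exp (- L)"
          unfolding \<tau> by (intro mult_right_mono) auto
        also have "\<dots> \<le> 1" using L1 by (simp add: exp_add[symmetric])
        finally show "real n ^ ((p + 3) * n) * \<tau> \<le> 1" .
      qed (use H n1 in auto)
      finally show "(K\<^sub>2 * real n ^ p) ^ n * (K\<^sub>3 * \<tau>) \<le> real n powr (-\<alpha>)" by simp
    qed
  qed simp
qed

section \<open>The stability estimate\<close>

definition gauged_weight ::
  "(real \<times> real \<times> real \<Rightarrow> real) \<Rightarrow> (real \<times> real \<Rightarrow> real) \<Rightarrow> real \<Rightarrow> real \<Rightarrow> real \<Rightarrow> real \<Rightarrow> real" where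
  "gauged_weight m a \<gamma> x \<xi> \<eta> = m (x, \<xi>, \<eta>) * exp (gauge_jet a \<gamma> 0 \<xi> \<eta>)"

text \<open>
  The \<open>\<xi>\<close>-derivatives of the potential \<open>c = b + \<partial>\<^sub>\<xi> \<integral>\<^sub>\<gamma>\<^sup>\<eta> a\<close> that the gauged weight satisfies.
\<close>

definition potential_jet ::
  "(real \<times> real \<Rightarrow> real) \<Rightarrow> (real \<times> real \<Rightarrow> real) \<Rightarrow> real \<Rightarrow> nat \<Rightarrow> real \<Rightarrow> real \<Rightarrow> real" where
  "potential_jet a b \<gamma> j \<xi> \<eta> = xi_deriv j b (\<xi>, \<eta>) + gauge_jet a \<gamma> (Suc j) \<xi> \<eta>"

lemma transported_weight_gauged:
  assumes m: "smooth_on UNIV m" and a: "smooth_on UNIV a" and b: "smooth_on UNIV b"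
    and pde: "\<And>x \<xi> \<eta>. partial_deriv (0, 1, 0) m (x, \<xi>, \<eta>) - x * partial_deriv (0, 0, 1) m (x, \<xi>, \<eta>)
           = (x * a (\<xi>, \<eta>) + b (\<xi>, \<eta>)) * m (x, \<xi>, \<eta>)"
    and f: "continuous_on UNIV f" "\<And>x y. y < x\<^sup>2 \<Longrightarrow> f (x, y) = 0"
    and r: "0 < r" "r\<^sup>2 / 4 \<le> \<gamma>" "r + \<gamma> \<le> 1"
  shows "transported_weight f (gauged_weight m a \<gamma>) (potential_jet a b \<gamma> 0) r \<gamma>"
proof
  have mc: "continuous_on UNIV m" using smooth_on_continuous[OF m, of "[]"] by simp
  have "continuous_on UNIV (\<lambda>p. gauged_weight m a \<gamma> (fst p) (fst (snd p)) (snd (snd p)))"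
    unfolding gauged_weight_def by (intro continuous_intros a continuous_on_compose2[OF mc]) auto
  thus "continuous_on UNIV (\<lambda>(x, \<xi>, \<eta>). gauged_weight m a \<gamma> x \<xi> \<eta>)" by (simp add: split_def)
  have "continuous_on UNIV (\<lambda>p. potential_jet a b \<gamma> 0 (fst p) (snd p))"
    unfolding potential_jet_def by (intro continuous_intros a b) 
  thus "continuous_on UNIV (\<lambda>(\<xi>, \<eta>). potential_jet a b \<gamma> 0 \<xi> \<eta>)" by (simp add: split_def)
  fix x \<xi> y :: real
  let ?\<eta> = "y - \<xi> * x"
  have "((\<lambda>\<xi>. gauged_weight m a \<gamma> x \<xi> (y - \<xi> * x)) has_real_derivative
     (x * a (\<xi>, ?\<eta>) + b (\<xi>, ?\<eta>)) * m (x, \<xi>, ?\<eta>) * exp (gauge_jet a \<gamma> 0 \<xi> ?\<eta>)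
     + m (x, \<xi>, ?\<eta>) * (exp (gauge_jet a \<gamma> 0 \<xi> ?\<eta>) * (gauge_jet a \<gamma> (Suc 0) \<xi> ?\<eta> - x * a (\<xi>, ?\<eta>)))) (at \<xi>)"
    unfolding gauged_weight_def
    by (rule derivative_eq_intros smooth_on_partials3[OF m] gauge_jet_characteristic[OF a] refl)+
       (simp add: pde algebra_simps)
  thus "((\<lambda>\<xi>. gauged_weight m a \<gamma> x \<xi> (y - \<xi> * x)) has_real_derivative
     potential_jet a b \<gamma> 0 \<xi> ?\<eta> * gauged_weight m a \<gamma> x \<xi> ?\<eta>) (at \<xi>)"
    by (simp add: potential_jet_def gauged_weight_def algebra_simps)
qed (use f r in auto)

text \<open>
  The gauge factor does not depend on \<open>x\<close>, so it comes out of the integral.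
\<close>

lemma weighted_radon_gauged:
  assumes "transported_weight f (gauged_weight m a \<gamma>) c r \<gamma>" and "\<bar>\<xi>\<bar> \<le> r" "\<eta> \<le> \<gamma>"
  shows "of_real (exp (gauge_jet a \<gamma> 0 \<xi> \<eta>)) * weighted_radon m f (\<xi>, \<eta>)
     = transported_weight.line_integral f (gauged_weight m a \<gamma>) \<xi> \<eta>"
proof -
  interpret transported_weight f "gauged_weight m a \<gamma>" c r \<gamma> by fact
  have "line_integral \<xi> \<eta> = (LINT x|lborel. of_real (exp (gauge_jet a \<gamma> 0 \<xi> \<eta>)) * (f (x, \<xi> * x + \<eta>) * of_real (m (x, \<xi>, \<eta>))))"
    unfolding LINT_integrand[OF assms(2,3), symmetric]
    by (rule arg_cong[of _ _ "integral\<^sup>L lborel"]) (auto simp: integrand_def gauged_weight_def)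
  thus ?thesis by (simp add: weighted_radon_def)
qed

lemma continuous_on_weighted_radon:
  assumes w: "transported_weight f (gauged_weight m a \<gamma>) c r \<gamma>" and a: "smooth_on UNIV a"
  shows "continuous_on (closed_rect r \<gamma>) (weighted_radon m f)"
proof -
  interpret transported_weight f "gauged_weight m a \<gamma>" c r \<gamma> by fact
  have "continuous_on (closed_rect r \<gamma>) (\<lambda>p. of_real (exp (- gauge_jet a \<gamma> 0 (fst p) (snd p))) * line_integral (fst p) (snd p))"
    by (intro continuous_intros a)
  thus ?thesis
  proof (rule continuous_on_eq)
    fix p assume "p \<in> closed_rect r \<gamma>"
    hence "\<bar>fst p\<bar> \<le> r" "snd p \<le> \<gamma>" by (auto simp: closed_rect_def)
    from weighted_radon_gauged[OF w this, symmetric]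
    show "of_real (exp (- gauge_jet a \<gamma> 0 (fst p) (snd p))) * line_integral (fst p) (snd p) = weighted_radon m f p"
      by (simp add: mult.assoc[symmetric] of_real_mult[symmetric] exp_minus del: of_real_mult)
  qed
qed

text \<open>
  The values of \<open>f\<close> themselves are bounded by comparison with its zeros below the parabola, at \<open>(y, -1)\<close>.
\<close>

lemma weighted_holder_bound:
  fixes f :: "real \<times> real \<Rightarrow> complex" and m :: "real \<times> real \<times> real \<Rightarrow> real"
  assumes H: "\<And>p q. norm (f p - f q) \<le> C\<^sub>0 * norm (p - q) powr \<alpha>" and C0: "0 \<le> C\<^sub>0" and \<alpha>: "0 < \<alpha>" "\<alpha> \<le> 1"
    and supp: "\<And>x y. y < x\<^sup>2 \<Longrightarrow> f (x, y) = 0"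
    and m: "\<And>p. p \<in> cbox (-3, -1, 0) (3, 1, 1) \<Longrightarrow> \<bar>m p\<bar> \<le> M\<^sub>0"
      "\<And>p q. p \<in> cbox (-3, -1, 0) (3, 1, 1) \<Longrightarrow> q \<in> cbox (-3, -1, 0) (3, 1, 1) \<Longrightarrow> \<bar>m p - m q\<bar> \<le> L * norm (p - q)"
    and L: "0 \<le> L" and *: "\<bar>x\<bar> \<le> 1" "y \<in> {x - 2..x + 2}" "\<bar>\<xi>\<bar> \<le> 1" "0 \<le> \<gamma>" "\<gamma> \<le> 1"
  shows "norm (f (x, \<gamma>) * of_real (m (x, 0, \<gamma>)) - f (y, \<xi> * y + \<gamma>) * of_real (m (y, \<xi>, \<gamma>)))
     \<le> C\<^sub>0 * (3 * M\<^sub>0 + 15 * L) * (\<bar>y - x\<bar> + \<bar>\<xi>\<bar>) powr \<alpha>"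
proof -
  define \<tau> where "\<tau> = \<bar>y - x\<bar> + \<bar>\<xi>\<bar>"
  have y: "\<bar>y\<bar> \<le> 3" using * by auto
  have \<tau>: "0 \<le> \<tau>" "\<tau> \<le> 3" using * by (auto simp: \<tau>_def)
  have box: "(x, 0 :: real, \<gamma>) \<in> cbox (-3, -1, 0) (3, 1, 1)" "(y, \<xi>, \<gamma>) \<in> cbox (-3, -1, 0) (3, 1, 1)"
    using * y by (auto simp: cbox_Pair_eq box_real abs_le_iff)
  have M0: "0 \<le> M\<^sub>0" using m(1)[OF box(1)] by simp
  have \<xi>y: "\<bar>\<xi> * y\<bar> \<le> 3 * \<bar>\<xi>\<bar>" unfolding abs_mult using mult_left_mono[OF y, of "\<bar>\<xi>\<bar>"] by (simp add: mult.commute)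
  have powr1: "t powr \<alpha> \<le> max 1 t" if "0 \<le> t" for t :: real
  proof (cases "t \<le> 1")
    case True thus ?thesis using powr_le1[of \<alpha> t] that \<alpha> by simp
  next
    case False thus ?thesis using powr_mono[of \<alpha> 1 t] \<alpha> by simp
  qed
  have fd: "norm (f (x, \<gamma>) - f (y, \<xi> * y + \<gamma>)) \<le> C\<^sub>0 * (3 * \<tau> powr \<alpha>)"
  proof -
    have "norm ((x, \<gamma>) - (y, \<xi> * y + \<gamma>)) \<le> \<bar>x - y\<bar> + \<bar>\<xi> * y\<bar>"
      using norm_Pair_le[of "x - y" "- (\<xi> * y)"] by simp
    also have "\<dots> \<le> 3 * \<bar>y - x\<bar> + 3 * \<bar>\<xi>\<bar>" by (intro add_mono \<xi>y) (subst abs_minus_commute, simp)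
    also have "\<dots> = 3 * \<tau>" by (simp add: \<tau>_def)
    finally have "norm ((x, \<gamma>) - (y, \<xi> * y + \<gamma>)) powr \<alpha> \<le> (3 * \<tau>) powr \<alpha>"
      using \<alpha> by (intro powr_mono2) auto
    also have "\<dots> = 3 powr \<alpha> * \<tau> powr \<alpha>" using \<tau> by (simp add: powr_mult)
    also have "\<dots> \<le> 3 * \<tau> powr \<alpha>" using powr1[of 3] by (intro mult_right_mono) auto
    finally show ?thesis using H[of "(x, \<gamma>)" "(y, \<xi> * y + \<gamma>)"] C0 by (meson mult_left_mono order_trans)
  qed
  have fb: "norm (f (y, \<xi> * y + \<gamma>)) \<le> C\<^sub>0 * 5"
  proof -
    have "norm (f (y, \<xi> * y + \<gamma>)) = norm (f (y, \<xi> * y + \<gamma>) - f (y, -1))"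
      using supp[of "-1" y] by (simp add: less_le_trans[of "-1" 0])
    also have "\<dots> \<le> C\<^sub>0 * norm ((y, \<xi> * y + \<gamma>) - (y, -1)) powr \<alpha>" by (rule H)
    also have "norm ((y, \<xi> * y + \<gamma>) - (y, -1)) = \<bar>\<xi> * y + \<gamma> + 1\<bar>" by (simp add: norm_Pair)
    also have "C\<^sub>0 * \<bar>\<xi> * y + \<gamma> + 1\<bar> powr \<alpha> \<le> C\<^sub>0 * 5"
    proof (rule mult_left_mono[OF _ C0])
      have "\<bar>\<xi> * y + \<gamma> + 1\<bar> \<le> 5" using \<xi>y * by linarith
      thus "\<bar>\<xi> * y + \<gamma> + 1\<bar> powr \<alpha> \<le> 5" using powr1[of "\<bar>\<xi> * y + \<gamma> + 1\<bar>"] by simp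
    qed
    finally show ?thesis .
  qed
  have md: "\<bar>m (x, 0, \<gamma>) - m (y, \<xi>, \<gamma>)\<bar> \<le> L * (3 * \<tau> powr \<alpha>)"
  proof -
    have "norm ((x, 0, \<gamma>) - (y, \<xi>, \<gamma>)) \<le> \<bar>x - y\<bar> + norm (- \<xi>, 0 :: real)"
      using norm_Pair_le[of "x - y" "(- \<xi>, 0 :: real)"] by simp
    hence "norm ((x, 0, \<gamma>) - (y, \<xi>, \<gamma>)) \<le> \<tau>" by (simp add: \<tau>_def norm_Pair abs_minus_commute)
    also have "\<tau> \<le> 3 * \<tau> powr \<alpha>"
    proof (cases "\<tau> \<le> 1")
      case True
      hence "\<tau> \<le> \<tau> powr \<alpha>" using powr_mono'[of \<alpha> 1 \<tau>] \<tau> \<alpha> by simp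
      thus ?thesis using \<tau> by simp
    next
      case False
      hence "1 \<le> \<tau> powr \<alpha>" using \<alpha> by (simp add: ge_one_powr_ge_zero)
      thus ?thesis using \<tau> by simp
    qed
    finally show ?thesis using m(2)[OF box] L by (meson mult_left_mono order_trans)
  qed
  have "norm (f (x, \<gamma>) * of_real (m (x, 0, \<gamma>)) - f (y, \<xi> * y + \<gamma>) * of_real (m (y, \<xi>, \<gamma>)))
      = norm ((f (x, \<gamma>) - f (y, \<xi> * y + \<gamma>)) * of_real (m (x, 0, \<gamma>))
         + f (y, \<xi> * y + \<gamma>) * of_real (m (x, 0, \<gamma>) - m (y, \<xi>, \<gamma>)))"
    by (simp add: algebra_simps)
  also have "\<dots> \<le> norm (f (x, \<gamma>) - f (y, \<xi> * y + \<gamma>)) * \<bar>m (x, 0, \<gamma>)\<bar>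
      + norm (f (y, \<xi> * y + \<gamma>)) * \<bar>m (x, 0, \<gamma>) - m (y, \<xi>, \<gamma>)\<bar>"
    by (rule order_trans[OF norm_triangle_ineq]) (simp add: norm_mult del: of_real_diff)
  also have "\<dots> \<le> C\<^sub>0 * (3 * \<tau> powr \<alpha>) * M\<^sub>0 + C\<^sub>0 * 5 * (L * (3 * \<tau> powr \<alpha>))"
    using C0 by (intro add_mono mult_mono fd fb md m(1) box) auto
  also have "\<dots> = C\<^sub>0 * (3 * M\<^sub>0 + 15 * L) * \<tau> powr \<alpha>" by (simp add: algebra_simps)
  finally show ?thesis by (simp add: \<tau>_def)
qed

text \<open>
  The estimate of \<open>pointwise_bound\<close> for the gauged weight and slopes up to \<open>r = 1/n\<close>, expressed in
  the original data.  Every constant on the right is independent of \<open>\<alpha>\<close>, \<open>\<epsilon>\<close>, \<open>\<gamma>\<close> and of \<open>f\<close>; the width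
  \<open>\<epsilon>\<close> of the data only enters through \<open>1/n \<le> \<epsilon>\<close>.
\<close>

lemma stability_estimate:
  fixes f :: "real \<times> real \<Rightarrow> complex" and m :: "real \<times> real \<times> real \<Rightarrow> real"
  assumes m: "smooth_on UNIV m" and a: "smooth_on UNIV a" and b: "smooth_on UNIV b"
    and pde: "\<And>x \<xi> \<eta>. partial_deriv (0, 1, 0) m (x, \<xi>, \<eta>) - x * partial_deriv (0, 0, 1) m (x, \<xi>, \<eta>)
           = (x * a (\<xi>, \<eta>) + b (\<xi>, \<eta>)) * m (x, \<xi>, \<eta>)"
    and C: "1 \<le> C" "1 \<le> s"
    and aC: "\<And>j \<xi> \<eta>. \<bar>\<xi>\<bar> \<le> 1 \<Longrightarrow> \<bar>\<eta>\<bar> \<le> 1 \<Longrightarrow> \<bar>xi_deriv j a (\<xi>, \<eta>)\<bar> \<le> C ^ (j + 1) * (fact j) ^ s"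
    and bC: "\<And>j \<xi> \<eta>. \<bar>\<xi>\<bar> \<le> 1 \<Longrightarrow> \<bar>\<eta>\<bar> \<le> 1 \<Longrightarrow> \<bar>xi_deriv j b (\<xi>, \<eta>)\<bar> \<le> C ^ (j + 1) * (fact j) ^ s"
    and mM: "\<And>p. p \<in> cbox (-3, -1, 0) (3, 1, 1) \<Longrightarrow> \<bar>m p\<bar> \<le> M\<^sub>0"
    and mL: "\<And>p q. p \<in> cbox (-3, -1, 0) (3, 1, 1) \<Longrightarrow> q \<in> cbox (-3, -1, 0) (3, 1, 1) \<Longrightarrow> \<bar>m p - m q\<bar> \<le> L * norm (p - q)"
    and L: "0 \<le> L"
    and H: "\<And>p q. norm (f p - f q) \<le> C\<^sub>0 * norm (p - q) powr \<alpha>" and C0: "0 \<le> C\<^sub>0" and \<alpha>: "0 < \<alpha>" "\<alpha> \<le> 1"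
    and supp: "\<And>x y. y < x\<^sup>2 \<Longrightarrow> f (x, y) = 0"
    and \<epsilon>: "0 < \<epsilon>" "\<epsilon>\<^sup>2 / 4 \<le> \<gamma>" "\<epsilon> + \<gamma> \<le> 1"
    and T1: "integral {-\<gamma>..\<gamma>} (\<lambda>\<eta>. integral {-\<epsilon>..\<epsilon>} (\<lambda>\<xi>. norm (weighted_radon m f (\<xi>, \<eta>)))) \<le> T"
    and T2: "integral {-\<epsilon>..\<epsilon>} (\<lambda>\<xi>. norm (weighted_radon m f (\<xi>, \<gamma>))) \<le> T"
    and n: "1 \<le> n" "1 / real n \<le> \<epsilon>" "2 * (3 * C\<^sup>2 * 2 ^ s) \<le> 16 * (real n)\<^sup>2" and x: "\<bar>x\<bar> \<le> 1"
  shows "norm (f (x, \<gamma>) * of_real (m (x, 0, \<gamma>))) \<le> 1026 * (C\<^sub>0 * (3 * M\<^sub>0 + 15 * L)) * real n powr (-\<alpha>)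
     + (1024 * 7 ^ 4 * 64 ^ 8 * 8 ^ (8 * s) * real n ^ (18 + 8 * s)) ^ n * (exp (2 * C) * T)"
proof -
  define r where "r = 1 / real n"
  have fc: "continuous_on UNIV f" by (rule holder_imp_continuous[OF H \<alpha>(1)])
  have r0: "0 < r" using n by (simp add: r_def)
  have re: "r \<le> \<epsilon>" using n by (simp add: r_def)
  have "r\<^sup>2 \<le> \<epsilon>\<^sup>2" using r0 re by (intro power_mono) auto
  hence r4: "r\<^sup>2 / 4 \<le> \<gamma>" "r + \<gamma> \<le> 1" using \<epsilon> re by auto
  have we: "transported_weight f (gauged_weight m a \<gamma>) (potential_jet a b \<gamma> 0) \<epsilon> \<gamma>"
    by (rule transported_weight_gauged[OF m a b pde fc supp \<epsilon>])
  have w: "transported_weight f (gauged_weight m a \<gamma>) (potential_jet a b \<gamma> 0) r \<gamma>"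
    by (rule transported_weight_gauged[OF m a b pde fc supp r0 r4])
  interpret transported_weight f "gauged_weight m a \<gamma>" "potential_jet a b \<gamma> 0" r \<gamma> by fact
  let ?g = "weighted_radon m f"
  have integrand: "integrand y \<xi> \<gamma> = f (y, \<xi> * y + \<gamma>) * of_real (m (y, \<xi>, \<gamma>))" for y \<xi>
    by (simp add: integrand_def gauged_weight_def)
  have line_integral: "norm (line_integral \<xi> \<eta>) \<le> exp (2 * C) * norm (?g (\<xi>, \<eta>))" if "\<bar>\<xi>\<bar> \<le> \<epsilon>" "\<bar>\<eta>\<bar> \<le> \<gamma>" for \<xi> \<eta>
  proof -
    have e: "line_integral \<xi> \<eta> = of_real (exp (gauge_jet a \<gamma> 0 \<xi> \<eta>)) * ?g (\<xi>, \<eta>)"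
      using weighted_radon_gauged[OF we that(1), of \<eta>] that(2) by simp
    have "\<bar>gauge_jet a \<gamma> 0 \<xi> \<eta>\<bar> \<le> 2 * (C ^ (0 + 1) * (fact 0) ^ s)"
      by (rule gauge_jet_bound[OF a aC]) (use that \<epsilon> \<gamma> in auto)
    hence "gauge_jet a \<gamma> 0 \<xi> \<eta> \<le> 2 * C" by simp
    thus ?thesis unfolding e by (simp add: norm_mult mult_right_mono)
  qed
  have gc: "continuous_on (closed_rect \<epsilon> \<gamma>) ?g" by (rule continuous_on_weighted_radon[OF we a])
  have gs: "continuous_on {-\<epsilon>..\<epsilon>} (\<lambda>\<xi>. norm (?g (\<xi>, \<eta>)))" if "\<eta> \<in> {-\<gamma>..\<gamma>}" for \<eta>
    by (rule continuous_on_norm, rule continuous_on_compose2[OF gc]) (use that in \<open>auto simp: closed_rect_def abs_le_iff intro!: continuous_intros\<close>)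
  have slice: "integral {-r..r} (\<lambda>\<xi>. norm (line_integral \<xi> \<eta>)) \<le> exp (2 * C) * integral {-\<epsilon>..\<epsilon>} (\<lambda>\<xi>. norm (?g (\<xi>, \<eta>)))"
    if \<eta>: "\<eta> \<in> {-\<gamma>..\<gamma>}" for \<eta>
  proof -
    have "integral {-r..r} (\<lambda>\<xi>. norm (line_integral \<xi> \<eta>)) \<le> integral {-\<epsilon>..\<epsilon>} (\<lambda>\<xi>. norm (line_integral \<xi> \<eta>))"
      using re by (intro integral_subset_le integrable_continuous_interval continuous_intros) auto
    also have "\<dots> \<le> integral {-\<epsilon>..\<epsilon>} (\<lambda>\<xi>. exp (2 * C) * norm (?g (\<xi>, \<eta>)))"
      using \<eta> by (intro integral_le integrable_continuous_interval continuous_intros gs line_integral) (auto simp: abs_le_iff)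
    finally show ?thesis by simp
  qed
  have gi: "continuous_on {-\<gamma>..\<gamma>} (\<lambda>\<eta>. integral {-\<epsilon>..\<epsilon>} (\<lambda>\<xi>. norm (?g (\<xi>, \<eta>))))"
    unfolding box_real(2)[symmetric]
    by (rule integral_continuous_on_param)
       (auto simp: split_def closed_rect_def abs_le_iff intro!: continuous_intros continuous_on_compose2[OF gc])
  have Ui: "continuous_on {-\<gamma>..\<gamma>} (\<lambda>\<eta>. integral {-r..r} (\<lambda>\<xi>. norm (line_integral \<xi> \<eta>)))"
    unfolding box_real(2)[symmetric]
    by (rule integral_continuous_on_param) (auto simp: split_def intro!: continuous_intros)
  have D1: "integral {-\<gamma>..\<gamma>} (\<lambda>\<eta>. integral {-r..r} (\<lambda>\<xi>. norm (line_integral \<xi> \<eta>))) \<le> exp (2 * C) * T"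
  proof -
    have "integral {-\<gamma>..\<gamma>} (\<lambda>\<eta>. integral {-r..r} (\<lambda>\<xi>. norm (line_integral \<xi> \<eta>)))
        \<le> integral {-\<gamma>..\<gamma>} (\<lambda>\<eta>. exp (2 * C) * integral {-\<epsilon>..\<epsilon>} (\<lambda>\<xi>. norm (?g (\<xi>, \<eta>))))"
      by (intro integral_le integrable_continuous_interval continuous_intros gi Ui slice)
    also have "\<dots> = exp (2 * C) * integral {-\<gamma>..\<gamma>} (\<lambda>\<eta>. integral {-\<epsilon>..\<epsilon>} (\<lambda>\<xi>. norm (?g (\<xi>, \<eta>))))" by simp
    also have "\<dots> \<le> exp (2 * C) * T" using T1 by (intro mult_left_mono) auto
    finally show ?thesis .
  qed
  have D2: "integral {-r..r} (\<lambda>\<xi>. norm (line_integral \<xi> \<gamma>)) \<le> exp (2 * C) * T"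
    by (rule order_trans[OF slice mult_left_mono[OF T2]]) (use \<gamma> in auto)
  have "norm (integrand x 0 \<gamma>) \<le> 1026 * (C\<^sub>0 * (3 * M\<^sub>0 + 15 * L)) * real n powr (-\<alpha>)
     + (1024 * 7 ^ 4 * 64 ^ 8 * 8 ^ (8 * s) * real n ^ (18 + 8 * s)) ^ n * (exp (2 * C) * T)"
  proof (rule pointwise_bound[where cj = "potential_jet a b \<gamma>" and A = "3 * C\<^sup>2 * 2 ^ s"])
    show "jet_on {-r..r} (\<lambda>j \<xi>. potential_jet a b \<gamma> j \<xi> \<eta>)" for \<eta>
      unfolding jet_on_def potential_jet_def
      by (intro allI ballI DERIV_add has_derivative_xi_deriv gauge_jet_deriv a b)
    show "\<bar>potential_jet a b \<gamma> j \<xi> \<eta>\<bar> \<le> 3 * C\<^sup>2 * 2 ^ s * (3 * C\<^sup>2 * 2 ^ s) ^ j * fact j ^ s"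
      if "\<xi> \<in> {-r..r}" "\<eta> \<in> {-\<gamma>..\<gamma>}" for j \<xi> \<eta>
    proof -
      have *: "\<bar>\<xi>\<bar> \<le> 1" "\<bar>\<eta>\<bar> \<le> 1" "\<bar>\<gamma>\<bar> \<le> 1" using that \<gamma> by auto
      have "\<bar>gauge_jet a \<gamma> (Suc j) \<xi> \<eta>\<bar> \<le> 2 * (C ^ (Suc j + 1) * (fact (Suc j)) ^ s)"
        by (rule gauge_jet_bound[OF a aC *])
      thus ?thesis unfolding potential_jet_def
        using bC[OF *(1,2)] by (intro potential_jet_bound C) (auto simp del: fact_Suc)
    qed
    show "0 \<le> C\<^sub>0 * (3 * M\<^sub>0 + 15 * L)"
    proof -
      have "(0, 0, 0) \<in> cbox (-3, -1, 0) (3 :: real, 1 :: real, 1 :: real)" by (auto simp: cbox_Pair_eq box_real)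
      from mM[OF this] have "0 \<le> M\<^sub>0" by simp
      thus ?thesis using C0 L by simp
    qed
    show "norm (integrand x 0 \<gamma> - integrand y \<xi> \<gamma>) \<le> C\<^sub>0 * (3 * M\<^sub>0 + 15 * L) * (\<bar>y - x\<bar> + \<bar>\<xi>\<bar>) powr \<alpha>"
      if "y \<in> {x - 2..x + 2}" "\<xi> \<in> {-r..r}" for y \<xi>
      unfolding integrand using weighted_holder_bound[OF H C0 \<alpha> supp mM mL L x that(1), of \<xi> \<gamma>] that(2) \<gamma>
      by (auto simp: abs_le_iff)
  qed (use n C x \<alpha> D1 D2 in \<open>auto simp: r_def\<close>)
  thus ?thesis by (simp add: integrand)
qed

text \<open>
  With the pointwise estimate at hand, the square mean over \<open>[-1, 1]\<close> is bounded by twice the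
  supremum.  If the data vanish, the estimate holds with \<open>\<tau> = 0\<close> for all large \<open>n\<close>, and \<open>n \<rightarrow> \<infinity>\<close> gives
  that the function vanishes.  The Gevrey index \<open>\<sigma>\<close> is rounded up to an integer \<open>s\<close>.
\<close>

theorem theorem4p11:
  fixes \<sigma> :: real
    and m :: "real \<times> real \<times> real \<Rightarrow> real"
    and a b :: "real \<times> real \<Rightarrow> real"
    and N :: "real \<Rightarrow> real \<Rightarrow> (real \<times> real \<Rightarrow> complex) \<Rightarrow> ennreal"
  assumes "\<sigma> > 1"
    and "smooth_on UNIV m"
    and "\<And>p. m p \<ge> 0"
    and "a \<in> gevrey \<sigma> UNIV" and "b \<in> gevrey \<sigma> UNIV"
    and "\<And>x \<xi> \<eta>. partial_deriv (0, 1, 0) m (x, \<xi>, \<eta>) - x * partial_deriv (0, 0, 1) m (x, \<xi>, \<eta>)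
           = (x * a (\<xi>, \<eta>) + b (\<xi>, \<eta>)) * m (x, \<xi>, \<eta>)"
    and "data_norm_family N"
  shows "\<exists>\<gamma>\<^sub>0>0. \<forall>C\<^sub>0>0. \<exists>M>0. \<forall>\<alpha> \<epsilon> \<gamma>.
    0 < \<alpha> \<and> \<alpha> \<le> 1 \<and> 0 < \<epsilon> \<and> \<epsilon> < 1 \<and> 0 < \<gamma> \<and> \<gamma> < \<gamma>\<^sub>0 \<and> \<gamma> \<ge> \<epsilon>\<^sup>2 / 4 \<and> pos_root \<epsilon> \<gamma> \<le> 1 \<longrightarrow>
    (\<exists>\<delta>>0. \<forall>f :: real \<times> real \<Rightarrow> complex.
       holder_seminorm \<alpha> f \<le> ennreal C\<^sub>0 \<and>
       closure {p. f p \<noteq> 0} \<subseteq> {(x, y). y \<ge> x\<^sup>2} \<and>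
       N \<epsilon> \<gamma> (weighted_radon m f) < ennreal \<delta> \<longrightarrow>
       L2_norm (\<lambda>x. f (x, \<gamma>) * complex_of_real (m (x, 0, \<gamma>)))
         \<le> M * log_modulus \<alpha> (enn2real (N \<epsilon> \<gamma> (weighted_radon m f))))"
proof -
  define s where "s = nat \<lceil>\<sigma>\<rceil>"
  have s: "1 \<le> s" "\<sigma> \<le> real s" using assms(1) unfolding s_def by linarith+
  have a: "smooth_on UNIV a" and b: "smooth_on UNIV b" using assms(4,5) by (auto simp: gevrey_def)
  obtain Ca where Ca: "1 \<le> Ca" "\<And>j \<xi> \<eta>. \<bar>\<xi>\<bar> \<le> 1 \<Longrightarrow> \<bar>\<eta>\<bar> \<le> 1 \<Longrightarrow> \<bar>xi_deriv j a (\<xi>, \<eta>)\<bar> \<le> Ca ^ (j + 1) * (fact j) ^ s"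
    using gevrey_xi_deriv_bound[OF assms(4) s(2)] by blast
  obtain Cb where Cb: "1 \<le> Cb" "\<And>j \<xi> \<eta>. \<bar>\<xi>\<bar> \<le> 1 \<Longrightarrow> \<bar>\<eta>\<bar> \<le> 1 \<Longrightarrow> \<bar>xi_deriv j b (\<xi>, \<eta>)\<bar> \<le> Cb ^ (j + 1) * (fact j) ^ s"
    using gevrey_xi_deriv_bound[OF assms(5) s(2)] by blast
  define C where "C = max Ca Cb"
  have C: "1 \<le> C" using Ca by (simp add: C_def)
  have aC: "\<bar>xi_deriv j a (\<xi>, \<eta>)\<bar> \<le> C ^ (j + 1) * (fact j) ^ s" if "\<bar>\<xi>\<bar> \<le> 1" "\<bar>\<eta>\<bar> \<le> 1" for j \<xi> \<eta>
    by (rule order_trans[OF Ca(2)[OF that] mult_right_mono[OF power_mono]]) (use Ca in \<open>auto simp: C_def\<close>)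
  have bC: "\<bar>xi_deriv j b (\<xi>, \<eta>)\<bar> \<le> C ^ (j + 1) * (fact j) ^ s" if "\<bar>\<xi>\<bar> \<le> 1" "\<bar>\<eta>\<bar> \<le> 1" for j \<xi> \<eta>
    by (rule order_trans[OF Cb(2)[OF that] mult_right_mono[OF power_mono]]) (use Cb in \<open>auto simp: C_def\<close>)
  have mc: "continuous_on S m" for S using smooth_on_continuous[OF assms(2), of "[]"] by simp
  let ?K = "cbox (-3, -1, 0) (3, 1, 1) :: (real \<times> real \<times> real) set"
  have "bounded (m ` ?K)" by (intro compact_imp_bounded compact_continuous_image mc compact_cbox)
  then obtain M0 where M0: "\<And>p. p \<in> ?K \<Longrightarrow> \<bar>m p\<bar> \<le> M0" by (auto simp: bounded_iff)
  obtain L where L: "0 \<le> L" "\<And>p q. p \<in> ?K \<Longrightarrow> q \<in> ?K \<Longrightarrow> \<bar>m p - m q\<bar> \<le> L * norm (p - q)"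
    using smooth_imp_lipschitz[OF assms(2) compact_cbox convex_box(1)] by blast
  have "(0, 0, 0) \<in> ?K" by (auto simp: cbox_Pair_eq box_real)
  from M0[OF this] have M00: "0 \<le> M0" by simp
  obtain c where c: "0 < c" "\<And>\<epsilon> \<gamma> g. \<epsilon> \<in> {0<..<1} \<Longrightarrow> \<gamma> \<in> {0<..<1} \<Longrightarrow> continuous_on (closed_rect \<epsilon> \<gamma>) g \<Longrightarrow>
        ennreal c * max (L1_rect \<epsilon> \<gamma> g) (L1_slice \<epsilon> \<gamma> g) \<le> N \<epsilon> \<gamma> g"
    using assms(7) unfolding data_norm_family_def by blast
  define K2 :: real where "K2 = 1024 * 7 ^ 4 * 64 ^ 8 * 8 ^ (8 * s)"
  define p where "p = 18 + 8 * s"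
  define K1 where "K1 C\<^sub>0 = 1026 * (C\<^sub>0 * (3 * M0 + 15 * L))" for C\<^sub>0
  define M where "M C\<^sub>0 = 2 * ((K1 C\<^sub>0 + 1) * (8 * (real p + 3)))" for C\<^sub>0
  show ?thesis
  proof (rule exI[of _ 1], intro conjI allI impI)
    fix C\<^sub>0 :: real assume C0: "0 < C\<^sub>0"
    have K1: "0 \<le> K1 C\<^sub>0" using C0 M00 L by (simp add: K1_def)
    have M: "0 < M C\<^sub>0" using K1 by (simp add: M_def)
    show "\<exists>M>0. \<forall>\<alpha> \<epsilon> \<gamma>.
      0 < \<alpha> \<and> \<alpha> \<le> 1 \<and> 0 < \<epsilon> \<and> \<epsilon> < 1 \<and> 0 < \<gamma> \<and> \<gamma> < 1 \<and> \<gamma> \<ge> \<epsilon>\<^sup>2 / 4 \<and> pos_root \<epsilon> \<gamma> \<le> 1 \<longrightarrow>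
      (\<exists>\<delta>>0. \<forall>f :: real \<times> real \<Rightarrow> complex.
         holder_seminorm \<alpha> f \<le> ennreal C\<^sub>0 \<and>
         closure {p. f p \<noteq> 0} \<subseteq> {(x, y). y \<ge> x\<^sup>2} \<and>
         N \<epsilon> \<gamma> (weighted_radon m f) < ennreal \<delta> \<longrightarrow>
         L2_norm (\<lambda>x. f (x, \<gamma>) * complex_of_real (m (x, 0, \<gamma>)))
           \<le> M * log_modulus \<alpha> (enn2real (N \<epsilon> \<gamma> (weighted_radon m f))))"
    proof (rule exI[of _ "M C\<^sub>0"], intro conjI allI impI M)
      fix \<alpha> \<epsilon> \<gamma> :: real
      assume A: "0 < \<alpha> \<and> \<alpha> \<le> 1 \<and> 0 < \<epsilon> \<and> \<epsilon> < 1 \<and> 0 < \<gamma> \<and> \<gamma> < 1 \<and> \<gamma> \<ge> \<epsilon>\<^sup>2 / 4 \<and> pos_root \<epsilon> \<gamma> \<le> 1"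
      hence \<alpha>: "0 < \<alpha>" "\<alpha> \<le> 1" and \<epsilon>: "0 < \<epsilon>" "\<epsilon>\<^sup>2 / 4 \<le> \<gamma>" "\<epsilon> + \<gamma> \<le> 1"
        using pos_root_le_1_iff[of \<epsilon> \<gamma>] by auto
      have in01: "\<epsilon> \<in> {0<..<1}" "\<gamma> \<in> {0<..<1}" using A by auto
      \<comment> \<open>beyond \<open>n0\<close> the width \<open>1/n\<close> is at most \<open>\<epsilon>\<close> and the bump scale \<open>16n\<^sup>2\<close> dominates the potential\<close>
      define n0 where "n0 = nat \<lceil>max (1 / \<epsilon>) (6 * C\<^sup>2 * 2 ^ s)\<rceil> + 1"
      have n0: "1 \<le> n" "1 / real n \<le> \<epsilon>" "2 * (3 * C\<^sup>2 * 2 ^ s) \<le> 16 * (real n)\<^sup>2" if "n0 \<le> n" for n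
      proof -
        have "max (1 / \<epsilon>) (6 * C\<^sup>2 * 2 ^ s) \<le> real n" using that unfolding n0_def by linarith
        hence l: "1 / \<epsilon> \<le> real n" "6 * C\<^sup>2 * 2 ^ s \<le> real n" by auto
        show n1: "1 \<le> n" using that by (simp add: n0_def)
        show "1 / real n \<le> \<epsilon>" using l(1) \<epsilon>(1) n1 by (simp add: field_simps)
        have "1 * real n \<le> 16 * real n * real n" using n1 by (intro mult_right_mono) auto
        thus "2 * (3 * C\<^sup>2 * 2 ^ s) \<le> 16 * (real n)\<^sup>2" using l(2) by (simp add: power2_eq_square)
      qed
      obtain \<delta> where \<delta>: "0 < \<delta>" "\<And>\<tau>. 0 < \<tau> \<Longrightarrow> \<tau> < \<delta> \<Longrightarrow> \<exists>n\<ge>n0.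
          real n powr (-\<alpha>) \<le> 8 * (real p + 3) * log_modulus \<alpha> \<tau> \<and>
          (K2 * real n ^ p) ^ n * (exp (2 * C) / c * \<tau>) \<le> real n powr (-\<alpha>)"
        using choose_degree[of n0 p K2 "exp (2 * C) / c"] \<alpha> by blast
      show "\<exists>\<delta>>0. \<forall>f :: real \<times> real \<Rightarrow> complex.
         holder_seminorm \<alpha> f \<le> ennreal C\<^sub>0 \<and>
         closure {p. f p \<noteq> 0} \<subseteq> {(x, y). y \<ge> x\<^sup>2} \<and>
         N \<epsilon> \<gamma> (weighted_radon m f) < ennreal \<delta> \<longrightarrow>
         L2_norm (\<lambda>x. f (x, \<gamma>) * complex_of_real (m (x, 0, \<gamma>)))
           \<le> M C\<^sub>0 * log_modulus \<alpha> (enn2real (N \<epsilon> \<gamma> (weighted_radon m f)))"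
      proof (rule exI[of _ \<delta>], intro conjI allI impI \<delta>(1))
        fix f :: "real \<times> real \<Rightarrow> complex"
        assume F: "holder_seminorm \<alpha> f \<le> ennreal C\<^sub>0 \<and>
         closure {p. f p \<noteq> 0} \<subseteq> {(x, y). y \<ge> x\<^sup>2} \<and> N \<epsilon> \<gamma> (weighted_radon m f) < ennreal \<delta>"
        have H: "norm (f p - f q) \<le> C\<^sub>0 * norm (p - q) powr \<alpha>" for p q
          using holder_seminormD F C0 by blast
        have supp: "f (x, y) = 0" if "y < x\<^sup>2" for x y
        proof (rule ccontr)
          assume "f (x, y) \<noteq> 0"
          hence "(x, y) \<in> closure {p. f p \<noteq> 0}" using closure_subset by fastforce
          thus False using F that by auto
        qed
        let ?g = "weighted_radon m f"
        define \<tau> where "\<tau> = enn2real (N \<epsilon> \<gamma> ?g)"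
        have fin: "N \<epsilon> \<gamma> ?g = ennreal \<tau>"
        proof -
          have "N \<epsilon> \<gamma> ?g < top" using F by (auto intro: less_trans[OF _ ennreal_less_top])
          thus ?thesis by (simp add: \<tau>_def)
        qed
        have \<tau>0: "0 \<le> \<tau>" by (simp add: \<tau>_def)
        have \<tau>d: "\<tau> < \<delta>" using F \<delta>(1) \<tau>0 by (simp add: fin ennreal_less_iff)
        have fc: "continuous_on UNIV f" by (rule holder_imp_continuous[OF H \<alpha>(1)])
        have gc: "continuous_on (closed_rect \<epsilon> \<gamma>) ?g"
          by (rule continuous_on_weighted_radon[OF transported_weight_gauged[OF assms(2) a b assms(6) fc supp \<epsilon>] a])
        have lower: "ennreal c * max (L1_rect \<epsilon> \<gamma> ?g) (L1_slice \<epsilon> \<gamma> ?g) \<le> ennreal \<tau>"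
          using c(2)[OF in01 gc] fin by simp
        have conv: "I \<le> \<tau> / c" if "ennreal I \<le> max (L1_rect \<epsilon> \<gamma> ?g) (L1_slice \<epsilon> \<gamma> ?g)" for I
        proof (cases "0 \<le> I")
          case True
          have "ennreal c * ennreal I \<le> ennreal \<tau>"
            using lower that by (meson mult_left_mono order_trans zero_le)
          hence "c * I \<le> \<tau>" using c(1) True \<tau>0 by (simp add: ennreal_mult[symmetric])
          thus ?thesis using c(1) by (simp add: field_simps)
        next
          case False
          thus ?thesis using \<tau>0 c(1) by (meson divide_nonneg_pos le_cases order_trans)
        qed
        have T1: "integral {-\<gamma>..\<gamma>} (\<lambda>\<eta>. integral {-\<epsilon>..\<epsilon>} (\<lambda>\<xi>. norm (?g (\<xi>, \<eta>)))) \<le> \<tau> / c"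
          by (rule conv[OF order_trans[OF L1_rect_ge[OF gc] max.cobounded1]])
        have "continuous_on {-\<epsilon>..\<epsilon>} (\<lambda>\<xi>. ?g (\<xi>, \<gamma>))"
          by (rule continuous_on_compose2[OF gc]) (use A in \<open>auto simp: closed_rect_def abs_le_iff intro!: continuous_intros\<close>)
        hence T2: "integral {-\<epsilon>..\<epsilon>} (\<lambda>\<xi>. norm (?g (\<xi>, \<gamma>))) \<le> \<tau> / c"
          by (intro conv) (simp add: L1_slice_eq[symmetric])
        let ?h = "\<lambda>x. f (x, \<gamma>) * complex_of_real (m (x, 0, \<gamma>))"
        have est: "norm (?h x) \<le> K1 C\<^sub>0 * real n powr (-\<alpha>) + (K2 * real n ^ p) ^ n * (exp (2 * C) / c * \<tau>)"
          if "x \<in> {-1..1}" "n0 \<le> n" for x n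
          using stability_estimate[OF assms(2) a b assms(6) C s(1) aC bC M0 L(2,1) H _ \<alpha> supp \<epsilon> T1 T2 n0[OF that(2)], of x] that(1) C0
          by (simp add: K1_def K2_def p_def abs_le_iff)
        have hc: "continuous_on {-1..1} ?h"
          by (intro continuous_intros continuous_on_compose2[OF fc] continuous_on_compose2[OF mc]) auto
        show "L2_norm ?h \<le> M C\<^sub>0 * log_modulus \<alpha> (enn2real (N \<epsilon> \<gamma> ?g))"
        proof (cases "\<tau> = 0")
          case True
          have "norm (?h x) \<le> 0" if "x \<in> {-1..1}" for x
          proof (rule tendsto_lowerbound)
            have "((\<lambda>n. real n powr (-\<alpha>)) \<longlongrightarrow> 0) sequentially"
              using \<alpha>(1) by (intro tendsto_neg_powr filterlim_real_sequentially) simp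
            from tendsto_mult_left[OF this, of "K1 C\<^sub>0"]
            show "(\<lambda>n. K1 C\<^sub>0 * real n powr (-\<alpha>)) \<longlonglongrightarrow> 0" by simp
            show "\<forall>\<^sub>F n in sequentially. norm (?h x) \<le> K1 C\<^sub>0 * real n powr (-\<alpha>)"
              using eventually_ge_at_top[of n0] by eventually_elim (use est[OF that] True in simp)
          qed simp
          from L2_norm_le[OF hc this] show ?thesis using True by (simp add: \<tau>_def[symmetric] log_modulus_def)
        next
          case False
          hence "0 < \<tau>" using \<tau>0 by simp
          from \<delta>(2)[OF this \<tau>d] obtain n where n: "n0 \<le> n" "real n powr (-\<alpha>) \<le> 8 * (real p + 3) * log_modulus \<alpha> \<tau>"
            "(K2 * real n ^ p) ^ n * (exp (2 * C) / c * \<tau>) \<le> real n powr (-\<alpha>)" by blast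
          have "norm (?h x) \<le> (K1 C\<^sub>0 + 1) * (8 * (real p + 3) * log_modulus \<alpha> \<tau>)" if "x \<in> {-1..1}" for x
          proof -
            have "norm (?h x) \<le> (K1 C\<^sub>0 + 1) * real n powr (-\<alpha>)"
              using est[OF that n(1)] n(3) by (simp add: algebra_simps)
            also have "\<dots> \<le> (K1 C\<^sub>0 + 1) * (8 * (real p + 3) * log_modulus \<alpha> \<tau>)"
              using K1 n(2) by (intro mult_left_mono) auto
            finally show ?thesis .
          qed
          from L2_norm_le[OF hc this] show ?thesis by (simp add: M_def \<tau>_def mult_ac)
        qed
      qed
    qed
  qed simp
qed

end
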